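(* Let $U\subset C^1$ be open and let $f:U\to\mathbb{R}^n$ be a $C^1_F$-smooth map with property (e) and with $X_f=\{\phi\in U:\phi'(0)=f(\phi)\}\neq\emptyset$. Then for every $\phi\in X_f$ there is a maximal solution $x^{\phi}:(-\infty,t_{\phi})\to\mathbb{R}^n$, $0<t_{\phi}\le\infty$, of the initial value problem $$x'(t)=f(x_t)\ \text{ for } t>0,\qquad x_0=\phi,$$ that is, $x^\phi$ is a solution on $[0,t_\phi)$, and every other solution of the same initial value problem on some interval with left endpoint $0$ is a restriction of $x^{\phi}$. The relations $$\Omega_f=\{(t,\phi)\in[0,\infty)\times X_f:t<t_{\phi}\},\qquad \Sigma_f(t,\phi)=x^{\phi}_t$$ define a continuous semiflow $\Sigma_f:\Omega_f\to X_f$ on $X_f$. For every $t\ge0$ the set $\Omega_{f,t}=\{\phi\in X_f:(t,\phi)\in\Omega_f\}$ is an open subset of $X_f$, and, in case $\Omega_{f,t}\neq\emptyset$, the time-$t$-map $\Sigma_{f,t}:\Omega_{f,t}\ni\phi\mapsto\Sigma_f(t,\phi)\in X_f$ is $C^1_F$-smooth. Moreover, for all $(t,\phi)\in\Omega_f$ and $\chi\in T_\phi X_f$, $$D\Sigma_{f,t}(\phi)\chi=v_t^{\phi,\chi},$$ where $v=v^{\phi,\chi}$ is the unique maximal continuously differentiable solution of the initial value problem $$v'(t)=Df(\Sigma_f(t,\phi))v_t\ \text{ for } t>0,\qquad v_0=\chi .$$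
   Context: Spaces. Fix $n\in\mathbb{N}$. $C$ is the Fréchet space of continuous maps $(-\infty,0]\to\mathbb{R}^n$ with the topology of locally uniform convergence (seminorms $\max_{-j\le t\le0}|\phi(t)|$, $j\in\mathbb N$). $C^1$ is the Fréchet space of continuously differentiable maps $(-\infty,0]\to\mathbb{R}^n$ with the topology of locally uniform convergence of maps and their derivatives (seminorms $\max_{-j\le t\le0}|\phi(t)|+\max_{-j\le t\le0}|\phi'(t)|$, $j\in\mathbb N$). Segments and solutions. For a map $x:(-\infty,t_e)\to\mathbb{R}^n$ and $t<t_e$, the segment $x_t:(-\infty,0]\to\mathbb{R}^n$ is $x_t(s)=x(t+s)$. A solution of $x'(t)=f(x_t)$ on $[t_0,t_e)$, $t_0<t_e\le\infty$, is a map $x:(-\infty,t_e)\to\mathbb{R}^n$ with $x_t\in U$ for all $t\in[t_0,t_e)$ whose restriction to $[t_0,t_e)$ is differentiable and satisfies the equation there; solutions on other intervals are defined accordingly. $C^1_F$-smoothness. For topological vector spaces $V,W$, $L_c(V,W)$ is the space of continuous linear maps $V\to W$; the topology $\beta$ on it is that of uniform convergence on bounded sets (basic neighbourhoods of $0$: $\{A: AB\subset N\}$ with $B\subset V$ bounded and $N$ a neighbourhood of $0$ in $W$). A continuous map $f:V\supset U\to W$, $U$ open, is $C^1_F$-smooth if all directional derivatives $Df(u)v=\lim_{0\ne t\to0}\frac1t(f(u+tv)-f(u))$, $u\in U$, $v\in V$, exist, each $Df(u):V\to W$ is linear and continuous, and $U\ni u\mapsto Df(u)\in L_c(V,W)$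 is continuous with respect to $\beta$. Property (e): each derivative $Df(\phi):C^1\to\mathbb{R}^n$, $\phi\in U$, has a linear extension $D_ef(\phi):C\to\mathbb{R}^n$, and the map $U\times C\ni(\phi,\chi)\mapsto D_ef(\phi)\chi\in\mathbb{R}^n$ is continuous. Submanifolds. A $C^1_F$-diffeomorphism is an injective $C^1_F$-map from an open subset of a Fréchet space onto an open subset of a Fréchet space with $C^1_F$-smooth inverse. A subset $M$ of a Fréchet space $F=G\oplus H$ ($G,H$ closed subspaces) is a $C^1_F$-submanifold modelled over $G$ if for each $m\in M$ there are an open neighbourhood $O$ of $m$ in $F$ and a $C^1_F$-diffeomorphism $K$ from $O$ onto an open set $W\subset F$ with $K(M\cap O)=W\cap G$; restrictions of $K^{-1}$ to $W\cap G$ are local parametrizations. $T_mM$ is the set of all $c'(0)$ for continuously differentiable curves $c$ on open intervals containing $0$ with $c(0)=m$ and values in $M$. A map $h$ from a $C^1_F$-submanifold $M$ into a Fréchet space is $C^1_F$-smooth if its compositions with local parametrizations of $M$ are $C^1_F$-smooth; its derivative at $m$ maps $c'(0)\in T_mM$ to $(h\circ c)'(0)$. A map into a submanifold is $C^1_F$-smooth if it is so as a map into the ambient space. Under the hypotheses, $X_f$ is a $C^1_F$-submanifold of codimension $n$ of $C^1$ with $T_\phi X_f=\{\chi\in C^1:\chi'(0)=Df(\phi)\chi\}$. Semiflow: $\Sigma_f(0,\phi)=\phi$ for all $\phi\in X_f$, and if $(t,\phi)\in\Omega_f$ and $(s,\Sigma_f(t,\phi))\in\Omega_f$ then $(s+t,\phi)\in\Omega_f$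 and $\Sigma_f(s+t,\phi)=\Sigma_f(s,\Sigma_f(t,\phi))$. *)

theory Defs
  imports "HOL-Analysis.Analysis"
begin

section \<open>Topological vector spaces\<close>

class topological_real_vector = real_vector + topological_ab_group_add + t2_space +
  assumes tendsto_scaleR_tvs:
    "(f \<longlongrightarrow> a) F \<Longrightarrow> (g \<longlongrightarrow> b) F \<Longrightarrow> ((\<lambda>x. f x *\<^sub>R g x) \<longlongrightarrow> a *\<^sub>R b) F"

instance real_normed_vector \<subseteq> topological_real_vector
  by standard (rule tendsto_scaleR)

text \<open>
  The topology given by an increasing sequence of seminorms (a single seminorm then suffices
  to describe a basic neighbourhood).
\<close>

definition seminorm_open :: "(nat \<Rightarrow> 'a::real_vector \<Rightarrow> real) \<Rightarrow> 'a set \<Rightarrow> bool"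
  where "seminorm_open p S \<longleftrightarrow> (\<forall>x\<in>S. \<exists>j. \<exists>e>0. {y. p j (y - x) < e} \<subseteq> S)"

lemma seminorm_open_UNIV: "seminorm_open p UNIV"
  unfolding seminorm_open_def by (auto intro: zero_less_one)

lemma seminorm_open_Int:
  assumes mono: "\<And>i j x. i \<le> j \<Longrightarrow> p i x \<le> p j x"
    and S: "seminorm_open p S" and T: "seminorm_open p T"
  shows "seminorm_open p (S \<inter> T)"
  unfolding seminorm_open_def
proof
  fix x assume x: "x \<in> S \<inter> T"
  obtain i d where i: "d > 0" "{y. p i (y - x) < d} \<subseteq> S"
    using S x unfolding seminorm_open_def by blast
  obtain j e where j: "e > 0" "{y. p j (y - x) < e} \<subseteq> T"
    using T x unfolding seminorm_open_def by blast
  have "{y. p (max i j) (y - x) < min d e} \<subseteq> S \<inter> T"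
  proof
    fix y assume y: "y \<in> {y. p (max i j) (y - x) < min d e}"
    have "p i (y - x) \<le> p (max i j) (y - x)" "p j (y - x) \<le> p (max i j) (y - x)"
      by (auto intro: mono)
    then have "p i (y - x) < d" "p j (y - x) < e" using y by auto
    then show "y \<in> S \<inter> T" using i j by blast
  qed
  then show "\<exists>j. \<exists>e>0. {y. p j (y - x) < e} \<subseteq> S \<inter> T"
    using i(1) j(1) by (metis min_less_iff_conj)
qed

lemma seminorm_open_Union:
  assumes "\<forall>S\<in>K. seminorm_open p S" shows "seminorm_open p (\<Union>K)"
  unfolding seminorm_open_def
proof
  fix x assume "x \<in> \<Union>K"
  then obtain S where S: "S \<in> K" "x \<in> S" by blast
  then obtain j e where "e > 0" "{y. p j (y - x) < e} \<subseteq> S"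
    using assms unfolding seminorm_open_def by blast
  then show "\<exists>j. \<exists>e>0. {y. p j (y - x) < e} \<subseteq> \<Union>K" using S by blast
qed

locale seminorm_family =
  fixes p :: "nat \<Rightarrow> 'a::{real_vector, topological_space} \<Rightarrow> real"
  assumes p_add: "p j (x + y) \<le> p j x + p j y"
    and p_scale: "p j (a *\<^sub>R x) = \<bar>a\<bar> * p j x"
    and p_sep: "(\<And>j. p j x = 0) \<Longrightarrow> x = 0"
    and open_iff: "open S \<longleftrightarrow> seminorm_open p S"
begin

lemma p_zero: "p j 0 = 0"
  using p_scale[of j 0 0] by simp

lemma p_minus: "p j (- x) = p j x"
  using p_scale[of j "-1" x] by simp

lemma p_nonneg: "0 \<le> p j x"
  using p_add[of j x "- x"] by (simp add: p_zero p_minus)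

lemma open_ball: "open {y. p j (y - x) < e}"
  unfolding open_iff seminorm_open_def
proof
  fix y assume y: "y \<in> {y. p j (y - x) < e}"
  have "{z. p j (z - y) < e - p j (y - x)} \<subseteq> {y. p j (y - x) < e}"
  proof
    fix z assume "z \<in> {z. p j (z - y) < e - p j (y - x)}"
    moreover have "p j (z - x) \<le> p j (z - y) + p j (y - x)"
      using p_add[of j "z - y" "y - x"] by simp
    ultimately show "z \<in> {y. p j (y - x) < e}" by simp
  qed
  then show "\<exists>i. \<exists>d>0. {z. p i (z - y) < d} \<subseteq> {y. p j (y - x) < e}"
    using y by (metis diff_gt_0_iff_gt mem_Collect_eq)
qed

lemma tendsto_seminorm:
  fixes f :: "'b \<Rightarrow> 'a"
  shows "(f \<longlongrightarrow> l) F \<longleftrightarrow> (\<forall>j. ((\<lambda>x. p j (f x - l)) \<longlongrightarrow> 0) F)"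
proof
  assume f: "(f \<longlongrightarrow> l) F"
  show "\<forall>j. ((\<lambda>x. p j (f x - l)) \<longlongrightarrow> 0) F"
  proof (intro allI tendstoI)
    fix j and e :: real assume "0 < e"
    then have "l \<in> {y. p j (y - l) < e}" by (simp add: p_zero)
    from topological_tendstoD[OF f open_ball this]
    show "\<forall>\<^sub>F x in F. dist (p j (f x - l)) 0 < e"
      by (auto simp: p_nonneg elim!: eventually_mono)
  qed
next
  assume *: "\<forall>j. ((\<lambda>x. p j (f x - l)) \<longlongrightarrow> 0) F"
  show "(f \<longlongrightarrow> l) F"
  proof (rule topological_tendstoI)
    fix S assume "open S" "l \<in> S"
    then obtain j e where je: "e > 0" "{y. p j (y - l) < e} \<subseteq> S"
      unfolding open_iff seminorm_open_def by blast
    have "\<forall>\<^sub>F x in F. dist (p j (f x - l)) 0 < e"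
      using *[rule_format, of j] je(1) by (rule tendstoD)
    then show "\<forall>\<^sub>F x in F. f x \<in> S"
      using je(2) by (auto simp: p_nonneg elim!: eventually_mono)
  qed
qed

lemma tvs_add:
  fixes f g :: "'b \<Rightarrow> 'a"
  assumes "(f \<longlongrightarrow> a) F" "(g \<longlongrightarrow> b) F" shows "((\<lambda>x. f x + g x) \<longlongrightarrow> a + b) F"
  unfolding tendsto_seminorm
proof
  fix j
  have "((\<lambda>x. p j (f x - a) + p j (g x - b)) \<longlongrightarrow> 0 + 0) F"
    using assms unfolding tendsto_seminorm by (intro tendsto_add) auto
  then have lim: "((\<lambda>x. p j (f x - a) + p j (g x - b)) \<longlongrightarrow> 0) F" by simp
  have "p j (f x + g x - (a + b)) \<le> p j (f x - a) + p j (g x - b)" for x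
    using p_add[of j "f x - a" "g x - b"] by (simp add: algebra_simps)
  then show "((\<lambda>x. p j (f x + g x - (a + b))) \<longlongrightarrow> 0) F"
    by (intro tendsto_sandwich[OF _ _ tendsto_const lim]) (simp_all add: p_nonneg)
qed

lemma tvs_minus:
  fixes f :: "'b \<Rightarrow> 'a"
  assumes "(f \<longlongrightarrow> a) F" shows "((\<lambda>x. - f x) \<longlongrightarrow> - a) F"
proof -
  have "p j (- f x + a) = p j (f x - a)" for j x
    using p_minus[of j "f x - a"] by simp
  then show ?thesis
    using assms unfolding tendsto_seminorm by simp
qed

lemma tvs_scale:
  fixes f :: "'b \<Rightarrow> real" and g :: "'b \<Rightarrow> 'a"
  assumes f: "(f \<longlongrightarrow> a) F" and g: "(g \<longlongrightarrow> b) F"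
  shows "((\<lambda>x. f x *\<^sub>R g x) \<longlongrightarrow> a *\<^sub>R b) F"
  unfolding tendsto_seminorm
proof
  fix j
  have "((\<lambda>x. \<bar>f x\<bar> * p j (g x - b) + \<bar>f x - a\<bar> * p j b) \<longlongrightarrow> \<bar>a\<bar> * 0 + \<bar>a - a\<bar> * p j b) F"
    using g unfolding tendsto_seminorm by (intro tendsto_intros f) auto
  then have lim: "((\<lambda>x. \<bar>f x\<bar> * p j (g x - b) + \<bar>f x - a\<bar> * p j b) \<longlongrightarrow> 0) F" by simp
  have "p j (f x *\<^sub>R g x - a *\<^sub>R b) \<le> \<bar>f x\<bar> * p j (g x - b) + \<bar>f x - a\<bar> * p j b" for x
  proof -
    have "f x *\<^sub>R g x - a *\<^sub>R b = f x *\<^sub>R (g x - b) + (f x - a) *\<^sub>R b"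
      by (simp add: algebra_simps)
    then show ?thesis
      using p_add[of j "f x *\<^sub>R (g x - b)" "(f x - a) *\<^sub>R b"] by (simp only: p_scale)
  qed
  then show "((\<lambda>x. p j (f x *\<^sub>R g x - a *\<^sub>R b)) \<longlongrightarrow> 0) F"
    by (intro tendsto_sandwich[OF _ _ tendsto_const lim]) (simp_all add: p_nonneg)
qed

lemma tvs_hausdorff:
  fixes x y :: 'a
  assumes "x \<noteq> y" shows "\<exists>S T. open S \<and> open T \<and> x \<in> S \<and> y \<in> T \<and> S \<inter> T = {}"
proof -
  obtain j where "p j (y - x) \<noteq> 0" using p_sep[of "y - x"] assms by auto
  then have pos: "p j (y - x) > 0" using p_nonneg[of j "y - x"] by simp
  let ?B = "\<lambda>z. {w. p j (w - z) < p j (y - x) / 2}"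
  have "?B x \<inter> ?B y = {}"
  proof (rule ccontr)
    assume "?B x \<inter> ?B y \<noteq> {}"
    then obtain z where z: "p j (z - x) < p j (y - x) / 2" "p j (z - y) < p j (y - x) / 2"
      by blast
    have "p j (y - x) \<le> p j (z - x) + p j (z - y)"
      using p_add[of j "z - x" "- (z - y)"] p_minus[of j "z - y"] by (simp add: algebra_simps)
    then show False using z by simp
  qed
  moreover have "x \<in> ?B x" "y \<in> ?B y" using pos by (simp_all add: p_zero)
  moreover have "open (?B x)" "open (?B y)" by (rule open_ball)+
  ultimately show ?thesis by metis
qed

end


section \<open>The spaces of continuous and of continuously differentiable maps on the half-line\<close>

text \<open>
  Maps on the half-line $(-\infty,0]$ are represented by total maps vanishing on $(0,\infty)$.
  The derivative at $0$ is the one-sided one.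
\<close>

definition c_maps :: "(real \<Rightarrow> real ^ 'n) set"
  where "c_maps = {\<phi>. continuous_on {..0} \<phi> \<and> (\<forall>s>0. \<phi> s = 0)}"

definition c1_maps :: "(real \<Rightarrow> real ^ 'n) set"
  where "c1_maps = {\<phi>. (\<exists>\<phi>'. continuous_on {..0} \<phi>' \<and>
            (\<forall>s\<le>0. (\<phi> has_vector_derivative \<phi>' s) (at s within {..0}))) \<and> (\<forall>s>0. \<phi> s = 0)}"

definition half_deriv :: "(real \<Rightarrow> real ^ 'n) \<Rightarrow> real \<Rightarrow> real ^ 'n"
  where "half_deriv \<phi> s = vector_derivative \<phi> (at s within {..0})"

definition max_norm :: "nat \<Rightarrow> (real \<Rightarrow> real ^ 'n) \<Rightarrow> real"
  where "max_norm j \<phi> = (SUP t\<in>{- real j..0}. norm (\<phi> t))"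

lemma half_derivI:
  assumes "(\<phi> has_vector_derivative d) (at s within {..0})" "s \<le> 0"
  shows "half_deriv \<phi> s = d"
proof -
  have "at s within {..0::real} \<noteq> bot"
  proof -
    have "at s within {s - 1..s} \<le> at s within {..0}"
      using assms(2) by (intro at_le) auto
    moreover have "at s within {s - 1..s} \<noteq> bot"
      by (simp add: trivial_limit_within islimpt_Icc)
    ultimately show ?thesis by (metis bot.extremum_uniqueI)
  qed
  then show ?thesis
    unfolding half_deriv_def using assms(1) by (rule vector_derivative_within)
qed

lemma c1_mapsD:
  assumes "\<phi> \<in> c1_maps"
  shows "continuous_on {..0} (half_deriv \<phi>)"
    and "\<And>s. s \<le> 0 \<Longrightarrow> (\<phi> has_vector_derivative half_deriv \<phi> s) (at s within {..0})"
    and "\<And>s. s > 0 \<Longrightarrow> \<phi> s = 0"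
    and "continuous_on {..0} \<phi>"
proof -
  obtain \<phi>' where c: "continuous_on {..0} \<phi>'"
    and d: "\<And>s. s \<le> 0 \<Longrightarrow> (\<phi> has_vector_derivative \<phi>' s) (at s within {..0})"
    using assms unfolding c1_maps_def by blast
  have eq: "half_deriv \<phi> s = \<phi>' s" if "s \<le> 0" for s
    using half_derivI[OF d] that by simp
  show "continuous_on {..0} (half_deriv \<phi>)"
    using c by (rule continuous_on_eq) (simp add: eq)
  show "\<And>s. s \<le> 0 \<Longrightarrow> (\<phi> has_vector_derivative half_deriv \<phi> s) (at s within {..0})"
    using d eq by simp
  show "\<And>s. s > 0 \<Longrightarrow> \<phi> s = 0"
    using assms unfolding c1_maps_def by blast
  show "continuous_on {..0} \<phi>"
    unfolding continuous_on_eq_continuous_within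
    using d has_vector_derivative_continuous by fastforce
qed

lemma c1_mapsI:
  assumes "continuous_on {..0} \<phi>'"
    and "\<And>s. s \<le> 0 \<Longrightarrow> (\<phi> has_vector_derivative \<phi>' s) (at s within {..0})"
    and "\<And>s. s > 0 \<Longrightarrow> \<phi> s = 0"
  shows "\<phi> \<in> c1_maps"
  using assms unfolding c1_maps_def by blast

lemma zero_c1: "(\<lambda>_. 0) \<in> c1_maps"
  by (rule c1_mapsI[of "\<lambda>_. 0"]) simp_all

lemma add_c1:
  assumes "\<phi> \<in> c1_maps" "\<psi> \<in> c1_maps" shows "(\<lambda>s. \<phi> s + \<psi> s) \<in> c1_maps"
proof (rule c1_mapsI)
  show "continuous_on {..0} (\<lambda>s. half_deriv \<phi> s + half_deriv \<psi> s)"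
    using assms by (intro continuous_on_add c1_mapsD(1))
  show "((\<lambda>s. \<phi> s + \<psi> s) has_vector_derivative half_deriv \<phi> s + half_deriv \<psi> s) (at s within {..0})"
    if "s \<le> 0" for s
    using assms that by (intro has_vector_derivative_add c1_mapsD(2))
  show "\<phi> s + \<psi> s = 0" if "s > 0" for s
    using c1_mapsD(3)[OF assms(1) that] c1_mapsD(3)[OF assms(2) that] by simp
qed

lemma scale_c1:
  assumes "\<phi> \<in> c1_maps" shows "(\<lambda>s. a *\<^sub>R \<phi> s) \<in> c1_maps"
proof (rule c1_mapsI)
  show "continuous_on {..0} (\<lambda>s. a *\<^sub>R half_deriv \<phi> s)"
    using assms by (intro continuous_on_scaleR continuous_on_const c1_mapsD(1))
  show "((\<lambda>s. a *\<^sub>R \<phi> s) has_vector_derivative a *\<^sub>R half_deriv \<phi> s) (at s within {..0})"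
    if "s \<le> 0" for s
    by (rule bounded_linear.has_vector_derivative[OF bounded_linear_scaleR_right c1_mapsD(2)[OF assms that]])
  show "a *\<^sub>R \<phi> s = 0" if "s > 0" for s
    using c1_mapsD(3)[OF assms that] by simp
qed

lemma minus_c1: "\<phi> \<in> c1_maps \<Longrightarrow> (\<lambda>s. - \<phi> s) \<in> c1_maps"
  using scale_c1[of \<phi> "-1"] by simp

lemma diff_c1: "\<phi> \<in> c1_maps \<Longrightarrow> \<psi> \<in> c1_maps \<Longrightarrow> (\<lambda>s. \<phi> s - \<psi> s) \<in> c1_maps"
  using add_c1[of \<phi> "\<lambda>s. - \<psi> s"] minus_c1[of \<psi>] by simp

lemma half_deriv_add:
  "\<phi> \<in> c1_maps \<Longrightarrow> \<psi> \<in> c1_maps \<Longrightarrow> s \<le> 0 \<Longrightarrow>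
    half_deriv (\<lambda>s. \<phi> s + \<psi> s) s = half_deriv \<phi> s + half_deriv \<psi> s"
  by (intro half_derivI has_vector_derivative_add c1_mapsD(2))

lemma half_deriv_scale:
  "\<phi> \<in> c1_maps \<Longrightarrow> s \<le> 0 \<Longrightarrow> half_deriv (\<lambda>s. a *\<^sub>R \<phi> s) s = a *\<^sub>R half_deriv \<phi> s"
  by (intro half_derivI bounded_linear.has_vector_derivative[OF bounded_linear_scaleR_right]
      c1_mapsD(2))

lemma norm_le_max_norm:
  assumes "continuous_on {..0} \<phi>" "t \<in> {- real j..0}" shows "norm (\<phi> t) \<le> max_norm j \<phi>"
proof -
  have "compact ((\<lambda>t. norm (\<phi> t)) ` {- real j..0})"
    by (intro compact_continuous_image continuous_on_norm continuous_on_subset[OF assms(1)]) auto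
  then have "bdd_above ((\<lambda>t. norm (\<phi> t)) ` {- real j..0})"
    by (intro bounded_imp_bdd_above compact_imp_bounded)
  then show ?thesis
    unfolding max_norm_def using assms(2) by (rule cSUP_upper2) auto
qed

lemma max_norm_le: "(\<And>t. t \<in> {- real j..0} \<Longrightarrow> norm (\<phi> t) \<le> b) \<Longrightarrow> max_norm j \<phi> \<le> b"
  unfolding max_norm_def by (rule cSUP_least) auto

lemma max_norm_cong: "(\<And>t. t \<le> 0 \<Longrightarrow> \<phi> t = \<psi> t) \<Longrightarrow> max_norm j \<phi> = max_norm j \<psi>"
  unfolding max_norm_def by (rule SUP_cong) auto

lemma max_norm_nonneg: "continuous_on {..0} \<phi> \<Longrightarrow> 0 \<le> max_norm j \<phi>"
  using norm_le_max_norm[of \<phi> 0 j] order_trans[OF norm_ge_zero[of "\<phi> 0"]] by auto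

lemma max_norm_mono:
  "continuous_on {..0} \<phi> \<Longrightarrow> i \<le> j \<Longrightarrow> max_norm i \<phi> \<le> max_norm j \<phi>"
  by (rule max_norm_le, rule norm_le_max_norm) auto

lemma max_norm_add:
  assumes "continuous_on {..0} \<phi>" "continuous_on {..0} \<psi>"
  shows "max_norm j (\<lambda>s. \<phi> s + \<psi> s) \<le> max_norm j \<phi> + max_norm j \<psi>"
  by (rule max_norm_le, rule norm_triangle_le) (intro add_mono norm_le_max_norm assms)

lemma max_norm_scale:
  assumes "continuous_on {..0} \<phi>"
  shows "max_norm j (\<lambda>s. a *\<^sub>R \<phi> s) = \<bar>a\<bar> * max_norm j \<phi>"
proof (rule antisym)
  show "max_norm j (\<lambda>s. a *\<^sub>R \<phi> s) \<le> \<bar>a\<bar> * max_norm j \<phi>"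
    by (rule max_norm_le) (auto intro!: mult_left_mono norm_le_max_norm assms)
  show "\<bar>a\<bar> * max_norm j \<phi> \<le> max_norm j (\<lambda>s. a *\<^sub>R \<phi> s)"
  proof (cases "a = 0")
    case True
    then show ?thesis by (auto intro: max_norm_nonneg continuous_on_const)
  next
    case False
    have "max_norm j \<phi> \<le> max_norm j (\<lambda>s. a *\<^sub>R \<phi> s) / \<bar>a\<bar>"
    proof (rule max_norm_le)
      fix t assume "t \<in> {- real j..0}"
      then have "norm (a *\<^sub>R \<phi> t) \<le> max_norm j (\<lambda>s. a *\<^sub>R \<phi> s)"
        by (intro norm_le_max_norm continuous_on_scaleR continuous_on_const assms)
      then show "norm (\<phi> t) \<le> max_norm j (\<lambda>s. a *\<^sub>R \<phi> s) / \<bar>a\<bar>"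
        using False by (simp add: field_simps)
    qed
    then show ?thesis using False by (simp add: field_simps)
  qed
qed

lemma max_norm_eq_0:
  assumes "continuous_on {..0} \<phi>" "\<And>j. max_norm j \<phi> = 0" "t \<le> 0" shows "\<phi> t = 0"
proof -
  obtain j :: nat where "- t \<le> real j" using real_arch_simple by blast
  then have "norm (\<phi> t) \<le> max_norm j \<phi>" using assms(3) by (intro norm_le_max_norm assms(1)) auto
  then show ?thesis using assms(2) by simp
qed

typedef 'n c_space = "c_maps :: (real \<Rightarrow> real ^ 'n) set"
  morphisms c_fun Abs_c_space
  by (rule exI[of _ "\<lambda>_. 0"]) (auto simp: c_maps_def)

typedef 'n c1_space = "c1_maps :: (real \<Rightarrow> real ^ 'n) set"
  morphisms c1_fun Abs_c1_space
  using zero_c1 by blast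

setup_lifting type_definition_c_space
setup_lifting type_definition_c1_space

instantiation c_space :: (finite) real_vector
begin
lift_definition zero_c_space :: "'a c_space" is "\<lambda>_. 0"
  by (simp add: c_maps_def)
lift_definition plus_c_space :: "'a c_space \<Rightarrow> 'a c_space \<Rightarrow> 'a c_space" is "\<lambda>\<phi> \<psi> s. \<phi> s + \<psi> s"
  by (auto simp: c_maps_def intro: continuous_on_add)
lift_definition minus_c_space :: "'a c_space \<Rightarrow> 'a c_space \<Rightarrow> 'a c_space" is "\<lambda>\<phi> \<psi> s. \<phi> s - \<psi> s"
  by (auto simp: c_maps_def intro: continuous_on_diff)
lift_definition uminus_c_space :: "'a c_space \<Rightarrow> 'a c_space" is "\<lambda>\<phi> s. - \<phi> s"
  by (auto simp: c_maps_def intro: continuous_on_minus)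
lift_definition scaleR_c_space :: "real \<Rightarrow> 'a c_space \<Rightarrow> 'a c_space" is "\<lambda>a \<phi> s. a *\<^sub>R \<phi> s"
  by (auto simp: c_maps_def intro: continuous_on_scaleR continuous_on_const)
instance
  by standard (transfer, auto simp: algebra_simps fun_eq_iff)+
end

instantiation c1_space :: (finite) real_vector
begin
lift_definition zero_c1_space :: "'a c1_space" is "\<lambda>_. 0"
  by (rule zero_c1)
lift_definition plus_c1_space :: "'a c1_space \<Rightarrow> 'a c1_space \<Rightarrow> 'a c1_space" is "\<lambda>\<phi> \<psi> s. \<phi> s + \<psi> s"
  by (rule add_c1)
lift_definition minus_c1_space :: "'a c1_space \<Rightarrow> 'a c1_space \<Rightarrow> 'a c1_space" is "\<lambda>\<phi> \<psi> s. \<phi> s - \<psi> s"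
  by (rule diff_c1)
lift_definition uminus_c1_space :: "'a c1_space \<Rightarrow> 'a c1_space" is "\<lambda>\<phi> s. - \<phi> s"
  by (rule minus_c1)
lift_definition scaleR_c1_space :: "real \<Rightarrow> 'a c1_space \<Rightarrow> 'a c1_space" is "\<lambda>a \<phi> s. a *\<^sub>R \<phi> s"
  by (rule scale_c1)
instance
  by standard (transfer, auto simp: algebra_simps fun_eq_iff)+
end

definition c_seminorm :: "nat \<Rightarrow> 'n::finite c_space \<Rightarrow> real"
  where "c_seminorm j \<phi> = max_norm j (c_fun \<phi>)"

definition c1_seminorm :: "nat \<Rightarrow> 'n::finite c1_space \<Rightarrow> real"
  where "c1_seminorm j \<phi> = max_norm j (c1_fun \<phi>) + max_norm j (half_deriv (c1_fun \<phi>))"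

lemma continuous_c_fun: "continuous_on {..0} (c_fun \<phi>)"
  using c_fun[of \<phi>] by (simp add: c_maps_def)

lemma continuous_c1_fun: "continuous_on {..0} (c1_fun \<phi>)"
  by (rule c1_mapsD(4)[OF c1_fun])

lemma continuous_half_deriv: "continuous_on {..0} (half_deriv (c1_fun \<phi>))"
  by (rule c1_mapsD(1)[OF c1_fun])

instantiation c_space :: (finite) topological_space
begin
definition open_c_space :: "'a c_space set \<Rightarrow> bool"
  where "open_c_space = seminorm_open c_seminorm"
instance
proof
  have mono: "\<And>i j x. i \<le> j \<Longrightarrow> c_seminorm i x \<le> c_seminorm j (x :: 'a c_space)"
    unfolding c_seminorm_def by (intro max_norm_mono continuous_c_fun)
  show "open (UNIV :: 'a c_space set)"
    unfolding open_c_space_def by (rule seminorm_open_UNIV)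
  show "open (S \<inter> T)" if "open S" "open T" for S T :: "'a c_space set"
    using that unfolding open_c_space_def by (intro seminorm_open_Int mono)
  show "open (\<Union>K)" if "\<forall>S\<in>K. open S" for K :: "'a c_space set set"
    using that unfolding open_c_space_def by (rule seminorm_open_Union)
qed
end

instantiation c1_space :: (finite) topological_space
begin
definition open_c1_space :: "'a c1_space set \<Rightarrow> bool"
  where "open_c1_space = seminorm_open c1_seminorm"
instance
proof
  have mono: "\<And>i j x. i \<le> j \<Longrightarrow> c1_seminorm i x \<le> c1_seminorm j (x :: 'a c1_space)"
    unfolding c1_seminorm_def
    by (intro add_mono max_norm_mono continuous_c1_fun continuous_half_deriv)
  show "open (UNIV :: 'a c1_space set)"
    unfolding open_c1_space_def by (rule seminorm_open_UNIV)
  show "open (S \<inter> T)" if "open S" "open T" for S T :: "'a c1_space set"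
    using that unfolding open_c1_space_def by (intro seminorm_open_Int mono)
  show "open (\<Union>K)" if "\<forall>S\<in>K. open S" for K :: "'a c1_space set set"
    using that unfolding open_c1_space_def by (rule seminorm_open_Union)
qed
end

interpretation c_space: seminorm_family "c_seminorm :: nat \<Rightarrow> 'n::finite c_space \<Rightarrow> real"
proof
  fix j and a :: real and x y :: "'n c_space" and S :: "'n c_space set"
  show "c_seminorm j (x + y) \<le> c_seminorm j x + c_seminorm j y"
    unfolding c_seminorm_def plus_c_space.rep_eq by (intro max_norm_add continuous_c_fun)
  show "c_seminorm j (a *\<^sub>R x) = \<bar>a\<bar> * c_seminorm j x"
    unfolding c_seminorm_def scaleR_c_space.rep_eq by (intro max_norm_scale continuous_c_fun)
  show "open S = seminorm_open c_seminorm S"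
    by (simp add: open_c_space_def)
  show "x = 0" if "\<And>j. c_seminorm j x = 0"
  proof -
    have "c_fun x t = 0" for t
      using that max_norm_eq_0[OF continuous_c_fun, of x t] c_fun[of x]
      unfolding c_seminorm_def c_maps_def by (cases "t \<le> 0") auto
    then show ?thesis by (simp add: c_fun_inject[symmetric] zero_c_space.rep_eq fun_eq_iff)
  qed
qed

interpretation c1_space: seminorm_family "c1_seminorm :: nat \<Rightarrow> 'n::finite c1_space \<Rightarrow> real"
proof
  fix j and a :: real and x y :: "'n c1_space" and S :: "'n c1_space set"
  have "max_norm j (half_deriv (c1_fun (x + y)))
      = max_norm j (\<lambda>s. half_deriv (c1_fun x) s + half_deriv (c1_fun y) s)"
    by (rule max_norm_cong) (simp add: plus_c1_space.rep_eq half_deriv_add[OF c1_fun c1_fun])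
  also have "\<dots> \<le> max_norm j (half_deriv (c1_fun x)) + max_norm j (half_deriv (c1_fun y))"
    by (intro max_norm_add continuous_half_deriv)
  finally show "c1_seminorm j (x + y) \<le> c1_seminorm j x + c1_seminorm j y"
    using max_norm_add[OF continuous_c1_fun continuous_c1_fun, of j x y]
    unfolding c1_seminorm_def by (simp add: plus_c1_space.rep_eq)
  have "max_norm j (half_deriv (c1_fun (a *\<^sub>R x)))
      = max_norm j (\<lambda>s. a *\<^sub>R half_deriv (c1_fun x) s)"
    by (rule max_norm_cong) (simp add: scaleR_c1_space.rep_eq half_deriv_scale[OF c1_fun])
  also have "\<dots> = \<bar>a\<bar> * max_norm j (half_deriv (c1_fun x))"
    by (intro max_norm_scale continuous_half_deriv)
  finally show "c1_seminorm j (a *\<^sub>R x) = \<bar>a\<bar> * c1_seminorm j x"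
    using max_norm_scale[OF continuous_c1_fun, of j a x]
    unfolding c1_seminorm_def by (simp add: scaleR_c1_space.rep_eq distrib_left)
  show "open S = seminorm_open c1_seminorm S"
    by (simp add: open_c1_space_def)
  show "x = 0" if "\<And>j. c1_seminorm j x = 0"
  proof -
    have "max_norm j (c1_fun x) = 0" for j
      using that[of j] max_norm_nonneg[OF continuous_c1_fun, of j x]
        max_norm_nonneg[OF continuous_half_deriv, of j x] unfolding c1_seminorm_def by simp
    then have "c1_fun x t = 0" for t
      using max_norm_eq_0[OF continuous_c1_fun, of x t] c1_mapsD(3)[OF c1_fun, of t x]
      by (cases "t \<le> 0") auto
    then show ?thesis by (simp add: c1_fun_inject[symmetric] zero_c1_space.rep_eq fun_eq_iff)
  qed
qed

instance c_space :: (finite) topological_real_vector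
proof
  show "((\<lambda>x. fst x + snd x) \<longlongrightarrow> a + b) (nhds a \<times>\<^sub>F nhds b)" for a b :: "'a c_space"
    by (intro c_space.tvs_add filterlim_fst filterlim_snd)
  show "(uminus \<longlongrightarrow> - a) (nhds a)" for a :: "'a c_space"
    using c_space.tvs_minus[OF filterlim_ident] .
  show "((\<lambda>x. f x *\<^sub>R g x) \<longlongrightarrow> a *\<^sub>R b) F" if "(f \<longlongrightarrow> a) F" "(g \<longlongrightarrow> b) F"
    for f :: "'b \<Rightarrow> real" and g :: "'b \<Rightarrow> 'a c_space" and a b F
    using that by (rule c_space.tvs_scale)
  show "\<exists>S T. open S \<and> open T \<and> x \<in> S \<and> y \<in> T \<and> S \<inter> T = {}" if "x \<noteq> y" for x y :: "'a c_space"
    using that by (rule c_space.tvs_hausdorff)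
qed

instance c1_space :: (finite) topological_real_vector
proof
  show "((\<lambda>x. fst x + snd x) \<longlongrightarrow> a + b) (nhds a \<times>\<^sub>F nhds b)" for a b :: "'a c1_space"
    by (intro c1_space.tvs_add filterlim_fst filterlim_snd)
  show "(uminus \<longlongrightarrow> - a) (nhds a)" for a :: "'a c1_space"
    using c1_space.tvs_minus[OF filterlim_ident] .
  show "((\<lambda>x. f x *\<^sub>R g x) \<longlongrightarrow> a *\<^sub>R b) F" if "(f \<longlongrightarrow> a) F" "(g \<longlongrightarrow> b) F"
    for f :: "'b \<Rightarrow> real" and g :: "'b \<Rightarrow> 'a c1_space" and a b F
    using that by (rule c1_space.tvs_scale)
  show "\<exists>S T. open S \<and> open T \<and> x \<in> S \<and> y \<in> T \<and> S \<inter> T = {}" if "x \<noteq> y" for x y :: "'a c1_space"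
    using that by (rule c1_space.tvs_hausdorff)
qed

lift_definition c1_to_c :: "'n::finite c1_space \<Rightarrow> 'n c_space" is "\<lambda>\<phi>. \<phi>"
  using c1_mapsD(3,4) by (auto simp: c_maps_def)


section \<open>Smoothness in the sense of Frechet\<close>

definition has_dir_deriv ::
    "('a::topological_real_vector \<Rightarrow> 'b::topological_real_vector) \<Rightarrow> 'a \<Rightarrow> 'a \<Rightarrow> 'b \<Rightarrow> bool"
  where "has_dir_deriv f u v w \<longleftrightarrow>
    ((\<lambda>t::real. (1 / t) *\<^sub>R (f (u + t *\<^sub>R v) - f u)) \<longlongrightarrow> w) (at 0)"

definition dir_deriv ::
    "('a::topological_real_vector \<Rightarrow> 'b::topological_real_vector) \<Rightarrow> 'a \<Rightarrow> 'a \<Rightarrow> 'b"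
  where "dir_deriv f u v = Lim (at 0) (\<lambda>t::real. (1 / t) *\<^sub>R (f (u + t *\<^sub>R v) - f u))"

definition tvs_bounded :: "'a::topological_real_vector set \<Rightarrow> bool"
  where "tvs_bounded B \<longleftrightarrow>
    (\<forall>N. open N \<and> 0 \<in> N \<longrightarrow> (\<exists>r>0. \<forall>s\<ge>r. B \<subseteq> (\<lambda>x. s *\<^sub>R x) ` N))"

text \<open>
  The domain of the maps below is a linear subspace \<open>G\<close> with the relative topology, because
  local parametrizations of submanifolds are defined on open subsets of a closed subspace.
  Members of \<open>cont_linear_maps G\<close> are total functions of which only the restriction to \<open>G\<close> is
  relevant; \<open>beta_topology G\<close> does not distinguish functions agreeing on \<open>G\<close>.
\<close>

definition linear_map_on :: "'a::real_vector set \<Rightarrow> ('a \<Rightarrow> 'b::real_vector) \<Rightarrow> bool"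
  where "linear_map_on G A \<longleftrightarrow>
    (\<forall>x\<in>G. \<forall>y\<in>G. A (x + y) = A x + A y) \<and> (\<forall>a. \<forall>x\<in>G. A (a *\<^sub>R x) = a *\<^sub>R A x)"

definition cont_linear_maps ::
    "'a::topological_real_vector set \<Rightarrow> ('a \<Rightarrow> 'b::topological_real_vector) set"
  where "cont_linear_maps G = {A. linear_map_on G A \<and> continuous_on G A}"

definition beta_open ::
    "'a::topological_real_vector set \<Rightarrow> ('a \<Rightarrow> 'b::topological_real_vector) set \<Rightarrow> bool"
  where "beta_open G S \<longleftrightarrow> S \<subseteq> cont_linear_maps G \<and>
    (\<forall>A\<in>S. \<exists>B N. B \<subseteq> G \<and> tvs_bounded B \<and> open N \<and> 0 \<in> N \<and>
      {A' \<in> cont_linear_maps G. \<forall>b\<in>B. A' b - A b \<in> N} \<subseteq> S)"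

definition beta_topology ::
    "'a::topological_real_vector set \<Rightarrow> ('a \<Rightarrow> 'b::topological_real_vector) topology"
  where "beta_topology G = topology (beta_open G)"

lemma tvs_bounded_Un:
  assumes "tvs_bounded B" "tvs_bounded B'" shows "tvs_bounded (B \<union> B')"
  unfolding tvs_bounded_def
proof (intro allI impI)
  fix N :: "'a set" assume N: "open N \<and> 0 \<in> N"
  obtain r where r: "r > 0" "\<forall>s\<ge>r. B \<subseteq> (\<lambda>x. s *\<^sub>R x) ` N"
    using assms(1) N unfolding tvs_bounded_def by blast
  obtain r' where r': "r' > 0" "\<forall>s\<ge>r'. B' \<subseteq> (\<lambda>x. s *\<^sub>R x) ` N"
    using assms(2) N unfolding tvs_bounded_def by blast
  have "\<forall>s\<ge>max r r'. B \<union> B' \<subseteq> (\<lambda>x. s *\<^sub>R x) ` N"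
    using r(2) r'(2) by (simp add: Un_least)
  then show "\<exists>r>0. \<forall>s\<ge>r. B \<union> B' \<subseteq> (\<lambda>x. s *\<^sub>R x) ` N"
    using r(1) by (intro exI[of _ "max r r'"]) auto
qed

lemma beta_openE:
  assumes "beta_open G S" "A \<in> S"
  obtains B N where "B \<subseteq> G" "tvs_bounded B" "open N" "0 \<in> N"
    "{A' \<in> cont_linear_maps G. \<forall>b\<in>B. A' b - A b \<in> N} \<subseteq> S"
  using bspec[OF conjunct2[OF assms(1)[unfolded beta_open_def]] assms(2)] by (elim exE conjE)

lemma beta_openI:
  assumes "S \<subseteq> cont_linear_maps G"
    and "\<And>A. A \<in> S \<Longrightarrow> \<exists>B N. B \<subseteq> G \<and> tvs_bounded B \<and> open N \<and> 0 \<in> N \<and>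
      {A' \<in> cont_linear_maps G. \<forall>b\<in>B. A' b - A b \<in> N} \<subseteq> S"
  shows "beta_open G S"
  unfolding beta_open_def using assms by (intro conjI ballI)

lemma beta_open_subset: "beta_open G S \<Longrightarrow> S \<subseteq> cont_linear_maps G"
  unfolding beta_open_def by (rule conjunct1)

lemma istopology_beta:
  "istopology (beta_open G :: ('a::topological_real_vector \<Rightarrow> 'b::topological_real_vector) set \<Rightarrow> bool)"
  unfolding istopology_def
proof (intro conjI allI impI)
  fix S T :: "('a \<Rightarrow> 'b) set"
  assume S: "beta_open G S" and T: "beta_open G T"
  show "beta_open G (S \<inter> T)"
  proof (rule beta_openI)
    show "S \<inter> T \<subseteq> cont_linear_maps G" using beta_open_subset[OF S] by (rule le_infI1)
    fix A assume A: "A \<in> S \<inter> T"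
    obtain B N where B: "B \<subseteq> G" "tvs_bounded B" and N: "open N" "0 \<in> N"
      and sub: "{A' \<in> cont_linear_maps G. \<forall>b\<in>B. A' b - A b \<in> N} \<subseteq> S"
      using beta_openE[OF S IntD1[OF A]] .
    obtain B' N' where B': "B' \<subseteq> G" "tvs_bounded B'" and N': "open N'" "0 \<in> N'"
      and sub': "{A' \<in> cont_linear_maps G. \<forall>b\<in>B'. A' b - A b \<in> N'} \<subseteq> T"
      using beta_openE[OF T IntD2[OF A]] .
    have "{A' \<in> cont_linear_maps G. \<forall>b\<in>B \<union> B'. A' b - A b \<in> N \<inter> N'} \<subseteq> S \<inter> T"
    proof
      fix A' assume "A' \<in> {A' \<in> cont_linear_maps G. \<forall>b\<in>B \<union> B'. A' b - A b \<in> N \<inter> N'}"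
      then show "A' \<in> S \<inter> T" using subsetD[OF sub, of A'] subsetD[OF sub', of A'] by simp
    qed
    with B B' N N' show "\<exists>B N. B \<subseteq> G \<and> tvs_bounded B \<and> open N \<and> 0 \<in> N \<and>
        {A' \<in> cont_linear_maps G. \<forall>b\<in>B. A' b - A b \<in> N} \<subseteq> S \<inter> T"
      by (intro exI[of _ "B \<union> B'"] exI[of _ "N \<inter> N'"] conjI tvs_bounded_Un open_Int Un_least IntI)
  qed
next
  fix K :: "('a \<Rightarrow> 'b) set set"
  assume K: "\<forall>S\<in>K. beta_open G S"
  show "beta_open G (\<Union>K)"
  proof (rule beta_openI)
    show "\<Union>K \<subseteq> cont_linear_maps G" by (intro Union_least beta_open_subset bspec[OF K])
    fix A assume "A \<in> \<Union>K"
    then obtain S where S: "S \<in> K" "A \<in> S" by (rule UnionE)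
    obtain B N where *: "B \<subseteq> G" "tvs_bounded B" "open N" "0 \<in> N"
      and sub: "{A' \<in> cont_linear_maps G. \<forall>b\<in>B. A' b - A b \<in> N} \<subseteq> S"
      using beta_openE[OF bspec[OF K S(1)] S(2)] .
    show "\<exists>B N. B \<subseteq> G \<and> tvs_bounded B \<and> open N \<and> 0 \<in> N \<and>
        {A' \<in> cont_linear_maps G. \<forall>b\<in>B. A' b - A b \<in> N} \<subseteq> \<Union>K"
      using * subset_trans[OF sub Union_upper[OF S(1)]] by (intro exI[of _ B] exI[of _ N] conjI)
  qed
qed

lemma openin_beta_topology: "openin (beta_topology G) = beta_open G"
  unfolding beta_topology_def using istopology_beta by (rule topology_inverse')

lemma topspace_beta_topology:
  "topspace (beta_topology G) =
    (cont_linear_maps G :: ('a::topological_real_vector \<Rightarrow> 'b::topological_real_vector) set)"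
proof -
  have "beta_open G (cont_linear_maps G :: ('a \<Rightarrow> 'b) set)"
    unfolding beta_open_def
  proof (intro conjI ballI)
    fix A :: "'a \<Rightarrow> 'b"
    have "tvs_bounded ({} :: 'a set)"
      unfolding tvs_bounded_def by (auto intro: zero_less_one)
    then show "\<exists>B N. B \<subseteq> G \<and> tvs_bounded B \<and> open N \<and> 0 \<in> N \<and>
        {A' \<in> cont_linear_maps G. \<forall>b\<in>B. A' b - A b \<in> N} \<subseteq> cont_linear_maps G"
      by (intro exI[of _ "{}"] exI[of _ UNIV]) auto
  qed simp
  then have "openin (beta_topology G) (cont_linear_maps G :: ('a \<Rightarrow> 'b) set)"
    unfolding openin_beta_topology .
  then have "cont_linear_maps G \<subseteq> topspace (beta_topology G :: ('a \<Rightarrow> 'b) topology)"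
    by (rule openin_subset)
  moreover have "topspace (beta_topology G :: ('a \<Rightarrow> 'b) topology) \<subseteq> cont_linear_maps G"
    using openin_topspace[of "beta_topology G"] unfolding openin_beta_topology
    by (rule beta_open_subset)
  ultimately show ?thesis by (rule antisym[rotated])
qed

text \<open>
  \<open>f\<close> is smooth on the relatively open subset \<open>U\<close> of the subspace \<open>G\<close>; linearity and continuity
  of the derivatives are part of \<open>continuous_map\<close> (see \<open>topspace_beta_topology\<close>).
\<close>

definition C1F_on ::
    "'a::topological_real_vector set \<Rightarrow> 'a set \<Rightarrow> ('a \<Rightarrow> 'b::topological_real_vector) \<Rightarrow> bool"
  where "C1F_on G U f \<longleftrightarrow> subspace G \<and> openin (top_of_set G) U \<and> continuous_on U f \<and>
    (\<forall>u\<in>U. \<forall>v\<in>G. \<exists>w. has_dir_deriv f u v w) \<and>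
    continuous_map (top_of_set U) (beta_topology G) (dir_deriv f)"


section \<open>Submanifolds\<close>

definition C1F_diffeo ::
    "'a::topological_real_vector set \<Rightarrow> 'b::topological_real_vector set \<Rightarrow> ('a \<Rightarrow> 'b) \<Rightarrow> bool"
  where "C1F_diffeo V W K \<longleftrightarrow> bij_betw K V W \<and> C1F_on UNIV V K \<and> C1F_on UNIV W (inv_into V K)"

definition closed_complemented :: "'a::topological_real_vector set \<Rightarrow> bool"
  where "closed_complemented G \<longleftrightarrow> subspace G \<and> closed G \<and>
    (\<exists>H. subspace H \<and> closed H \<and> G \<inter> H = {0} \<and> {g + h | g h. g \<in> G \<and> h \<in> H} = UNIV)"

definition submanifold_chart ::
    "'a::topological_real_vector set \<Rightarrow> 'a set \<Rightarrow> 'a set \<Rightarrow> 'a set \<Rightarrow> ('a \<Rightarrow> 'a) \<Rightarrow> bool"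
  where "submanifold_chart G M V W K \<longleftrightarrow> C1F_diffeo V W K \<and> K ` (M \<inter> V) = W \<inter> G"

definition C1F_submanifold :: "'a::topological_real_vector set \<Rightarrow> 'a set \<Rightarrow> bool"
  where "C1F_submanifold G M \<longleftrightarrow> closed_complemented G \<and>
    (\<forall>m\<in>M. \<exists>V W K. m \<in> V \<and> submanifold_chart G M V W K)"

text \<open>
  Smoothness of a map on a submanifold \<open>M\<close>, for all local parametrizations over all model spaces
  of \<open>M\<close>; in particular \<open>M\<close> has to be a submanifold.
\<close>

definition C1F_on_submanifold ::
    "'a::topological_real_vector set \<Rightarrow> ('a \<Rightarrow> 'b::topological_real_vector) \<Rightarrow> bool"
  where "C1F_on_submanifold M h \<longleftrightarrow> (\<exists>G. C1F_submanifold G M) \<and>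
    (\<forall>G V W K. C1F_submanifold G M \<and> submanifold_chart G M V W K \<longrightarrow>
      C1F_on G (W \<inter> G) (h \<circ> inv_into V K))"

text \<open>
  \<open>c\<close> restricts to a continuously differentiable curve in \<open>M\<close> on an open interval containing \<open>0\<close>,
  with $c(0)=m$ and $c'(0)=\eta$.
\<close>

definition C1_curve ::
    "'a::topological_real_vector set \<Rightarrow> 'a \<Rightarrow> 'a \<Rightarrow> (real \<Rightarrow> 'a) \<Rightarrow> bool"
  where "C1_curve M m \<eta> c \<longleftrightarrow> (\<exists>J c'. is_interval J \<and> open J \<and> 0 \<in> J \<and> c ` J \<subseteq> M \<and>
    (\<forall>t\<in>J. has_dir_deriv c t 1 (c' t)) \<and> continuous_on J c' \<and> c 0 = m \<and> c' 0 = \<eta>)"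

definition tangent_space :: "'a::topological_real_vector set \<Rightarrow> 'a \<Rightarrow> 'a set"
  where "tangent_space M m = {\<eta>. \<exists>c. C1_curve M m \<eta> c}"

text \<open>The derivative of the map \<open>h\<close> on \<open>M\<close> at \<open>m\<close> exists in direction \<open>\<eta>\<close> and has the value \<open>w\<close>.\<close>

definition has_tangent_deriv ::
    "'a::topological_real_vector set \<Rightarrow> ('a \<Rightarrow> 'b::topological_real_vector) \<Rightarrow> 'a \<Rightarrow> 'a \<Rightarrow> 'b \<Rightarrow> bool"
  where "has_tangent_deriv M h m \<eta> w \<longleftrightarrow> \<eta> \<in> tangent_space M m \<and>
    (\<forall>c. C1_curve M m \<eta> c \<longrightarrow> has_dir_deriv (h \<circ> c) 0 1 w)"


section \<open>Solutions of delay differential equations\<close>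

definition segment :: "(real \<Rightarrow> real ^ 'n) \<Rightarrow> real \<Rightarrow> real \<Rightarrow> real ^ 'n"
  where "segment x t = (\<lambda>s. if s \<le> 0 then x (t + s) else 0)"

text \<open>Meaningful only if \<open>segment x t \<in> c1_maps\<close>.\<close>

definition c1_segment :: "(real \<Rightarrow> real ^ 'n::finite) \<Rightarrow> real \<Rightarrow> 'n c1_space"
  where "c1_segment x t = Abs_c1_space (segment x t)"

text \<open>
  \<open>x\<close> solves $x'(t)=F(t,x_t)$ on the interval \<open>I\<close>, where \<open>D\<close> is the domain of the right hand side.
  Only the values of \<open>x\<close> at arguments not exceeding some point of \<open>I\<close> matter.
\<close>

definition solution_on ::
    "(real \<Rightarrow> 'n::finite c1_space \<Rightarrow> real ^ 'n) \<Rightarrow> (real \<times> 'n c1_space) set \<Rightarrow> real set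
      \<Rightarrow> (real \<Rightarrow> real ^ 'n) \<Rightarrow> bool"
  where "solution_on F D I x \<longleftrightarrow>
    (\<forall>t\<in>I. segment x t \<in> c1_maps \<and> (t, c1_segment x t) \<in> D \<and>
      (x has_vector_derivative F t (c1_segment x t)) (at t within I))"

definition ivp_solution ::
    "(real \<Rightarrow> 'n::finite c1_space \<Rightarrow> real ^ 'n) \<Rightarrow> (real \<times> 'n c1_space) set \<Rightarrow> 'n c1_space
      \<Rightarrow> real set \<Rightarrow> (real \<Rightarrow> real ^ 'n) \<Rightarrow> bool"
  where "ivp_solution F D \<phi> I x \<longleftrightarrow> solution_on F D I x \<and> (\<forall>s\<le>0. x s = c1_fun \<phi> s)"

definition interval_from_0 :: "real set \<Rightarrow> bool"
  where "interval_from_0 I \<longleftrightarrow> is_interval I \<and> I \<noteq> {} \<and> bdd_below I \<and> Inf I = 0"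

definition maximal_solution ::
    "(real \<Rightarrow> 'n::finite c1_space \<Rightarrow> real ^ 'n) \<Rightarrow> (real \<times> 'n c1_space) set \<Rightarrow> 'n c1_space
      \<Rightarrow> ereal \<Rightarrow> (real \<Rightarrow> real ^ 'n) \<Rightarrow> bool"
  where "maximal_solution F D \<phi> T x \<longleftrightarrow> 0 < T \<and>
    ivp_solution F D \<phi> {t. 0 \<le> t \<and> ereal t < T} x \<and>
    (\<forall>I y. interval_from_0 I \<and> ivp_solution F D \<phi> I y \<longrightarrow>
      (\<forall>t\<in>I. ereal t < T) \<and> (\<forall>t\<in>{..0} \<union> I. y t = x t))"

definition property_e :: "('n::finite c1_space \<Rightarrow> real ^ 'n) \<Rightarrow> 'n c1_space set \<Rightarrow> bool"
  where "property_e f U \<longleftrightarrow> (\<exists>De :: 'n c1_space \<Rightarrow> 'n c_space \<Rightarrow> real ^ 'n.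
    (\<forall>\<phi>\<in>U. linear (De \<phi>) \<and> (\<forall>\<eta>. De \<phi> (c1_to_c \<eta>) = dir_deriv f \<phi> \<eta>)) \<and>
    continuous_on (U \<times> UNIV) (\<lambda>(\<phi>, \<eta>). De \<phi> \<eta>))"

definition solution_manifold :: "('n::finite c1_space \<Rightarrow> real ^ 'n) \<Rightarrow> 'n c1_space set \<Rightarrow> 'n c1_space set"
  where "solution_manifold f U = {\<phi>\<in>U. half_deriv (c1_fun \<phi>) 0 = f \<phi>}"

text \<open>
  The maximal solution is unique where it is defined, so that the descriptions below determine
  $t_\phi$ and the values of $x^\phi$ on $(-\infty,t_\phi)$.
\<close>

definition exit_time :: "('n::finite c1_space \<Rightarrow> real ^ 'n) \<Rightarrow> 'n c1_space set \<Rightarrow> 'n c1_space \<Rightarrow> ereal"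
  where "exit_time f U \<phi> = (THE T. \<exists>x. maximal_solution (\<lambda>t. f) (UNIV \<times> U) \<phi> T x)"

definition max_solution ::
    "('n::finite c1_space \<Rightarrow> real ^ 'n) \<Rightarrow> 'n c1_space set \<Rightarrow> 'n c1_space \<Rightarrow> real \<Rightarrow> real ^ 'n"
  where "max_solution f U \<phi> = (SOME x. maximal_solution (\<lambda>t. f) (UNIV \<times> U) \<phi> (exit_time f U \<phi>) x)"

definition flow_domain ::
    "('n::finite c1_space \<Rightarrow> real ^ 'n) \<Rightarrow> 'n c1_space set \<Rightarrow> (real \<times> 'n c1_space) set"
  where "flow_domain f U = {(t, \<phi>). 0 \<le> t \<and> \<phi> \<in> solution_manifold f U \<and> ereal t < exit_time f U \<phi>}"

definition flow ::
    "('n::finite c1_space \<Rightarrow> real ^ 'n) \<Rightarrow> 'n c1_space set \<Rightarrow> real \<times> 'n c1_space \<Rightarrow> 'n c1_space"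
  where "flow f U = (\<lambda>(t, \<phi>). c1_segment (max_solution f U \<phi>) t)"

definition flow_slice ::
    "('n::finite c1_space \<Rightarrow> real ^ 'n) \<Rightarrow> 'n c1_space set \<Rightarrow> real \<Rightarrow> 'n c1_space set"
  where "flow_slice f U t = {\<phi> \<in> solution_manifold f U. (t, \<phi>) \<in> flow_domain f U}"

definition continuous_semiflow ::
    "'a::topological_space set \<Rightarrow> (real \<times> 'a) set \<Rightarrow> (real \<times> 'a \<Rightarrow> 'a) \<Rightarrow> bool"
  where "continuous_semiflow X \<Omega> S \<longleftrightarrow>
    \<Omega> \<subseteq> {0..} \<times> X \<and> S ` \<Omega> \<subseteq> X \<and> continuous_on \<Omega> S \<and>
    (\<forall>\<phi>\<in>X. (0, \<phi>) \<in> \<Omega> \<and> S (0, \<phi>) = \<phi>) \<and>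
    (\<forall>t s \<phi>. (t, \<phi>) \<in> \<Omega> \<and> (s, S (t, \<phi>)) \<in> \<Omega> \<longrightarrow>
      (s + t, \<phi>) \<in> \<Omega> \<and> S (s + t, \<phi>) = S (s, S (t, \<phi>)))"

end

theory Submission
  imports Defs
begin

text \<open>
  The equation is extended from the solution manifold to the open set \<open>U\<close>: for arbitrary
  $\phi\in U$ consider $x'(t)=f(x_t)+\phi'(0)-f(\phi)$, $x_0=\phi$. The defect $\phi'(0)-f(\phi)$
  is conserved along solutions and vanishes exactly on $X_f$, so this defines a semiflow on an open
  subset of $[0,\infty)\times U$ which restricts to $\Sigma_f$, and its smoothness can be studied
  without charts of $X_f$.

  On a short interval the derivative of a solution is the fixed point of a contraction on a space of
  bounded continuous functions; the contraction property comes from property (e), by which \<open>f\<close> is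
  locally Lipschitz with respect to the seminorms of \<open>C\<close>. The contraction depends smoothly on
  $\phi$, hence so does its fixed point, and differentiating the fixed point equation yields the
  variational equation. The semigroup property and compactness of time intervals extend this to all
  times. A contraction on $\mathbb{R}^n$ of the same kind provides the charts of $X_f$.
\<close>

text \<open>The obstacle: on a short interval [0, h] the prolongation by z has size of order h only
  in the seminorms of C; in those of C^1 no small factor arises, since its derivative is z up to a
  constant. Property (e) is what makes an estimate in C sufficient. Only z ranges over a Banach
  space, while the initial segment enters as a parameter from a Frechet space; hence a contraction
  principle with parameters takes the place of an inverse function theorem.

  The form of the extended equation comes from the choice of z. If x continues \<phi> with x'(t) =
  \<phi>'(0) + z(t) - z(0), then the fixed point condition z(t) = f(x_t) turns this into x'(t) =
  f(x_t) + \<phi>'(0) - f(\<phi>).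

  Differentiating the added constant with respect to \<phi> puts the constant inhomogeneity
  \<eta>'(0) - Df(\<phi>)\<eta> into the variational equation. It is conserved in the same way as
  the defect, and it vanishes for \<eta> tangent to X_f.\<close>

text \<open>
  In the axiom of \<open>topological_real_vector\<close> the filters live on the vector space itself;
  here scalar multiplication is jointly continuous, so that limits along any filter are covered.
\<close>

class tvs = topological_real_vector +
  assumes tendsto_scaleR_nhds: "((\<lambda>p. fst p *\<^sub>R snd p) \<longlongrightarrow> a *\<^sub>R x) (nhds a \<times>\<^sub>F nhds x)"

instance real_normed_vector \<subseteq> tvs
  by standard (intro tendsto_scaleR filterlim_fst filterlim_snd)

instance c1_space :: (finite) tvs
  by standard (intro c1_space.tvs_scale filterlim_fst filterlim_snd)

lemma tendsto_scaleR_tvs' [tendsto_intros]: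
  fixes g :: "'b \<Rightarrow> 'a::tvs"
  assumes "(f \<longlongrightarrow> a) F" "(g \<longlongrightarrow> b) F"
  shows "((\<lambda>x. f x *\<^sub>R g x) \<longlongrightarrow> a *\<^sub>R b) F"
  using filterlim_compose[OF tendsto_scaleR_nhds filterlim_Pair[OF assms]] by simp

section \<open>Products of topological vector spaces\<close>

instance prod :: (topological_monoid_add, topological_monoid_add) topological_monoid_add
proof
  fix a b :: "'a \<times> 'b"
  have "((\<lambda>x. (fst (fst x) + fst (snd x), snd (fst x) + snd (snd x))) \<longlongrightarrow>
      (fst a + fst b, snd a + snd b)) (nhds a \<times>\<^sub>F nhds b)"
    by (intro tendsto_Pair tendsto_add tendsto_fst tendsto_snd filterlim_fst filterlim_snd)
  then show "((\<lambda>x. fst x + snd x) \<longlongrightarrow> a + b) (nhds a \<times>\<^sub>F nhds b)"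
    by (simp add: plus_prod_def)
qed

instance prod :: (topological_group_add, topological_group_add) topological_group_add
proof
  fix a :: "'a \<times> 'b"
  have "((\<lambda>x. (- fst x, - snd x)) \<longlongrightarrow> (- fst a, - snd a)) (nhds a)"
    by (intro tendsto_Pair tendsto_minus tendsto_fst tendsto_snd filterlim_ident)
  then show "(uminus \<longlongrightarrow> - a) (nhds a)"
    unfolding uminus_prod_def by simp
qed

instance prod :: (topological_ab_group_add, topological_ab_group_add) topological_ab_group_add ..

lemma tendsto_scaleR_prod:
  fixes g :: "'c \<Rightarrow> 'a::tvs \<times> 'b::tvs"
  assumes "(f \<longlongrightarrow> a) F" "(g \<longlongrightarrow> b) F"
  shows "((\<lambda>x. f x *\<^sub>R g x) \<longlongrightarrow> a *\<^sub>R b) F"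
  unfolding scaleR_prod_def
  by (intro tendsto_Pair tendsto_scaleR_tvs' tendsto_fst tendsto_snd assms)

text \<open>The contraction will act on pairs of an initial segment and a prescribed
  derivative.\<close>

instance prod :: (tvs, tvs) topological_real_vector
  by standard (rule tendsto_scaleR_prod)

instance prod :: (tvs, tvs) tvs
  by standard (intro tendsto_scaleR_prod filterlim_fst filterlim_snd)

lemma continuous_on_open_nhds:
  assumes "continuous_on V f" "open V" "u \<in> V"
  shows "filterlim f (nhds (f u)) (nhds u)"
  using assms(1,3) unfolding continuous_on_def
  by (auto simp: at_within_open[OF assms(3,2)] tendsto_at_iff_tendsto_nhds[symmetric])

lemma continuous_on_nhdsI:
  assumes "\<And>x. x \<in> S \<Longrightarrow> (f \<longlongrightarrow> f x) (nhds x)"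
  shows "continuous_on S f"
  unfolding continuous_on_def at_within_def using assms by (auto intro: tendsto_mono[OF inf_le1])

text \<open>Continuity of addition at (0, 0); it replaces the halving of an epsilon where there is
  no norm.\<close>

lemma eventually_nhds_0_half:
  fixes N :: "'a::tvs set"
  assumes "open N" "0 \<in> N"
  obtains N' where "open N'" "0 \<in> N'" "\<And>x y. x \<in> N' \<Longrightarrow> y \<in> N' \<Longrightarrow> x + y \<in> N"
proof -
  have "((\<lambda>p::'a\<times>'a. fst p + snd p) \<longlongrightarrow> 0 + 0) (nhds 0 \<times>\<^sub>F nhds 0)"
    by (intro tendsto_add filterlim_fst filterlim_snd)
  then have "\<forall>\<^sub>F p in nhds 0 \<times>\<^sub>F nhds (0::'a). fst p + snd p \<in> N"
    using assms by (simp add: tendsto_def)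
  then obtain P Q where "eventually P (nhds 0)" "eventually Q (nhds 0)"
    and PQ: "\<And>x y. P x \<Longrightarrow> Q y \<Longrightarrow> x + y \<in> N"
    unfolding eventually_prod_filter by auto
  then obtain A B where "open A" "0 \<in> A" "\<forall>x\<in>A. P x" "open B" "0 \<in> B" "\<forall>x\<in>B. Q x"
    unfolding eventually_nhds by auto
  then show thesis using PQ by (intro that[of "A \<inter> B"]) auto
qed

lemma linear_continuousI:
  fixes A :: "'a::tvs \<Rightarrow> 'b::tvs"
  assumes "linear A" "(A \<longlongrightarrow> 0) (nhds 0)"
  shows "continuous_on UNIV A"
proof -
  have "(A \<longlongrightarrow> A x) (nhds x)" for x
  proof -
    have "((\<lambda>y. y - x) \<longlongrightarrow> x - x) (nhds x)" by (intro tendsto_intros filterlim_ident)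
    then have "((\<lambda>y. A (y - x)) \<longlongrightarrow> 0) (nhds x)"
      using filterlim_compose[OF assms(2)] by simp
    then have "((\<lambda>y. A (y - x) + A x) \<longlongrightarrow> 0 + A x) (nhds x)" by (intro tendsto_intros)
    then show ?thesis by (simp add: linear_diff[OF assms(1)])
  qed
  then show ?thesis
    by (simp add: continuous_on_eq_continuous_at isCont_def tendsto_at_iff_tendsto_nhds)
qed

lemma tvs_bounded_linear_image:
  fixes A :: "'a::tvs \<Rightarrow> 'b::tvs"
  assumes "tvs_bounded B" "linear A" "continuous_on UNIV A"
  shows "tvs_bounded (A ` B)"
  unfolding tvs_bounded_def
proof (intro allI impI)
  fix N :: "'b set" assume N: "open N \<and> 0 \<in> N"
  have "open (A -` N)" using N assms(3) by (simp add: continuous_on_open_vimage)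
  moreover have "0 \<in> A -` N" using N linear_0[OF assms(2)] by simp
  ultimately obtain r where r: "r > 0" "\<And>s. s \<ge> r \<Longrightarrow> B \<subseteq> (\<lambda>x. s *\<^sub>R x) ` (A -` N)"
    using assms(1) unfolding tvs_bounded_def by meson
  have "A ` B \<subseteq> (\<lambda>x. s *\<^sub>R x) ` N" if "s \<ge> r" for s
  proof
    fix y assume "y \<in> A ` B"
    then obtain b where b: "b \<in> B" "y = A b" by blast
    obtain x where "x \<in> A -` N" "b = s *\<^sub>R x" using r(2)[of s] \<open>s \<ge> r\<close> b(1) by blast
    then show "y \<in> (\<lambda>x. s *\<^sub>R x) ` N" using b linear_cmul[OF assms(2)] by auto
  qed
  then show "\<exists>r>0. \<forall>s\<ge>r. A ` B \<subseteq> (\<lambda>x. s *\<^sub>R x) ` N" using r(1) by blast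
qed

section \<open>Continuously differentiable maps in the sense of Hadamard\<close>

definition hadamard_deriv :: "('a::tvs \<Rightarrow> 'b::tvs) \<Rightarrow> 'a \<Rightarrow> 'a \<Rightarrow> 'b \<Rightarrow> bool"
  where "hadamard_deriv f u v w \<longleftrightarrow>
    ((\<lambda>p. (1 / fst p) *\<^sub>R (f (u + fst p *\<^sub>R snd p) - f u)) \<longlongrightarrow> w) (at (0::real) \<times>\<^sub>F nhds v)"

text \<open>
  Differentiability along converging directions makes the chain rule independent of a mean value
  theorem. Joint continuity of the derivative is required in addition to its continuity uniformly
  on bounded sets, since the latter implies the former only under countability assumptions.
\<close>

definition hadamard_C1 ::
    "'a::tvs set \<Rightarrow> ('a \<Rightarrow> 'b::tvs) \<Rightarrow> ('a \<Rightarrow> 'a \<Rightarrow> 'b) \<Rightarrow> bool"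
  where "hadamard_C1 V f D \<longleftrightarrow> open V \<and> continuous_on V f \<and>
    (\<forall>u\<in>V. linear (D u)) \<and> (\<forall>u\<in>V. \<forall>v. hadamard_deriv f u v (D u v)) \<and>
    continuous_on (V \<times> UNIV) (\<lambda>p. D (fst p) (snd p)) \<and>
    (\<forall>u\<in>V. \<forall>B N. tvs_bounded B \<longrightarrow> open N \<longrightarrow> 0 \<in> N \<longrightarrow>
      (\<forall>\<^sub>F u' in nhds u. \<forall>b\<in>B. D u' b - D u b \<in> N))"

lemma hadamard_C1D:
  assumes "hadamard_C1 V f D"
  shows "open V" "continuous_on V f" "u \<in> V \<Longrightarrow> linear (D u)"
    "u \<in> V \<Longrightarrow> hadamard_deriv f u v (D u v)"
    "continuous_on (V \<times> UNIV) (\<lambda>p. D (fst p) (snd p))"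
    "u \<in> V \<Longrightarrow> tvs_bounded B \<Longrightarrow> open N \<Longrightarrow> 0 \<in> N \<Longrightarrow>
      \<forall>\<^sub>F u' in nhds u. \<forall>b\<in>B. D u' b - D u b \<in> N"
  using assms unfolding hadamard_C1_def by (elim conjE; simp)+

lemma hadamard_C1I:
  assumes "open V" "continuous_on V f" "\<And>u. u \<in> V \<Longrightarrow> linear (D u)"
    "\<And>u v. u \<in> V \<Longrightarrow> hadamard_deriv f u v (D u v)"
    "continuous_on (V \<times> UNIV) (\<lambda>p. D (fst p) (snd p))"
    "\<And>u B N. u \<in> V \<Longrightarrow> tvs_bounded B \<Longrightarrow> open N \<Longrightarrow> 0 \<in> N \<Longrightarrow>
      \<forall>\<^sub>F u' in nhds u. \<forall>b\<in>B. D u' b - D u b \<in> N"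
  shows "hadamard_C1 V f D"
  unfolding hadamard_C1_def using assms by (intro conjI ballI allI impI)

lemma hadamard_C1_tendsto:
  assumes "hadamard_C1 V f D" "u \<in> V"
  shows "((\<lambda>p. D (fst p) (snd p)) \<longlongrightarrow> D u v) (nhds u \<times>\<^sub>F nhds v)"
proof -
  have "open (V \<times> (UNIV :: 'a set))" using hadamard_C1D(1)[OF assms(1)] by (intro open_Times) auto
  from continuous_on_open_nhds[OF hadamard_C1D(5)[OF assms(1)] this, of "(u, v)"] assms(2)
  show ?thesis by (simp add: nhds_prod)
qed

lemma hadamard_C1_continuous_deriv:
  assumes "hadamard_C1 V f D" "u \<in> V"
  shows "continuous_on UNIV (D u)"
proof -
  have "continuous_on UNIV (\<lambda>v. (u, v))" by (intro continuous_intros)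
  from continuous_on_compose2[OF hadamard_C1D(5)[OF assms(1)] this] assms(2)
  show ?thesis by auto
qed

lemma tendsto_at_le_nhds: "at x \<times>\<^sub>F nhds y \<le> nhds x \<times>\<^sub>F nhds y"
  by (intro prod_filter_mono at_le order.refl) (simp add: at_within_def)

lemma tendsto_line:
  fixes u v :: "'a::tvs"
  shows "((\<lambda>p. u + fst p *\<^sub>R snd p) \<longlongrightarrow> u) (at (0::real) \<times>\<^sub>F nhds v)"
proof -
  have "((\<lambda>p. u + fst p *\<^sub>R snd p) \<longlongrightarrow> u + 0 *\<^sub>R v) (nhds (0::real) \<times>\<^sub>F nhds v)"
    by (intro tendsto_intros filterlim_fst filterlim_snd)
  then show ?thesis using tendsto_at_le_nhds tendsto_mono by fastforce
qed

lemma eventually_fst_neq: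
  "\<forall>\<^sub>F p in at (0::real) \<times>\<^sub>F F. fst p \<noteq> 0"
  unfolding eventually_prod_filter
  by (rule exI[of _ "\<lambda>t. t \<noteq> 0"], rule exI[of _ "\<lambda>_. True"]) (simp add: eventually_at_filter)

text \<open>The form used in chain rules, where difference quotients of an inner map are inserted as
  directions.\<close>

lemma hadamard_deriv_along:
  assumes "hadamard_deriv f u v w" "(t \<longlongrightarrow> 0) F" "\<forall>\<^sub>F x in F. t x \<noteq> 0" "(k \<longlongrightarrow> v) F"
  shows "((\<lambda>x. (1 / t x) *\<^sub>R (f (u + t x *\<^sub>R k x) - f u)) \<longlongrightarrow> w) F"
proof -
  have "filterlim (\<lambda>x. (t x, k x)) (at 0 \<times>\<^sub>F nhds v) F"
    using assms(2-4) by (intro filterlim_Pair) (simp_all add: filterlim_at)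
  from filterlim_compose[OF assms(1)[unfolded hadamard_deriv_def] this]
  show ?thesis by simp
qed

lemma hadamard_deriv_imp_dir:
  "hadamard_deriv f u v w \<Longrightarrow> has_dir_deriv f u v w"
  unfolding has_dir_deriv_def
  by (erule hadamard_deriv_along) (auto simp: eventually_at_filter)

text \<open>The difference quotients \<kappa> of the inner map are directions converging to w, along
  which the outer map may be differentiated. The inner map only has to be differentiable in a single
  direction, which covers curves.\<close>

lemma has_dir_deriv_compose:
  fixes k :: "'a::topological_real_vector \<Rightarrow> 'b::tvs"
  assumes "hadamard_deriv g (k u) w z" "has_dir_deriv k u v w"
  shows "has_dir_deriv (g \<circ> k) u v z"
proof -
  define \<kappa> where "\<kappa> t = (1 / t) *\<^sub>R (k (u + t *\<^sub>R v) - k u)" for t :: real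
  have "((\<lambda>t. (1 / t) *\<^sub>R (g (k u + t *\<^sub>R \<kappa> t) - g (k u))) \<longlongrightarrow> z) (at 0)"
    using assms(2) unfolding has_dir_deriv_def \<kappa>_def[symmetric]
    by (intro hadamard_deriv_along[OF assms(1)]) (auto simp: eventually_at_filter)
  then show ?thesis unfolding has_dir_deriv_def
    by (rule filterlim_mono_eventually) (auto simp: eventually_at_filter \<kappa>_def)
qed

lemma hadamard_deriv_compose:
  fixes k :: "'a::tvs \<Rightarrow> 'b::tvs"
  assumes "hadamard_deriv g (k u) w z" "hadamard_deriv k u v w"
  shows "hadamard_deriv (g \<circ> k) u v z"
proof -
  define \<kappa> where "\<kappa> p = (1 / fst p) *\<^sub>R (k (u + fst p *\<^sub>R snd p) - k u)" for p :: "real \<times> 'a"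
  have "((\<lambda>p. (1 / fst p) *\<^sub>R (g (k u + fst p *\<^sub>R \<kappa> p) - g (k u))) \<longlongrightarrow> z) (at 0 \<times>\<^sub>F nhds v)"
    using assms(2) unfolding hadamard_deriv_def \<kappa>_def[symmetric]
    by (intro hadamard_deriv_along[OF assms(1)] eventually_fst_neq)
      (auto intro: filterlim_mono[OF filterlim_fst order.refl]
        tendsto_mono[OF tendsto_at_le_nhds filterlim_fst])
  moreover have "\<forall>\<^sub>F p in at 0 \<times>\<^sub>F nhds v. (1 / fst p) *\<^sub>R (g (k u + fst p *\<^sub>R \<kappa> p) - g (k u)) =
      (1 / fst p) *\<^sub>R ((g \<circ> k) (u + fst p *\<^sub>R snd p) - (g \<circ> k) u)"
    using eventually_fst_neq by eventually_elim (simp add: \<kappa>_def)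
  ultimately show ?thesis unfolding hadamard_deriv_def using tendsto_cong by fast
qed

lemma hadamard_deriv_cong:
  assumes "hadamard_deriv f u v w" "open V" "u \<in> V" "\<And>x. x \<in> V \<Longrightarrow> f x = g x"
  shows "hadamard_deriv g u v w"
proof -
  have "\<forall>\<^sub>F p in at (0::real) \<times>\<^sub>F nhds v. u + fst p *\<^sub>R snd p \<in> V"
    using tendsto_line assms(2,3) by (rule topological_tendstoD)
  then have "\<forall>\<^sub>F p in at 0 \<times>\<^sub>F nhds v. (1 / fst p) *\<^sub>R (f (u + fst p *\<^sub>R snd p) - f u) =
      (1 / fst p) *\<^sub>R (g (u + fst p *\<^sub>R snd p) - g u)"
    by eventually_elim (simp add: assms(3,4))
  then show ?thesis using assms(1) unfolding hadamard_deriv_def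
    using tendsto_cong by fast
qed

lemma hadamard_C1_cong:
  assumes "hadamard_C1 V f D" "\<And>x. x \<in> V \<Longrightarrow> f x = g x" "\<And>x v. x \<in> V \<Longrightarrow> D x v = D' x v"
  shows "hadamard_C1 V g D'"
proof -
  have eq: "D' x = D x" if "x \<in> V" for x using assms(3)[OF that] by auto
  have "\<forall>\<^sub>F u' in nhds u. \<forall>b\<in>B. D' u' b - D' u b \<in> N"
    if "u \<in> V" "tvs_bounded B" "open N" "0 \<in> N" for u B N
    using hadamard_C1D(6)[OF assms(1) that]
      eventually_nhds_in_open[OF hadamard_C1D(1)[OF assms(1)] that(1)]
    by eventually_elim (simp add: eq that(1))
  moreover have "continuous_on (V \<times> UNIV) (\<lambda>p. D' (fst p) (snd p))"
    by (rule continuous_on_eq[OF hadamard_C1D(5)[OF assms(1)]]) (auto simp: eq)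
  moreover have "continuous_on V g"
    by (rule continuous_on_eq[OF hadamard_C1D(2)[OF assms(1)]]) (auto simp: assms(2))
  moreover have "hadamard_deriv g u v (D' u v)" if "u \<in> V" for u v
    using hadamard_deriv_cong[OF hadamard_C1D(4)[OF assms(1) that] _ that assms(2)]
      hadamard_C1D(1)[OF assms(1)] eq[OF that] by simp
  ultimately show ?thesis
    using hadamard_C1D(1,3)[OF assms(1)] unfolding hadamard_C1_def by (simp add: eq)
qed

lemma hadamard_C1_subset:
  assumes "hadamard_C1 V f D" "open V'" "V' \<subseteq> V"
  shows "hadamard_C1 V' f D"
proof (rule hadamard_C1I)
  show "continuous_on (V' \<times> UNIV) (\<lambda>p. D (fst p) (snd p))"
    using assms(3) by (intro continuous_on_subset[OF hadamard_C1D(5)[OF assms(1)]]) auto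
qed (use assms(3) in \<open>auto intro: assms(2) continuous_on_subset[OF hadamard_C1D(2)[OF assms(1)]]
  hadamard_C1D(3,4,6)[OF assms(1)]\<close>)

lemma hadamard_C1_linear:
  assumes "linear A" "continuous_on UNIV A"
  shows "hadamard_C1 UNIV A (\<lambda>_. A)"
proof -
  have "hadamard_deriv A u v (A v)" for u v
  proof -
    have "((\<lambda>p. A (snd p)) \<longlongrightarrow> A v) (at (0::real) \<times>\<^sub>F nhds v)"
      using continuous_on_open_nhds[OF assms(2)] filterlim_snd by (blast intro: filterlim_compose)
    moreover have "\<forall>\<^sub>F p in at (0::real) \<times>\<^sub>F nhds v. A (snd p) =
        (1 / fst p) *\<^sub>R (A (u + fst p *\<^sub>R snd p) - A u)"
      using eventually_fst_neq
      by eventually_elim (simp add: linear_add[OF assms(1)] linear_cmul[OF assms(1)])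
    ultimately show ?thesis unfolding hadamard_deriv_def using tendsto_cong by fast
  qed
  moreover have "continuous_on (UNIV \<times> UNIV) (\<lambda>p. A (snd p))"
    using continuous_on_compose2[OF assms(2) continuous_on_snd[OF continuous_on_id]] by simp
  ultimately show ?thesis using assms unfolding hadamard_C1_def by simp
qed

text \<open>Equicontinuity of the derivatives near u: joint continuity at (u, 0), where the value is
  0 by linearity.\<close>

lemma eventually_deriv_small:
  assumes "hadamard_C1 V f D" "u \<in> V" "open N" "0 \<in> N"
  obtains P Q where "open P" "u \<in> P" "open Q" "0 \<in> Q" "\<And>x v. x \<in> P \<Longrightarrow> v \<in> Q \<Longrightarrow> D x v \<in> N"
proof -
  have "D u 0 = 0" using linear_0[OF hadamard_C1D(3)[OF assms(1,2)]] .
  then have "\<forall>\<^sub>F p in nhds u \<times>\<^sub>F nhds 0. D (fst p) (snd p) \<in> N"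
    using hadamard_C1_tendsto[OF assms(1,2), of 0] assms(3,4) by (simp add: tendsto_def)
  then obtain P Q where "eventually P (nhds u)" "eventually Q (nhds 0)"
    and PQ: "\<And>x y. P x \<Longrightarrow> Q y \<Longrightarrow> D x y \<in> N"
    unfolding eventually_prod_filter by auto
  then show thesis using that unfolding eventually_nhds by metis
qed

text \<open>For uniformity on a bounded set B, the difference of the derivatives is split into D'(f
  u') applied to D u' b - D u b, which is small by equicontinuity of D', and D'(f u') - D'(f u)
  applied to D u b, which is small because D u maps B to a bounded set.\<close>

lemma hadamard_C1_compose:
  assumes f: "hadamard_C1 V f D" and g: "hadamard_C1 V' g D'" and sub: "f ` V \<subseteq> V'"
  shows "hadamard_C1 V (g \<circ> f) (\<lambda>u v. D' (f u) (D u v))"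
proof -
  have fV: "f u \<in> V'" if "u \<in> V" for u using sub that by blast
  have "\<forall>\<^sub>F u' in nhds u. \<forall>b\<in>B. D' (f u') (D u' b) - D' (f u) (D u b) \<in> N"
    if u: "u \<in> V" and B: "tvs_bounded B" and N: "open N" "0 \<in> N" for u B N
  proof -
    obtain N' where N': "open N'" "0 \<in> N'" "\<And>x y. x \<in> N' \<Longrightarrow> y \<in> N' \<Longrightarrow> x + y \<in> N"
      using eventually_nhds_0_half[OF N] by metis
    obtain P Q where PQ: "open P" "f u \<in> P" "open Q" "0 \<in> Q"
      "\<And>x v. x \<in> P \<Longrightarrow> v \<in> Q \<Longrightarrow> D' x v \<in> N'"
      using eventually_deriv_small[OF g fV[OF u] N'(1,2)] by metis
    have lim: "filterlim f (nhds (f u)) (nhds u)"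
      using continuous_on_open_nhds[OF hadamard_C1D(2,1)[OF f] u] .
    have "tvs_bounded (D u ` B)"
      using tvs_bounded_linear_image[OF B hadamard_C1D(3)[OF f u] hadamard_C1_continuous_deriv[OF f u]] .
    from filterlim_iff[THEN iffD1, OF lim, rule_format, OF hadamard_C1D(6)[OF g fV[OF u] this N'(1,2)]]
    have "\<forall>\<^sub>F u' in nhds u. \<forall>b\<in>B. D' (f u') (D u b) - D' (f u) (D u b) \<in> N'" by simp
    moreover have "\<forall>\<^sub>F u' in nhds u. \<forall>b\<in>B. D u' b - D u b \<in> Q"
      using hadamard_C1D(6)[OF f u B PQ(3,4)] .
    moreover have "\<forall>\<^sub>F u' in nhds u. f u' \<in> P"
      using topological_tendstoD[OF lim PQ(1,2)] .
    moreover have "\<forall>\<^sub>F u' in nhds u. u' \<in> V"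
      using eventually_nhds_in_open[OF hadamard_C1D(1)[OF f] u] .
    ultimately show ?thesis
    proof eventually_elim
      case (elim u')
      show ?case
      proof
        fix b assume b: "b \<in> B"
        have "D' (f u') (D u' b - D u b) + (D' (f u') (D u b) - D' (f u) (D u b)) \<in> N"
          using b elim by (intro N'(3) PQ(5)) auto
        then show "D' (f u') (D u' b) - D' (f u) (D u b) \<in> N"
          using linear_diff[OF hadamard_C1D(3)[OF g fV[OF \<open>u' \<in> V\<close>]]] by simp
      qed
    qed
  qed
  moreover have "continuous_on (V \<times> UNIV) (\<lambda>p. D' (f (fst p)) (D (fst p) (snd p)))"
  proof -
    have "continuous_on (V \<times> (UNIV :: 'a set)) (\<lambda>p. (f (fst p), D (fst p) (snd p)))"
      by (intro continuous_on_Pair hadamard_C1D(5)[OF f]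
          continuous_on_compose2[OF hadamard_C1D(2)[OF f] continuous_on_fst[OF continuous_on_id]]) auto
    from continuous_on_compose2[OF hadamard_C1D(5)[OF g] this]
    show ?thesis using fV by (auto simp: image_subset_iff)
  qed
  moreover have "continuous_on V (g \<circ> f)"
    using continuous_on_compose[OF hadamard_C1D(2)[OF f] continuous_on_subset[OF hadamard_C1D(2)[OF g] sub]] .
  moreover have "hadamard_deriv (g \<circ> f) u v (D' (f u) (D u v))" if "u \<in> V" for u v
    using hadamard_deriv_compose[OF hadamard_C1D(4)[OF g fV[OF that]] hadamard_C1D(4)[OF f that]] .
  moreover have "linear (\<lambda>v. D' (f u) (D u v))" if "u \<in> V" for u
    using linear_compose[OF hadamard_C1D(3)[OF f that] hadamard_C1D(3)[OF g fV[OF that]]]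
    by (simp add: o_def)
  ultimately show ?thesis by (intro hadamard_C1I hadamard_C1D(1)[OF f])
qed

lemma hadamard_C1_Pair:
  assumes f: "hadamard_C1 V f D" and g: "hadamard_C1 V g D'"
  shows "hadamard_C1 V (\<lambda>u. (f u, g u)) (\<lambda>u v. (D u v, D' u v))"
proof -
  have "\<forall>\<^sub>F u' in nhds u. \<forall>b\<in>B. (D u' b, D' u' b) - (D u b, D' u b) \<in> N"
    if u: "u \<in> V" and B: "tvs_bounded B" and N: "open N" "0 \<in> N" for u B N
  proof -
    obtain P Q where PQ: "open P" "open Q" "0 \<in> P \<times> Q" "P \<times> Q \<subseteq> N"
      using open_prod_elim[OF N] by metis
    then have "0 \<in> P" "0 \<in> Q" by (auto simp: zero_prod_def)
    from hadamard_C1D(6)[OF f u B PQ(1) this(1)] hadamard_C1D(6)[OF g u B PQ(2) this(2)]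
    show ?thesis by eventually_elim (use PQ(4) in auto)
  qed
  moreover have "hadamard_deriv (\<lambda>u. (f u, g u)) u v (D u v, D' u v)" if "u \<in> V" for u v
    using tendsto_Pair[OF hadamard_C1D(4)[OF f that, of v, unfolded hadamard_deriv_def]
        hadamard_C1D(4)[OF g that, of v, unfolded hadamard_deriv_def]]
    unfolding hadamard_deriv_def by simp
  moreover have "linear (\<lambda>v. (D u v, D' u v))" if "u \<in> V" for u
    using hadamard_C1D(3)[OF f that] hadamard_C1D(3)[OF g that]
    by (auto intro!: linearI simp: linear_add linear_cmul)
  ultimately show ?thesis
    by (intro hadamard_C1I hadamard_C1D(1)[OF f] continuous_on_Pair
        hadamard_C1D(2)[OF f] hadamard_C1D(2)[OF g] hadamard_C1D(5)[OF f] hadamard_C1D(5)[OF g])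
qed

lemma hadamard_C1_add:
  assumes "hadamard_C1 V f D" "hadamard_C1 V g D'"
  shows "hadamard_C1 V (\<lambda>u. f u + g u) (\<lambda>u v. D u v + D' u v)"
proof -
  have "hadamard_C1 UNIV (\<lambda>p :: 'b \<times> 'b. fst p + snd p) (\<lambda>_ p. fst p + snd p)"
    by (intro hadamard_C1_linear linearI continuous_on_nhdsI tendsto_add tendsto_fst tendsto_snd filterlim_ident)
      (simp_all add: algebra_simps)
  from hadamard_C1_compose[OF hadamard_C1_Pair[OF assms] this] show ?thesis by (simp add: o_def)
qed

lemma hadamard_C1_linear_compose:
  assumes "hadamard_C1 V f D" "linear A" "continuous_on UNIV A"
  shows "hadamard_C1 V (\<lambda>u. A (f u)) (\<lambda>u v. A (D u v))"
  using hadamard_C1_compose[OF assms(1) hadamard_C1_linear[OF assms(2,3)]] by (simp add: o_def)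

lemma hadamard_C1_id: "open V \<Longrightarrow> hadamard_C1 V (\<lambda>u. u) (\<lambda>_ v. v)"
  using hadamard_C1_subset[OF hadamard_C1_linear[OF linear_id continuous_on_id']] by (simp add: id_def)

lemma hadamard_C1_local:
  assumes "\<And>u. u \<in> V \<Longrightarrow> \<exists>N. u \<in> N \<and> N \<subseteq> V \<and> hadamard_C1 N f D"
  shows "hadamard_C1 V f D"
proof (rule hadamard_C1I)
  show "open V"
    unfolding open_subopen[of V] using assms hadamard_C1D(1) by metis
  show "continuous_on V f"
  proof (rule continuous_on_nhdsI)
    fix u assume "u \<in> V"
    then obtain N where N: "u \<in> N" "hadamard_C1 N f D" using assms by blast
    show "(f \<longlongrightarrow> f u) (nhds u)" using continuous_on_open_nhds[OF hadamard_C1D(2,1)[OF N(2)] N(1)] .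
  qed
  show "continuous_on (V \<times> UNIV) (\<lambda>p. D (fst p) (snd p))"
  proof (rule continuous_on_nhdsI)
    fix p :: "'a \<times> 'a" assume "p \<in> V \<times> UNIV"
    then have "fst p \<in> V" by auto
    then obtain N where N: "fst p \<in> N" "hadamard_C1 N f D" using assms by blast
    from hadamard_C1_tendsto[OF N(2,1), of "snd p"]
    show "((\<lambda>p. D (fst p) (snd p)) \<longlongrightarrow> D (fst p) (snd p)) (nhds p)"
      by (simp add: nhds_prod[symmetric])
  qed
next
  fix u and B :: "'a set" and N :: "'b set" assume u: "u \<in> V" and *: "tvs_bounded B" "open N" "0 \<in> N"
  obtain M where "u \<in> M" "hadamard_C1 M f D" using assms u by blast
  from hadamard_C1D(6)[OF this(2,1) *] show "\<forall>\<^sub>F u' in nhds u. \<forall>b\<in>B. D u' b - D u b \<in> N" .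
qed (use assms hadamard_C1D(3,4) in blast)+

section \<open>Fixed points of parametrized contractions\<close>

text \<open>The error estimates for fixed points below all have this shape, with a the unknown
  error.\<close>

lemma norm_le_contraction:
  fixes a b :: real
  assumes "a \<le> q * a + b" "q < 1"
  shows "a \<le> b / (1 - q)"
  using assms by (simp add: field_simps)

text \<open>The contraction estimate carries over to the partial derivative in z, so that the
  derivative of the fixed point can be defined as the fixed point of the linearized contraction.
  Continuity, joint continuity of the derivative, its uniformity on bounded sets and
  differentiability then follow from one principle: the distance of two fixed points is at most 1 /
  (1 - q) times the error which one of them makes in the equation of the other.\<close>

lemma parametrized_contraction:
  fixes \<Gamma> :: "'a::tvs \<times> 'z::banach \<Rightarrow> 'z"
  assumes \<Gamma>: "hadamard_C1 Q \<Gamma> D" and N: "open N" and q: "0 \<le> q" "q < 1"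
    and dom: "\<And>u z. u \<in> N \<Longrightarrow> z \<in> cball z0 r \<Longrightarrow> (u, z) \<in> Q"
    and lip: "\<And>u z z'. u \<in> N \<Longrightarrow> z \<in> cball z0 r \<Longrightarrow> z' \<in> cball z0 r \<Longrightarrow>
      norm (\<Gamma> (u, z) - \<Gamma> (u, z')) \<le> q * norm (z - z')"
    and start: "\<And>u. u \<in> N \<Longrightarrow> norm (\<Gamma> (u, z0) - z0) < (1 - q) * r"
  obtains \<zeta> D\<zeta> where "hadamard_C1 N \<zeta> D\<zeta>"
    "\<And>u. u \<in> N \<Longrightarrow> \<zeta> u \<in> ball z0 r" "\<And>u. u \<in> N \<Longrightarrow> \<Gamma> (u, \<zeta> u) = \<zeta> u"
    "\<And>u z. u \<in> N \<Longrightarrow> z \<in> cball z0 r \<Longrightarrow> \<Gamma> (u, z) = z \<Longrightarrow> z = \<zeta> u"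
    "\<And>u v. u \<in> N \<Longrightarrow> D\<zeta> u v = D (u, \<zeta> u) (v, D\<zeta> u v)"
proof -
  have r: "0 < r" if "u \<in> N" for u
    using le_less_trans[OF norm_ge_zero start[OF that]] q by (simp add: zero_less_mult_iff)
  \<comment> \<open>The strict inequality puts the fixed point into the open ball, so that small
    displacements of it remain where the Lipschitz estimate holds.\<close>
  have near: "norm (\<Gamma> (u, z) - z0) < r" if "u \<in> N" "z \<in> cball z0 r" for u z
  proof -
    have "norm (\<Gamma> (u, z) - z0) \<le> norm (\<Gamma> (u, z) - \<Gamma> (u, z0)) + norm (\<Gamma> (u, z0) - z0)"
      using norm_triangle_ineq[of "\<Gamma> (u, z) - \<Gamma> (u, z0)" "\<Gamma> (u, z0) - z0"] by simp
    also have "\<dots> < q * norm (z - z0) + (1 - q) * r"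
      using lip[OF that, of z0] start[OF that(1)] r[OF that(1)] by simp
    also have "\<dots> \<le> q * r + (1 - q) * r"
      using that(2) q by (intro add_right_mono mult_left_mono) (simp_all add: dist_norm norm_minus_commute)
    finally show ?thesis by (simp add: algebra_simps)
  qed
  have ex: "\<exists>!z\<in>cball z0 r. \<Gamma> (u, z) = z" if "u \<in> N" for u
  proof (rule Banach_fix[OF _ _ q])
    show "complete (cball z0 r)" by (simp add: complete_eq_closed)
    show "cball z0 r \<noteq> {}" using r[OF that] by simp
    show "(\<lambda>z. \<Gamma> (u, z)) ` cball z0 r \<subseteq> cball z0 r"
      using near[OF that] by (force simp: dist_norm norm_minus_commute)
    show "dist (\<Gamma> (u, z)) (\<Gamma> (u, z')) \<le> q * dist z z'"
      if "z \<in> cball z0 r" "z' \<in> cball z0 r" for z z'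
      using lip[OF \<open>u \<in> N\<close> that] by (simp add: dist_norm)
  qed
  define \<zeta> where "\<zeta> u = (THE z. z \<in> cball z0 r \<and> \<Gamma> (u, z) = z)" for u
  have \<zeta>: "\<zeta> u \<in> cball z0 r" "\<Gamma> (u, \<zeta> u) = \<zeta> u" if "u \<in> N" for u
    using theI'[OF ex[OF that]] unfolding \<zeta>_def by blast+
  have \<zeta>_unique: "z = \<zeta> u" if "u \<in> N" "z \<in> cball z0 r" "\<Gamma> (u, z) = z" for u z
    using ex[OF that(1)] \<zeta>[OF that(1)] that(2,3) by blast
  have \<zeta>_ball: "\<zeta> u \<in> ball z0 r" if "u \<in> N" for u
    using near[OF that \<zeta>(1)[OF that]] \<zeta>(2)[OF that] by (simp add: dist_norm norm_minus_commute)
  have Q: "(u, \<zeta> u) \<in> Q" if "u \<in> N" for u using dom \<zeta>(1) that by blast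
  have inN: "\<forall>\<^sub>F u' in nhds u. u' \<in> N" if "u \<in> N" for u
    using eventually_nhds_in_open[OF N that] .
  have lim\<zeta>: "(\<zeta> \<longlongrightarrow> \<zeta> u) (nhds u)" if u: "u \<in> N" for u
  proof (rule Lim_transform_bound[THEN Lim_null[THEN iffD2]])
    have "((\<lambda>u'. (u', \<zeta> u)) \<longlongrightarrow> (u, \<zeta> u)) (nhds u)"
      by (intro tendsto_intros filterlim_ident)
    with continuous_on_open_nhds[OF hadamard_C1D(2,1)[OF \<Gamma>] Q[OF u]]
    have "((\<lambda>u'. \<Gamma> (u', \<zeta> u)) \<longlongrightarrow> \<Gamma> (u, \<zeta> u)) (nhds u)" by (rule filterlim_compose)
    then have "((\<lambda>u'. norm (\<Gamma> (u', \<zeta> u) - \<Gamma> (u, \<zeta> u)) / (1 - q)) \<longlongrightarrow> 0 / (1 - q)) (nhds u)"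
      using q by (intro tendsto_divide tendsto_const) (auto intro: tendsto_norm_zero simp: Lim_null[symmetric])
    then show "((\<lambda>u'. norm (\<Gamma> (u', \<zeta> u) - \<Gamma> (u, \<zeta> u)) / (1 - q)) \<longlongrightarrow> 0) (nhds u)" by simp
    show "\<forall>\<^sub>F u' in nhds u. norm (\<zeta> u' - \<zeta> u) \<le> norm (norm (\<Gamma> (u', \<zeta> u) - \<Gamma> (u, \<zeta> u)) / (1 - q))"
      using inN[OF u]
    proof eventually_elim
      case (elim u')
      have "norm (\<zeta> u' - \<zeta> u) \<le> q * norm (\<zeta> u' - \<zeta> u) + norm (\<Gamma> (u', \<zeta> u) - \<Gamma> (u, \<zeta> u))"
        using norm_triangle_ineq[of "\<Gamma> (u', \<zeta> u') - \<Gamma> (u', \<zeta> u)" "\<Gamma> (u', \<zeta> u) - \<Gamma> (u, \<zeta> u)"]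
          lip[OF elim \<zeta>(1)[OF elim] \<zeta>(1)[OF u]] \<zeta>(2)[OF elim] \<zeta>(2)[OF u] by simp
      from norm_le_contraction[OF this q(2)] q show ?case by simp
    qed
  qed
  have lim\<zeta>': "filterlim (\<lambda>u'. (u', \<zeta> u')) (nhds (u, \<zeta> u)) (nhds u)" if "u \<in> N" for u
    by (intro tendsto_Pair filterlim_ident lim\<zeta> that)
  have lin: "linear (D (u, \<zeta> u))" if "u \<in> N" for u using hadamard_C1D(3)[OF \<Gamma> Q[OF that]] .
  \<comment> \<open>The Lipschitz estimate, applied to difference quotients in z and carried to the
    limit.\<close>
  have D_le: "norm (D (u, \<zeta> u) (0, w)) \<le> q * norm w" if u: "u \<in> N" for u w
  proof (rule tendsto_upperbound)
    show "((\<lambda>t::real. norm ((1 / t) *\<^sub>R (\<Gamma> ((u, \<zeta> u) + t *\<^sub>R (0, w)) - \<Gamma> (u, \<zeta> u)))) \<longlongrightarrow>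
        norm (D (u, \<zeta> u) (0, w))) (at 0)"
      using hadamard_deriv_imp_dir[OF hadamard_C1D(4)[OF \<Gamma> Q[OF u]]]
      unfolding has_dir_deriv_def by (rule tendsto_norm)
    have "((\<lambda>t::real. \<zeta> u + t *\<^sub>R w) \<longlongrightarrow> \<zeta> u + 0 *\<^sub>R w) (at 0)" by (intro tendsto_intros)
    then have "\<forall>\<^sub>F t in at (0::real). \<zeta> u + t *\<^sub>R w \<in> ball z0 r"
      using \<zeta>_ball[OF u] by (intro topological_tendstoD) auto
    moreover have "\<forall>\<^sub>F t in at (0::real). t \<noteq> 0" by (simp add: eventually_at_filter)
    ultimately show "\<forall>\<^sub>F t in at (0::real). norm ((1 / t) *\<^sub>R (\<Gamma> ((u, \<zeta> u) + t *\<^sub>R (0, w)) - \<Gamma> (u, \<zeta> u)))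
        \<le> q * norm w"
    proof eventually_elim
      case (elim t)
      then show ?case using lip[OF u, of "\<zeta> u + t *\<^sub>R w" "\<zeta> u"] \<zeta>(1)[OF u]
        by (simp only: norm_scaleR) (simp add: divide_le_eq mult_ac)
    qed
  qed simp
  have D_split: "D (u, \<zeta> u) (v, w) - D (u, \<zeta> u) (v', w') =
      D (u, \<zeta> u) (0, w - w') + (D (u, \<zeta> u) (v, w') - D (u, \<zeta> u) (v', w'))" if "u \<in> N" for u v v' w w'
    using linear_diff[OF lin[OF that], of "(v, w)" "(v, w')"] by simp
  have exD: "\<exists>!w. D (u, \<zeta> u) (v, w) = w" if "u \<in> N" for u v
    using D_le[OF that] D_split[OF that, of v _ v] by (intro banach_fix_type[OF q]) (simp add: dist_norm)
  define D\<zeta> where "D\<zeta> u v = (THE w. D (u, \<zeta> u) (v, w) = w)" for u v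
  have D\<zeta>: "D (u, \<zeta> u) (v, D\<zeta> u v) = D\<zeta> u v" if "u \<in> N" for u v
    using theI'[OF exD[OF that]] unfolding D\<zeta>_def .
  have D\<zeta>_eq: "D\<zeta> u v = w" if "u \<in> N" "D (u, \<zeta> u) (v, w) = w" for u v w
    using exD[OF that(1)] D\<zeta>[OF that(1)] that(2) by blast
  have D\<zeta>_lin: "linear (D\<zeta> u)" if u: "u \<in> N" for u
  proof (rule linearI)
    show "D\<zeta> u (a + b) = D\<zeta> u a + D\<zeta> u b" for a b
      using linear_add[OF lin[OF u], of "(a, D\<zeta> u a)" "(b, D\<zeta> u b)"]
      by (intro D\<zeta>_eq[OF u]) (simp add: D\<zeta>[OF u])
    show "D\<zeta> u (c *\<^sub>R a) = c *\<^sub>R D\<zeta> u a" for c a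
      using linear_cmul[OF lin[OF u], of c "(a, D\<zeta> u a)"]
      by (intro D\<zeta>_eq[OF u]) (simp add: D\<zeta>[OF u])
  qed
  \<comment> \<open>The linear counterpart of the estimate for \<zeta>; base point and direction may
    both change.\<close>
  have D\<zeta>_diff: "norm (D\<zeta> u' v' - D\<zeta> u v) \<le>
      norm (D (u', \<zeta> u') (v', D\<zeta> u v) - D (u, \<zeta> u) (v, D\<zeta> u v)) / (1 - q)"
    if "u' \<in> N" "u \<in> N" for u u' v v'
  proof (rule norm_le_contraction[OF _ q(2)])
    have "D\<zeta> u' v' - D\<zeta> u v = D (u', \<zeta> u') (0, D\<zeta> u' v' - D\<zeta> u v) +
        (D (u', \<zeta> u') (v', D\<zeta> u v) - D (u, \<zeta> u) (v, D\<zeta> u v))"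
      using D_split[OF that(1), of v' "D\<zeta> u' v'" v' "D\<zeta> u v"] D\<zeta>[OF that(1)] D\<zeta>[OF that(2)]
      by (simp add: diff_eq_eq)
    then show "norm (D\<zeta> u' v' - D\<zeta> u v) \<le> q * norm (D\<zeta> u' v' - D\<zeta> u v) +
        norm (D (u', \<zeta> u') (v', D\<zeta> u v) - D (u, \<zeta> u) (v, D\<zeta> u v))"
      using D_le[OF that(1), of "D\<zeta> u' v' - D\<zeta> u v"] by (metis (no_types) add_right_mono norm_triangle_le)
  qed
  have limD\<zeta>: "((\<lambda>p. D\<zeta> (fst p) (snd p)) \<longlongrightarrow> D\<zeta> u v) (nhds u \<times>\<^sub>F nhds v)" if u: "u \<in> N" for u v
  proof (rule Lim_transform_bound[THEN Lim_null[THEN iffD2]])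
    let ?g = "\<lambda>p. norm (D (fst p, \<zeta> (fst p)) (snd p, D\<zeta> u v) - D (u, \<zeta> u) (v, D\<zeta> u v)) / (1 - q)"
    have "filterlim (\<lambda>p. ((fst p, \<zeta> (fst p)), (snd p, D\<zeta> u v)))
        (nhds (u, \<zeta> u) \<times>\<^sub>F nhds (v, D\<zeta> u v)) (nhds u \<times>\<^sub>F nhds v)"
      by (intro filterlim_Pair filterlim_compose[OF lim\<zeta>'[OF u]] tendsto_Pair tendsto_const
          filterlim_fst filterlim_snd)
    from filterlim_compose[OF hadamard_C1_tendsto[OF \<Gamma> Q[OF u]] this]
    have "((\<lambda>p. D (fst p, \<zeta> (fst p)) (snd p, D\<zeta> u v)) \<longlongrightarrow> D (u, \<zeta> u) (v, D\<zeta> u v))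
        (nhds u \<times>\<^sub>F nhds v)" by simp
    then have "(?g \<longlongrightarrow> 0 / (1 - q)) (nhds u \<times>\<^sub>F nhds v)"
      using q by (intro tendsto_divide tendsto_const) (auto intro: tendsto_norm_zero simp: Lim_null[symmetric])
    then show "(?g \<longlongrightarrow> 0) (nhds u \<times>\<^sub>F nhds v)" by simp
    have "\<forall>\<^sub>F p in nhds u \<times>\<^sub>F nhds v. fst p \<in> N"
      using filterlim_fst inN[OF u] unfolding filterlim_iff by blast
    then show "\<forall>\<^sub>F p in nhds u \<times>\<^sub>F nhds v. norm (D\<zeta> (fst p) (snd p) - D\<zeta> u v) \<le> norm (?g p)"
      by eventually_elim (use D\<zeta>_diff[OF _ u] q in simp)
  qed
  have "hadamard_C1 N \<zeta> D\<zeta>"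
  proof (rule hadamard_C1I[OF N])
    show "continuous_on N \<zeta>"
      unfolding continuous_on_def using lim\<zeta> by (auto intro: tendsto_mono[OF at_le[OF subset_UNIV]]
        simp: tendsto_at_iff_tendsto_nhds)
    show "linear (D\<zeta> u)" if "u \<in> N" for u using D\<zeta>_lin[OF that] .
    show "continuous_on (N \<times> UNIV) (\<lambda>p. D\<zeta> (fst p) (snd p))"
      unfolding continuous_on_def
    proof
      fix p :: "'a \<times> 'a" assume "p \<in> N \<times> UNIV"
      then have "((\<lambda>p. D\<zeta> (fst p) (snd p)) \<longlongrightarrow> D\<zeta> (fst p) (snd p)) (nhds p)"
        using limD\<zeta>[of "fst p" "snd p"] by (simp add: nhds_prod[symmetric] mem_Times_iff)
      then show "((\<lambda>p. D\<zeta> (fst p) (snd p)) \<longlongrightarrow> D\<zeta> (fst p) (snd p)) (at p within N \<times> UNIV)"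
        by (rule tendsto_mono[rotated]) (simp add: at_within_def)
    qed
    show "\<forall>\<^sub>F u' in nhds u. \<forall>b\<in>B. D\<zeta> u' b - D\<zeta> u b \<in> M"
      if u: "u \<in> N" and B: "tvs_bounded B" and M: "open M" "0 \<in> M" for u B M
    proof -
      obtain e where e: "e > 0" "ball 0 e \<subseteq> M" using M by (meson openE)
      have "continuous_on UNIV (D\<zeta> u)"
        by (rule linear_continuousI[OF D\<zeta>_lin[OF u]])
          (use filterlim_compose[OF limD\<zeta>[OF u, of 0] filterlim_Pair[OF tendsto_const filterlim_ident]]
            linear_0[OF D\<zeta>_lin[OF u]] in simp)
      \<comment> \<open>The derivative of \<Gamma> is applied to pairs (b, D\<zeta> u b), so
        uniformity over B is needed on the graph of D\<zeta> u over B.\<close>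
      then have "tvs_bounded ((\<lambda>b. (b, D\<zeta> u b)) ` B)"
        using linear_add[OF D\<zeta>_lin[OF u]] linear_cmul[OF D\<zeta>_lin[OF u]]
        by (intro tvs_bounded_linear_image B linearI continuous_on_Pair continuous_on_id) auto
      from hadamard_C1D(6)[OF \<Gamma> Q[OF u] this, of "ball 0 ((1 - q) * e)"] e q
      have "\<forall>\<^sub>F y in nhds (u, \<zeta> u). \<forall>b\<in>B. D y (b, D\<zeta> u b) - D (u, \<zeta> u) (b, D\<zeta> u b) \<in> ball 0 ((1 - q) * e)"
        by simp
      with lim\<zeta>'[OF u] have "\<forall>\<^sub>F u' in nhds u. \<forall>b\<in>B.
          D (u', \<zeta> u') (b, D\<zeta> u b) - D (u, \<zeta> u) (b, D\<zeta> u b) \<in> ball 0 ((1 - q) * e)"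
        unfolding filterlim_iff by blast
      with inN[OF u] show ?thesis
      proof eventually_elim
        case (elim u')
        show ?case
        proof
          fix b assume "b \<in> B"
          then have "norm (D (u', \<zeta> u') (b, D\<zeta> u b) - D (u, \<zeta> u) (b, D\<zeta> u b)) / (1 - q) < e"
            using elim(2) q by (simp add: field_simps)
          then show "D\<zeta> u' b - D\<zeta> u b \<in> M"
            using D\<zeta>_diff[OF elim(1) u, of b b] e(2) by (force simp: dist_norm)
        qed
      qed
    qed
    show "hadamard_deriv \<zeta> u v (D\<zeta> u v)" if u: "u \<in> N" for u v
      unfolding hadamard_deriv_def
    proof (rule Lim_transform_bound[THEN Lim_null[THEN iffD2]])
      define w where "w = D\<zeta> u v"
      let ?F = "at (0::real) \<times>\<^sub>F nhds v"
      \<comment> \<open>\<zeta> u' is compared with its linear prediction \<zeta> u + t w. By the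
        fixed point equations, the error which the prediction makes in the equation at u' is t (E -
        w), and E tends to D (u, \<zeta> u) (v, w) = w.\<close>
      define E where "E p = (1 / fst p) *\<^sub>R (\<Gamma> ((u, \<zeta> u) + fst p *\<^sub>R (snd p, w)) - \<Gamma> (u, \<zeta> u))"
        for p :: "real \<times> 'a"
      have "(E \<longlongrightarrow> D (u, \<zeta> u) (v, w)) ?F"
        unfolding E_def
        by (intro hadamard_deriv_along[OF hadamard_C1D(4)[OF \<Gamma> Q[OF u]]] eventually_fst_neq
            tendsto_Pair tendsto_const tendsto_mono[OF tendsto_at_le_nhds filterlim_fst]
            tendsto_mono[OF tendsto_at_le_nhds filterlim_snd])
      then have "((\<lambda>p. norm (E p - w) / (1 - q)) \<longlongrightarrow> 0 / (1 - q)) ?F"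
        using q D\<zeta>[OF u, of v] unfolding w_def[symmetric]
        by (intro tendsto_divide tendsto_const) (auto intro: tendsto_norm_zero simp: Lim_null[symmetric])
      then show "((\<lambda>p. norm (E p - w) / (1 - q)) \<longlongrightarrow> 0) ?F" by simp
      have "((\<lambda>p. \<zeta> u + fst p *\<^sub>R w) \<longlongrightarrow> \<zeta> u + 0 *\<^sub>R w) ?F"
        by (intro tendsto_intros tendsto_mono[OF tendsto_at_le_nhds filterlim_fst])
      then have "\<forall>\<^sub>F p in ?F. \<zeta> u + fst p *\<^sub>R w \<in> ball z0 r"
        using \<zeta>_ball[OF u] by (intro topological_tendstoD) auto
      moreover have "\<forall>\<^sub>F p in ?F. u + fst p *\<^sub>R snd p \<in> N"
        using topological_tendstoD[OF tendsto_line N u] .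
      moreover note eventually_fst_neq[of "nhds v"]
      ultimately show "\<forall>\<^sub>F p in ?F. norm ((1 / fst p) *\<^sub>R (\<zeta> (u + fst p *\<^sub>R snd p) - \<zeta> u) - D\<zeta> u v)
          \<le> norm (norm (E p - w) / (1 - q))"
      proof eventually_elim
        case (elim p)
        define t where "t = fst p"
        define u' where "u' = u + t *\<^sub>R snd p"
        have u': "u' \<in> N" and t: "t \<noteq> 0" and ball: "\<zeta> u + t *\<^sub>R w \<in> cball z0 r"
          using elim by (auto simp: u'_def t_def)
        let ?x = "(1 / t) *\<^sub>R (\<zeta> u' - \<zeta> u) - w"
        have tx: "t *\<^sub>R ?x = \<zeta> u' - (\<zeta> u + t *\<^sub>R w)" using t by (simp add: algebra_simps)
        have "t *\<^sub>R ?x = (\<Gamma> (u', \<zeta> u') - \<Gamma> (u', \<zeta> u + t *\<^sub>R w)) + t *\<^sub>R (E p - w)"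
          using t \<zeta>(2)[OF u'] \<zeta>(2)[OF u] unfolding tx E_def t_def[symmetric]
          by (simp add: algebra_simps u'_def)
        then have "norm (t *\<^sub>R ?x) \<le> q * norm (t *\<^sub>R ?x) + norm (t *\<^sub>R (E p - w))"
          using lip[OF u' \<zeta>(1)[OF u'] ball] unfolding tx
          by (metis (no_types) add_right_mono norm_triangle_le)
        then have "\<bar>t\<bar> * norm ?x \<le> \<bar>t\<bar> * (q * norm ?x + norm (E p - w))"
          unfolding norm_scaleR by (simp only: algebra_simps)
        then have "norm ?x \<le> q * norm ?x + norm (E p - w)"
          using t by (metis mult_le_cancel_left_pos zero_less_abs_iff)
        from norm_le_contraction[OF this q(2)] q show ?case
          by (simp add: u'_def t_def w_def)
      qed
    qed
  qed
  then show thesis using that \<zeta>_ball \<zeta>(2) \<zeta>_unique D\<zeta> by metis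
qed

text \<open>Makes \<open>parametrized_contraction\<close> applicable to fixed points in the space of
  bounded continuous functions.\<close>

instance bcontfun :: (metric_space, banach) banach ..

section \<open>Superposition operators\<close>

text \<open>The tube lemma with an arbitrary filter in place of a neighbourhood filter: finitely
  many of the local boxes cover K, and finitely many eventualities can be combined.\<close>

lemma eventually_tube:
  assumes "compact K"
    and loc: "\<And>t. t \<in> K \<Longrightarrow> \<forall>\<^sub>F p in nhds t \<times>\<^sub>F F. fst p \<in> K \<longrightarrow> P (fst p) (snd p)"
  shows "\<forall>\<^sub>F u in F. \<forall>t\<in>K. P t u"
proof -
  have "\<exists>A R. open A \<and> t \<in> A \<and> eventually R F \<and> (\<forall>s\<in>A \<inter> K. \<forall>u. R u \<longrightarrow> P s u)" if t: "t \<in> K" for t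
  proof -
    obtain Q R where "eventually Q (nhds t)" "eventually R F"
      and QR: "\<And>s u. Q s \<Longrightarrow> R u \<Longrightarrow> s \<in> K \<longrightarrow> P s u"
      using loc[OF t] unfolding eventually_prod_filter by auto
    then show ?thesis unfolding eventually_nhds by (metis IntE)
  qed
  then obtain A R where AR: "\<And>t. t \<in> K \<Longrightarrow> open (A t) \<and> t \<in> A t \<and> eventually (R t) F \<and>
      (\<forall>s\<in>A t \<inter> K. \<forall>u. R t u \<longrightarrow> P s u)"
    by metis
  then have "\<forall>t\<in>K. open (A t)" "K \<subseteq> (\<Union>t\<in>K. A t)" by blast+
  then obtain C where C: "C \<subseteq> K" "finite C" "K \<subseteq> (\<Union>t\<in>C. A t)"
    using compactE_image[OF assms(1)] by metis
  have "\<forall>\<^sub>F u in F. \<forall>t\<in>C. R t u"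
    using C(1,2) AR by (intro eventually_ball_finite) auto
  then show ?thesis
  proof eventually_elim
    case (elim u)
    show ?case
    proof
      fix s assume "s \<in> K"
      then obtain t where "t \<in> C" "s \<in> A t" using C(3) by blast
      then show "P s u" using AR[of t] C(1) elim \<open>s \<in> K\<close> by blast
    qed
  qed
qed

text \<open>The mean value inequality for \<theta> to f (y + \<theta> d) - \<theta> A, whose
  derivative is D \<theta> - A. With A = 0 it yields Lipschitz estimates, with A a derivative it
  yields differentiability.\<close>

lemma mvt_line:
  fixes f :: "'a::tvs \<Rightarrow> 'c::real_inner"
  assumes der: "\<And>\<theta>. \<theta> \<in> {0..1} \<Longrightarrow> has_dir_deriv f (y + \<theta> *\<^sub>R d) d (D \<theta>)"
    and le: "\<And>\<theta>. \<theta> \<in> {0..1} \<Longrightarrow> norm (D \<theta> - A) \<le> e"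
  shows "norm (f (y + d) - f y - A) \<le> e"
proof -
  define g where "g \<theta> = f (y + \<theta> *\<^sub>R d) - \<theta> *\<^sub>R A" for \<theta> :: real
  have der_g: "(g has_derivative (\<lambda>h. h *\<^sub>R (D \<theta> - A))) (at \<theta>)" if \<theta>: "\<theta> \<in> {0..1}" for \<theta>
    unfolding has_derivative_at
  proof
    show "bounded_linear (\<lambda>h. h *\<^sub>R (D \<theta> - A))" by (rule bounded_linear_scaleR_left)
    have "((\<lambda>t. norm ((1 / t) *\<^sub>R (f (y + \<theta> *\<^sub>R d + t *\<^sub>R d) - f (y + \<theta> *\<^sub>R d)) - D \<theta>)) \<longlongrightarrow> 0) (at 0)"
      using der[OF \<theta>] unfolding has_dir_deriv_def by (simp add: Lim_null[symmetric] tendsto_norm_zero)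
    moreover have "\<forall>\<^sub>F t in at 0. norm ((1 / t) *\<^sub>R (f (y + \<theta> *\<^sub>R d + t *\<^sub>R d) - f (y + \<theta> *\<^sub>R d)) - D \<theta>) =
        norm (g (\<theta> + t) - g \<theta> - t *\<^sub>R (D \<theta> - A)) / norm t"
      unfolding eventually_at_filter
    proof (rule always_eventually, intro allI impI)
      fix t :: real assume t: "t \<noteq> 0"
      have "g (\<theta> + t) - g \<theta> - t *\<^sub>R (D \<theta> - A) =
          t *\<^sub>R ((1 / t) *\<^sub>R (f (y + \<theta> *\<^sub>R d + t *\<^sub>R d) - f (y + \<theta> *\<^sub>R d)) - D \<theta>)"
        using t by (simp add: g_def algebra_simps)
      then show "norm ((1 / t) *\<^sub>R (f (y + \<theta> *\<^sub>R d + t *\<^sub>R d) - f (y + \<theta> *\<^sub>R d)) - D \<theta>) =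
        norm (g (\<theta> + t) - g \<theta> - t *\<^sub>R (D \<theta> - A)) / norm t" using t by simp
    qed
    ultimately show "((\<lambda>h. norm (g (\<theta> + h) - g \<theta> - h *\<^sub>R (D \<theta> - A)) / norm h) \<longlongrightarrow> 0) (at 0)"
      using tendsto_cong by fast
  qed
  have "continuous_on {0..1} g"
    using der_g has_derivative_continuous by (intro continuous_at_imp_continuous_on) blast
  then obtain \<theta> where \<theta>: "\<theta> \<in> {0<..<1}" "norm (g 1 - g 0) \<le> norm ((1 - 0) *\<^sub>R (D \<theta> - A))"
    using mvt_general[of 0 1 g "\<lambda>\<theta> h. h *\<^sub>R (D \<theta> - A)"] der_g by auto
  then show ?thesis using le[of \<theta>] by (simp add: g_def diff_diff_eq add.commute)
qed

text \<open>Clamping the argument to [0, h] turns continuous functions on [0, h] into bounded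
  continuous functions on the real line, so that this Banach space can stand in for
  C([0, h]).\<close>

lemma apply_Bcontfun_clamp:
  fixes g :: "real \<Rightarrow> 'c::metric_space"
  assumes "continuous_on {0..h} g" "0 \<le> h"
  shows "apply_bcontfun (Bcontfun (\<lambda>t. g (max 0 (min h t)))) t = g (max 0 (min h t))"
proof -
  have im: "max 0 (min h s) \<in> {0..h}" for s using assms(2) by auto
  have "continuous_on UNIV (\<lambda>t. g (max 0 (min h t)))"
    using im by (intro continuous_on_compose2[OF assms(1)] continuous_intros) auto
  moreover have "bounded (range (\<lambda>t. g (max 0 (min h t))))"
    using compact_imp_bounded[OF compact_continuous_image[OF assms(1) compact_Icc]]
    by (rule bounded_subset) (use im in auto)
  ultimately show ?thesis by (simp add: Bcontfun_inverse bcontfun_def)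
qed

lemma eventually_fst_snd:
  assumes "eventually P F" shows "\<forall>\<^sub>F p in G \<times>\<^sub>F F. P (snd p)" "\<forall>\<^sub>F p in F \<times>\<^sub>F G. P (fst p)"
  using filterlim_iff[THEN iffD1, OF filterlim_snd] filterlim_iff[THEN iffD1, OF filterlim_fst] assms
  by blast+

text \<open>Reduces convergence in the sup norm to convergence jointly in time and parameter. The
  tube yields the bound e / 2 at all times, so the supremum remains strictly below e.\<close>

lemma tendsto_bcontfun_tube:
  fixes \<Phi> :: "'x \<Rightarrow> real \<Rightarrow>\<^sub>C 'c::real_normed_vector"
  assumes h: "0 \<le> h"
    and G: "\<And>t. t \<in> {0..h} \<Longrightarrow> ((\<lambda>p. G (fst p) (snd p)) \<longlongrightarrow> L t) (nhds t \<times>\<^sub>F F)"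
    and L: "\<And>t. t \<in> {0..h} \<Longrightarrow> (L \<longlongrightarrow> L t) (nhds t)"
    and \<Phi>: "\<forall>\<^sub>F x in F. \<forall>t. apply_bcontfun (\<Phi> x) t = G (max 0 (min h t)) x"
    and l: "\<And>t. apply_bcontfun l t = L (max 0 (min h t))"
  shows "(\<Phi> \<longlongrightarrow> l) F"
proof (rule tendstoI)
  fix e :: real assume e: "0 < e"
  have "\<forall>\<^sub>F x in F. \<forall>t\<in>{0..h}. dist (G t x) (L t) < e / 2"
  proof (rule eventually_tube[OF compact_Icc])
    fix t assume t: "t \<in> {0..h}"
    have "\<forall>\<^sub>F p in nhds t \<times>\<^sub>F F. dist (G (fst p) (snd p)) (L t) < e / 4"
      using tendstoD[OF G[OF t], of "e / 4"] e by simp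
    moreover have "\<forall>\<^sub>F p in nhds t \<times>\<^sub>F F. dist (L (fst p)) (L t) < e / 4"
      using tendstoD[OF L[OF t], of "e / 4"] e by (intro eventually_fst_snd) simp
    ultimately show "\<forall>\<^sub>F p in nhds t \<times>\<^sub>F F. fst p \<in> {0..h} \<longrightarrow> dist (G (fst p) (snd p)) (L (fst p)) < e / 2"
    proof eventually_elim
      case (elim p)
      then show ?case
        using dist_triangle2[of "G (fst p) (snd p)" "L (fst p)" "L t"] by linarith
    qed
  qed
  with \<Phi> show "\<forall>\<^sub>F x in F. dist (\<Phi> x) l < e"
  proof eventually_elim
    case (elim x)
    have "dist (\<Phi> x) l \<le> e / 2"
    proof (rule dist_bound)
      fix t
      have "max 0 (min h t) \<in> {0..h}" using h by auto
      then show "dist (apply_bcontfun (\<Phi> x) t) (apply_bcontfun l t) \<le> e / 2"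
        using elim l by (simp add: less_imp_le)
    qed
    then show ?case using e by simp
  qed
qed

text \<open>Joint continuity of the derivative permits base point, step and direction to vary
  together: by compactness of the unit interval the derivatives along the whole segment are close to
  D y0 k0, and the mean value inequality applies.\<close>

lemma strict_derivative:
  fixes f :: "'b::tvs \<Rightarrow> 'c::real_inner"
  assumes V: "open V" "y0 \<in> V"
    and lin: "\<And>u. u \<in> V \<Longrightarrow> linear (D u)"
    and der: "\<And>u v. u \<in> V \<Longrightarrow> has_dir_deriv f u v (D u v)"
    and jc: "continuous_on (V \<times> UNIV) (\<lambda>p. D (fst p) (snd p))"
    and y: "(y \<longlongrightarrow> y0) F" and s: "(s \<longlongrightarrow> 0) F" "\<forall>\<^sub>F x in F. s x \<noteq> 0" and k: "(k \<longlongrightarrow> k0) F"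
  shows "((\<lambda>x. (1 / s x) *\<^sub>R (f (y x + s x *\<^sub>R k x) - f (y x))) \<longlongrightarrow> D y0 k0) F"
proof (rule tendstoI)
  fix e :: real assume e: "0 < e"
  have "\<forall>\<^sub>F x in F. \<forall>\<theta>\<in>{0..1}. y x + (\<theta> * s x) *\<^sub>R k x \<in> V \<and>
      dist (D (y x + (\<theta> * s x) *\<^sub>R k x) (k x)) (D y0 k0) < e / 2"
  proof (rule eventually_tube[OF compact_Icc])
    fix \<theta> :: real
    let ?F = "nhds \<theta> \<times>\<^sub>F F"
    have snd: "filterlim (\<lambda>p. snd p) F ?F" by (rule filterlim_snd)
    have "((\<lambda>p. y (snd p) + (fst p * s (snd p)) *\<^sub>R k (snd p)) \<longlongrightarrow> y0 + (\<theta> * 0) *\<^sub>R k0) ?F"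
      by (intro tendsto_intros filterlim_compose[OF y snd] filterlim_compose[OF s(1) snd]
          filterlim_compose[OF k snd] filterlim_fst)
    then have lim: "((\<lambda>p. y (snd p) + (fst p * s (snd p)) *\<^sub>R k (snd p)) \<longlongrightarrow> y0) ?F" by simp
    have "((\<lambda>p. (y (snd p) + (fst p * s (snd p)) *\<^sub>R k (snd p), k (snd p))) \<longlongrightarrow> (y0, k0)) ?F"
      by (intro tendsto_Pair lim filterlim_compose[OF k snd])
    moreover have "filterlim (\<lambda>p. D (fst p) (snd p)) (nhds (D y0 k0)) (nhds (y0, k0))"
      using continuous_on_open_nhds[OF jc open_Times[OF V(1) open_UNIV], of "(y0, k0)"] V(2) by simp
    ultimately have "((\<lambda>p. D (y (snd p) + (fst p * s (snd p)) *\<^sub>R k (snd p)) (k (snd p))) \<longlongrightarrow> D y0 k0) ?F"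
      using filterlim_compose by fastforce
    from tendstoD[OF this, of "e / 2"] e topological_tendstoD[OF lim V]
    show "\<forall>\<^sub>F p in ?F. fst p \<in> {0..1} \<longrightarrow> y (snd p) + (fst p * s (snd p)) *\<^sub>R k (snd p) \<in> V \<and>
      dist (D (y (snd p) + (fst p * s (snd p)) *\<^sub>R k (snd p)) (k (snd p))) (D y0 k0) < e / 2"
      by (auto elim: eventually_elim2)
  qed
  with s(2) show "\<forall>\<^sub>F x in F. dist ((1 / s x) *\<^sub>R (f (y x + s x *\<^sub>R k x) - f (y x))) (D y0 k0) < e"
  proof eventually_elim
    case (elim x)
    have V': "y x + \<theta> *\<^sub>R s x *\<^sub>R k x \<in> V" if "\<theta> \<in> {0..1}" for \<theta> using elim that by simp
    have "norm (f (y x + s x *\<^sub>R k x) - f (y x) - s x *\<^sub>R D y0 k0) \<le> \<bar>s x\<bar> * (e / 2)"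
    proof (rule mvt_line)
      show "has_dir_deriv f (y x + \<theta> *\<^sub>R s x *\<^sub>R k x) (s x *\<^sub>R k x)
          (D (y x + \<theta> *\<^sub>R s x *\<^sub>R k x) (s x *\<^sub>R k x))" if "\<theta> \<in> {0..1}" for \<theta>
        using der[OF V'[OF that]] .
      fix \<theta> :: real assume \<theta>: "\<theta> \<in> {0..1}"
      have "D (y x + \<theta> *\<^sub>R s x *\<^sub>R k x) (s x *\<^sub>R k x) - s x *\<^sub>R D y0 k0 =
          s x *\<^sub>R (D (y x + \<theta> *\<^sub>R s x *\<^sub>R k x) (k x) - D y0 k0)"
        using linear_cmul[OF lin[OF V'[OF \<theta>]]] by (simp add: algebra_simps)
      moreover have "norm (D (y x + \<theta> *\<^sub>R s x *\<^sub>R k x) (k x) - D y0 k0) \<le> e / 2"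
        using elim \<theta> by (simp add: dist_norm less_imp_le)
      ultimately show "norm (D (y x + \<theta> *\<^sub>R s x *\<^sub>R k x) (s x *\<^sub>R k x) - s x *\<^sub>R D y0 k0) \<le> \<bar>s x\<bar> * (e / 2)"
        by (simp only: norm_scaleR) (intro mult_left_mono abs_ge_zero)
    qed
    moreover have "(1 / s x) *\<^sub>R (f (y x + s x *\<^sub>R k x) - f (y x)) - D y0 k0 =
        (1 / s x) *\<^sub>R (f (y x + s x *\<^sub>R k x) - f (y x) - s x *\<^sub>R D y0 k0)"
      using elim(1) by (simp add: algebra_simps)
    ultimately have "dist ((1 / s x) *\<^sub>R (f (y x + s x *\<^sub>R k x) - f (y x))) (D y0 k0) \<le> e / 2"
      using elim(1) by (simp add: dist_norm divide_le_eq mult.commute)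
    then show ?case using e by simp
  qed
qed

lemma hadamard_C1_of_dir_deriv:
  fixes f :: "'b::tvs \<Rightarrow> 'c::real_inner"
  assumes V: "open V" and cont: "continuous_on V f"
    and lin: "\<And>u. u \<in> V \<Longrightarrow> linear (D u)"
    and der: "\<And>u v. u \<in> V \<Longrightarrow> has_dir_deriv f u v (D u v)"
    and jc: "continuous_on (V \<times> UNIV) (\<lambda>p. D (fst p) (snd p))"
    and beta: "\<And>u B N. u \<in> V \<Longrightarrow> tvs_bounded B \<Longrightarrow> open N \<Longrightarrow> 0 \<in> N \<Longrightarrow>
      \<forall>\<^sub>F u' in nhds u. \<forall>b\<in>B. D u' b - D u b \<in> N"
  shows "hadamard_C1 V f D"
proof (rule hadamard_C1I[OF V cont lin _ jc beta])
  show "hadamard_deriv f u v (D u v)" if "u \<in> V" for u v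
    unfolding hadamard_deriv_def
    by (rule strict_derivative[OF V that lin der jc tendsto_const _ eventually_fst_neq])
      (auto intro: tendsto_mono[OF tendsto_at_le_nhds filterlim_fst]
        tendsto_mono[OF tendsto_at_le_nhds filterlim_snd])
qed

text \<open>In the application S t sends an initial segment and a prescribed derivative to the
  segment at time t. Every property required in the sup norm is a limit taken jointly in time and
  argument, made uniform in time by compactness. For the derivative the base point moves with time,
  which is what \<open>strict_derivative\<close> allows.\<close>

lemma hadamard_C1_superposition:
  fixes S :: "real \<Rightarrow> 'a::tvs \<Rightarrow> 'b::tvs" and f :: "'b \<Rightarrow> 'c::euclidean_space"
  assumes f: "hadamard_C1 V f D"
    and h: "0 \<le> h"
    and S_lin: "\<And>t. t \<in> {0..h} \<Longrightarrow> linear (S t)"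
    and S_cont: "continuous_on ({0..h} \<times> UNIV) (\<lambda>p. S (fst p) (snd p))"
  shows "hadamard_C1 {u. \<forall>t\<in>{0..h}. S t u \<in> V}
    (\<lambda>u. Bcontfun (\<lambda>t. f (S (max 0 (min h t)) u)))
    (\<lambda>u v. Bcontfun (\<lambda>t. D (S (max 0 (min h t)) u) (S (max 0 (min h t)) v)))"
    (is "hadamard_C1 ?Q ?F ?DF")
proof -
  let ?c = "\<lambda>t. max 0 (min h t)"
  have im: "?c s \<in> {0..h}" for s using h by auto
  have c_eq: "?c s = s" if "s \<in> {0..h}" for s using that by auto
  \<comment> \<open>Clamping the time extends S to all real t, so that limits along full
    neighbourhoods of t are available also at 0 and h.\<close>
  define R where "R t = S (?c t)" for t
  have R_c: "R (?c t) = R t" for t unfolding R_def using c_eq[OF im] by simp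
  have R_lin: "linear (R t)" for t unfolding R_def using S_lin[OF im] .
  have "continuous_on UNIV (\<lambda>p. R (fst p) (snd p))"
  proof -
    have "continuous_on UNIV (\<lambda>p::real \<times> 'a. (?c (fst p), snd p))"
      by (intro continuous_intros)
    from continuous_on_compose2[OF S_cont this] im show ?thesis by (simp add: R_def image_subset_iff)
  qed
  then have limR: "((\<lambda>p. R (fst p) (snd p)) \<longlongrightarrow> R t u) (nhds t \<times>\<^sub>F nhds u)" for t u
    using continuous_on_open_nhds[of UNIV "\<lambda>p. R (fst p) (snd p)" "(t, u)"] by (simp add: nhds_prod)
  have limR': "((\<lambda>x. R (a x) (b x)) \<longlongrightarrow> R t u) F" if "(a \<longlongrightarrow> t) F" "(b \<longlongrightarrow> u) F" for a b t u F
    using filterlim_compose[OF limR filterlim_Pair[OF that]] by simp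
  define Q where "Q = {u. \<forall>t\<in>{0..h}. R t u \<in> V}"
  define F where "F = ?F"
  define DF where "DF = ?DF"
  have Q_iff: "u \<in> Q \<longleftrightarrow> (\<forall>t\<in>{0..h}. R t u \<in> V)" for u unfolding Q_def by blast
  have evQ: "\<forall>\<^sub>F u' in nhds u. u' \<in> Q" if "u \<in> Q" for u
    unfolding Q_iff
  proof (rule eventually_tube[OF compact_Icc])
    fix t assume "t \<in> {0..h}"
    then have "R t u \<in> V" using that unfolding Q_iff by blast
    from topological_tendstoD[OF limR hadamard_C1D(1)[OF f] this]
    show "\<forall>\<^sub>F p in nhds t \<times>\<^sub>F nhds u. fst p \<in> {0..h} \<longrightarrow> R (fst p) (snd p) \<in> V"
      by (rule eventually_mono) simp
  qed
  have open_Q: "open Q"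
    unfolding open_subopen[of Q]
  proof
    fix u assume "u \<in> Q"
    from evQ[OF this] show "\<exists>T. open T \<and> u \<in> T \<and> T \<subseteq> Q" unfolding eventually_nhds by blast
  qed
  have RV: "R t u \<in> V" if "u \<in> Q" for t u
    using bspec[OF that[unfolded Q_iff] im[of t]] unfolding R_c .
  have limf: "((\<lambda>x. f (R (a x) (b x))) \<longlongrightarrow> f (R t u)) F"
    if "u \<in> Q" "(a \<longlongrightarrow> t) F" "(b \<longlongrightarrow> u) F" for a b t u F
    using filterlim_compose[OF continuous_on_open_nhds[OF hadamard_C1D(2,1)[OF f] RV[OF that(1)]]
        limR'[OF that(2,3)]] .
  have limD: "((\<lambda>x. D (R (a x) (b x)) (R (a' x) (b' x))) \<longlongrightarrow> D (R t u) (R t' v)) F"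
    if "u \<in> Q" "(a \<longlongrightarrow> t) F" "(b \<longlongrightarrow> u) F" "(a' \<longlongrightarrow> t') F" "(b' \<longlongrightarrow> v) F" for a b t u a' b' t' v F
    using filterlim_compose[OF hadamard_C1_tendsto[OF f RV[OF that(1)]]
        filterlim_Pair[OF limR'[OF that(2,3)] limR'[OF that(4,5)]]] by simp
  have F_eq: "apply_bcontfun (F u) t = f (R t u)" if "u \<in> Q" for u t
  proof -
    have "continuous_on UNIV (\<lambda>t. f (R t u))"
      unfolding continuous_on_def by (intro ballI limf that tendsto_intros)
    then have "continuous_on {0..h} (\<lambda>t. f (R t u))" by (rule continuous_on_subset) simp
    from apply_Bcontfun_clamp[OF this h] show ?thesis unfolding F_def R_c unfolding R_def c_eq[OF im] .
  qed
  have DF_eq: "apply_bcontfun (DF u v) t = D (R t u) (R t v)" if "u \<in> Q" for u v t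
  proof -
    have "continuous_on UNIV (\<lambda>t. D (R t u) (R t v))"
      unfolding continuous_on_def by (intro ballI limD that tendsto_intros)
    then have "continuous_on {0..h} (\<lambda>t. D (R t u) (R t v))" by (rule continuous_on_subset) simp
    from apply_Bcontfun_clamp[OF this h] show ?thesis unfolding DF_def R_c unfolding R_def c_eq[OF im] .
  qed
  have cont_F: "(F \<longlongrightarrow> F u) (nhds u)" if u: "u \<in> Q" for u
  proof (rule tendsto_bcontfun_tube[OF h, where G = "\<lambda>t u. f (R t u)" and L = "\<lambda>t. f (R t u)"])
    show "\<forall>\<^sub>F x in nhds u. \<forall>t. apply_bcontfun (F x) t = f (R (?c t) x)"
      using evQ[OF u] by eventually_elim (simp only: F_eq R_c, simp)
  qed (auto intro!: limf[OF u] filterlim_fst filterlim_snd filterlim_ident simp only: F_eq[OF u] R_c)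
  have cont_DF: "((\<lambda>p. DF (fst p) (snd p)) \<longlongrightarrow> DF u v) (nhds u \<times>\<^sub>F nhds v)" if u: "u \<in> Q" for u v
  proof (rule tendsto_bcontfun_tube[OF h, where G = "\<lambda>t p. D (R t (fst p)) (R t (snd p))"
        and L = "\<lambda>t. D (R t u) (R t v)"])
    show "\<forall>\<^sub>F x in nhds u \<times>\<^sub>F nhds v. \<forall>t. apply_bcontfun (DF (fst x) (snd x)) t =
        D (R (?c t) (fst x)) (R (?c t) (snd x))"
      using eventually_fst_snd(2)[OF evQ[OF u]] by eventually_elim (simp only: DF_eq R_c, simp)
  qed (auto intro!: limD[OF u] filterlim_fst filterlim_snd filterlim_ident
      filterlim_compose[OF filterlim_fst filterlim_snd] filterlim_compose[OF filterlim_snd filterlim_snd]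
      simp only: DF_eq[OF u] R_c)
  have "hadamard_C1 Q F DF"
  proof (rule hadamard_C1I[OF open_Q])
    show "continuous_on Q F"
      unfolding continuous_on_def
      by (intro ballI tendsto_mono[OF _ cont_F]) (simp_all add: at_within_def)
    show "linear (DF u)" if "u \<in> Q" for u
      using hadamard_C1D(3)[OF f RV[OF that]]
      by (intro linearI bcontfun_eqI)
        (simp_all only: DF_eq[OF that] plus_bcontfun.rep_eq scaleR_bcontfun.rep_eq
          linear_add[OF R_lin] linear_cmul[OF R_lin] linear_add linear_cmul)
    show "continuous_on (Q \<times> UNIV) (\<lambda>p. DF (fst p) (snd p))"
      unfolding continuous_on_def
    proof
      fix p :: "'a \<times> 'a" assume "p \<in> Q \<times> UNIV"
      then have "((\<lambda>p. DF (fst p) (snd p)) \<longlongrightarrow> DF (fst p) (snd p)) (nhds p)"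
        using cont_DF[of "fst p" "snd p"] by (simp add: nhds_prod[symmetric] mem_Times_iff)
      then show "((\<lambda>p. DF (fst p) (snd p)) \<longlongrightarrow> DF (fst p) (snd p)) (at p within Q \<times> UNIV)"
        by (rule tendsto_mono[rotated]) (simp add: at_within_def)
    qed
    show "hadamard_deriv F u v (DF u v)" if u: "u \<in> Q" for u v
      unfolding hadamard_deriv_def
    proof (rule tendsto_bcontfun_tube[OF h, where L = "\<lambda>t. D (R t u) (R t v)" and
          G = "\<lambda>t p. (1 / fst p) *\<^sub>R (f (R t u + fst p *\<^sub>R R t (snd p)) - f (R t u))"])
      let ?F' = "at (0::real) \<times>\<^sub>F nhds v"
      have evQ': "\<forall>\<^sub>F p in ?F'. u + fst p *\<^sub>R snd p \<in> Q"
        using topological_tendstoD[OF tendsto_line open_Q u] .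
      then show "\<forall>\<^sub>F p in ?F'. \<forall>t. apply_bcontfun ((1 / fst p) *\<^sub>R (F (u + fst p *\<^sub>R snd p) - F u)) t =
          (1 / fst p) *\<^sub>R (f (R (?c t) u + fst p *\<^sub>R R (?c t) (snd p)) - f (R (?c t) u))"
        by eventually_elim (simp only: F_eq[OF u] F_eq R_c scaleR_bcontfun.rep_eq minus_bcontfun.rep_eq
            linear_add[OF R_lin] linear_cmul[OF R_lin], simp)
      fix t :: real
      have "((\<lambda>x. fst (snd x)) \<longlongrightarrow> 0) (nhds t \<times>\<^sub>F ?F')" "((\<lambda>x. snd (snd x)) \<longlongrightarrow> v) (nhds t \<times>\<^sub>F ?F')"
        using filterlim_compose[OF tendsto_mono[OF tendsto_at_le_nhds filterlim_fst] filterlim_snd]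
          filterlim_compose[OF tendsto_mono[OF tendsto_at_le_nhds filterlim_snd] filterlim_snd] by blast+
      then show "((\<lambda>p. (1 / fst (snd p)) *\<^sub>R (f (R (fst p) u + fst (snd p) *\<^sub>R R (fst p) (snd (snd p))) -
          f (R (fst p) u))) \<longlongrightarrow> D (R t u) (R t v)) (nhds t \<times>\<^sub>F ?F')"
        by (intro strict_derivative[OF hadamard_C1D(1)[OF f] RV[OF u] hadamard_C1D(3)[OF f]
              hadamard_deriv_imp_dir[OF hadamard_C1D(4)[OF f]] hadamard_C1D(5)[OF f]]
            limR' tendsto_const filterlim_fst eventually_fst_snd(1) eventually_fst_neq)
    qed (auto intro!: limD[OF u] filterlim_ident simp only: DF_eq[OF u] R_c)
    show "\<forall>\<^sub>F u' in nhds u. \<forall>b\<in>B. DF u' b - DF u b \<in> N"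
      if u: "u \<in> Q" and B: "tvs_bounded B" and N: "open N" "0 \<in> N" for u B N
    proof -
      obtain e where e: "e > 0" "ball 0 e \<subseteq> N" using N by (meson openE)
      \<comment> \<open>Uniformity over B and over all times amounts to uniformity of the derivative
        of f over this union, which compactness of [0, h] keeps bounded.\<close>
      define B' where "B' = (\<Union>t\<in>{0..h}. R t ` B)"
      have "tvs_bounded B'"
        unfolding tvs_bounded_def
      proof (intro allI impI)
        fix M :: "'b set" assume M: "open M \<and> 0 \<in> M"
        have "\<forall>\<^sub>F x in nhds 0. \<forall>t\<in>{0..h}. R t x \<in> M"
        proof (rule eventually_tube[OF compact_Icc])
          fix t
          have "R t 0 \<in> M" using linear_0[OF R_lin] M by simp
          from topological_tendstoD[OF limR _ this]
          show "\<forall>\<^sub>F p in nhds t \<times>\<^sub>F nhds 0. fst p \<in> {0..h} \<longrightarrow> R (fst p) (snd p) \<in> M"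
            using M by (auto elim: eventually_mono)
        qed
        then obtain W where W: "open W" "0 \<in> W" "\<And>x t. x \<in> W \<Longrightarrow> t \<in> {0..h} \<Longrightarrow> R t x \<in> M"
          unfolding eventually_nhds by blast
        then obtain r where r: "r > 0" "\<forall>s\<ge>r. B \<subseteq> (\<lambda>x. s *\<^sub>R x) ` W"
          using B unfolding tvs_bounded_def by meson
        have "B' \<subseteq> (\<lambda>x. s *\<^sub>R x) ` M" if "r \<le> s" for s
        proof
          fix y assume "y \<in> B'"
          then obtain t b where tb: "t \<in> {0..h}" "b \<in> B" "y = R t b" unfolding B'_def by blast
          from subsetD[OF r(2)[rule_format, OF \<open>r \<le> s\<close>] tb(2)]
          obtain x where "x \<in> W" "b = s *\<^sub>R x" by (rule imageE)
          then show "y \<in> (\<lambda>x. s *\<^sub>R x) ` M" using W(3) tb linear_cmul[OF R_lin] by auto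
        qed
        then show "\<exists>r>0. \<forall>s\<ge>r. B' \<subseteq> (\<lambda>x. s *\<^sub>R x) ` M" using r(1) by blast
      qed
      have "\<forall>\<^sub>F u' in nhds u. \<forall>t\<in>{0..h}. \<forall>b\<in>B'. dist (D (R t u') b) (D (R t u) b) < e / 2"
      proof (rule eventually_tube[OF compact_Icc])
        fix t
        have "\<forall>\<^sub>F y in nhds (R t u). \<forall>b\<in>B'. D y b - D (R t u) b \<in> ball 0 (e / 4)"
          using hadamard_C1D(6)[OF f RV[OF u] \<open>tvs_bounded B'\<close>, of "ball 0 (e / 4)"] e by simp
        then have ev: "\<forall>\<^sub>F p in F. \<forall>b\<in>B'. D (R (fst p) (g p)) b - D (R t u) b \<in> ball 0 (e / 4)"
          if "(fst \<longlongrightarrow> t) F" "(g \<longlongrightarrow> u) F" for F and g :: "real \<times> 'a \<Rightarrow> 'a"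
          using limR'[OF that] unfolding filterlim_iff by blast
        show "\<forall>\<^sub>F p in nhds t \<times>\<^sub>F nhds u. fst p \<in> {0..h} \<longrightarrow>
          (\<forall>b\<in>B'. dist (D (R (fst p) (snd p)) b) (D (R (fst p) u) b) < e / 2)"
          using ev[OF filterlim_fst filterlim_snd] ev[OF filterlim_fst tendsto_const]
        proof eventually_elim
          case (elim p)
          show ?case
          proof (intro impI ballI)
            fix b assume "b \<in> B'"
            then have "dist (D (R (fst p) (snd p)) b) (D (R t u) b) < e / 4"
              "dist (D (R (fst p) u) b) (D (R t u) b) < e / 4"
              using elim by (simp_all add: dist_norm norm_minus_commute)
            then show "dist (D (R (fst p) (snd p)) b) (D (R (fst p) u) b) < e / 2"
              using dist_triangle2[of "D (R (fst p) (snd p)) b" "D (R (fst p) u) b" "D (R t u) b"] by linarith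
          qed
        qed
      qed
      with evQ[OF u] show ?thesis
      proof eventually_elim
        case (elim u')
        show ?case
        proof
          fix b assume b: "b \<in> B"
          have "dist (DF u' b) (DF u b) \<le> e / 2"
          proof (rule dist_bound)
            fix t
            have "R (?c t) b \<in> B'" using im b unfolding B'_def by blast
            then have "dist (D (R (?c t) u') (R (?c t) b)) (D (R (?c t) u) (R (?c t) b)) \<le> e / 2"
              using elim(2) im[of t] by (simp add: less_imp_le)
            then show "dist (apply_bcontfun (DF u' b) t) (apply_bcontfun (DF u b) t) \<le> e / 2"
              unfolding DF_eq[OF u] DF_eq[OF elim(1)] R_c .
          qed
          then show "DF u' b - DF u b \<in> N" using e by (intro subsetD[OF e(2)]) (simp add: dist_norm norm_minus_commute)
        qed
      qed
    qed
  qed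
  moreover have "{u. \<forall>t\<in>{0..h}. S t u \<in> V} = Q" unfolding Q_def R_def using c_eq by auto
  ultimately show ?thesis unfolding F_def DF_def by simp
qed

section \<open>Smoothness with respect to the topology of uniform convergence on bounded sets\<close>

lemma beta_continuousD:
  fixes D :: "'a::tvs \<Rightarrow> 'c::tvs \<Rightarrow> 'b::tvs"
  assumes cont: "continuous_map (top_of_set U) (beta_topology G) D" and u: "u \<in> U"
    and B: "B \<subseteq> G" "tvs_bounded B" and N: "open N" "0 \<in> N"
  shows "\<forall>\<^sub>F u' in nhds u. u' \<in> U \<longrightarrow> (\<forall>b\<in>B. D u' b - D u b \<in> N)"
proof -
  \<comment> \<open>The set of all A with A b - D u b in N for b in B need not be open. Requiring a
    margin N' common to all b makes it open, and halving N' shows this.\<close>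
  define S where "S = {A \<in> cont_linear_maps G. \<exists>N'. open N' \<and> 0 \<in> N' \<and>
    (\<forall>b\<in>B. \<forall>n\<in>N'. (A b - D u b) + n \<in> N)}"
  have Du: "D u \<in> cont_linear_maps G"
    using cont u unfolding continuous_map_def topspace_beta_topology by auto
  have "beta_open G S"
  proof (rule beta_openI)
    show "S \<subseteq> cont_linear_maps G" unfolding S_def by blast
    fix A assume "A \<in> S"
    then obtain N' where N': "open N'" "0 \<in> N'" "\<And>b n. b \<in> B \<Longrightarrow> n \<in> N' \<Longrightarrow> (A b - D u b) + n \<in> N"
      unfolding S_def by blast
    obtain M where M: "open M" "0 \<in> M" "\<And>x y. x \<in> M \<Longrightarrow> y \<in> M \<Longrightarrow> x + y \<in> N'"
      using eventually_nhds_0_half[OF N'(1,2)] by metis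
    have "{A' \<in> cont_linear_maps G. \<forall>b\<in>B. A' b - A b \<in> M} \<subseteq> S"
    proof
      fix A' assume A': "A' \<in> {A' \<in> cont_linear_maps G. \<forall>b\<in>B. A' b - A b \<in> M}"
      have "(A' b - D u b) + n \<in> N" if "b \<in> B" "n \<in> M" for b n
        using N'(3)[OF that(1) M(3)[OF _ that(2)], of "A' b - A b"] A' that(1)
        by (simp add: algebra_simps)
      then show "A' \<in> S" using A' M(1,2) unfolding S_def by blast
    qed
    then show "\<exists>B N. B \<subseteq> G \<and> tvs_bounded B \<and> open N \<and> 0 \<in> N \<and>
      {A' \<in> cont_linear_maps G. \<forall>b\<in>B. A' b - A b \<in> N} \<subseteq> S"
      using B M(1,2) by blast
  qed
  then have "openin (top_of_set U) {x \<in> U. D x \<in> S}"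
    using cont unfolding continuous_map_def openin_beta_topology by simp
  then obtain T where T: "open T" "{x \<in> U. D x \<in> S} = U \<inter> T" unfolding openin_open by blast
  have "D u \<in> S" unfolding S_def using Du N by auto
  then have "u \<in> T" using T(2) u by blast
  with T(1) have "\<forall>\<^sub>F u' in nhds u. u' \<in> T" by (rule eventually_nhds_in_open)
  then show ?thesis
  proof eventually_elim
    case (elim u')
    show ?case
    proof (intro impI ballI)
      fix b assume "u' \<in> U" and b: "b \<in> B"
      then have "D u' \<in> S" using T(2) elim by blast
      then obtain N' where "0 \<in> N'" "\<forall>n\<in>N'. (D u' b - D u b) + n \<in> N"
        using b unfolding S_def by blast
      then show "D u' b - D u b \<in> N" by (metis add_0_right)
    qed
  qed
qed

lemma beta_continuousI:
  fixes D :: "'a::tvs \<Rightarrow> 'c::tvs \<Rightarrow> 'b::tvs"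
  assumes lin: "\<And>u. u \<in> U \<Longrightarrow> D u \<in> cont_linear_maps G"
    and ev: "\<And>u B N. u \<in> U \<Longrightarrow> B \<subseteq> G \<Longrightarrow> tvs_bounded B \<Longrightarrow> open N \<Longrightarrow> 0 \<in> N \<Longrightarrow>
      \<forall>\<^sub>F u' in nhds u. u' \<in> U \<longrightarrow> (\<forall>b\<in>B. D u' b - D u b \<in> N)"
  shows "continuous_map (top_of_set U) (beta_topology G) D"
  unfolding continuous_map_def openin_beta_topology topspace_beta_topology
proof (intro conjI allI impI)
  show "D \<in> topspace (top_of_set U) \<rightarrow> cont_linear_maps G" using lin by auto
  fix S :: "('c \<Rightarrow> 'b) set" assume S: "beta_open G S"
  show "openin (top_of_set U) {x \<in> topspace (top_of_set U). D x \<in> S}"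
    unfolding openin_subopen[of _ "{x \<in> topspace (top_of_set U). D x \<in> S}"]
  proof
    fix u assume "u \<in> {x \<in> topspace (top_of_set U). D x \<in> S}"
    then have u: "u \<in> U" "D u \<in> S" by auto
    obtain B N where BN: "B \<subseteq> G" "tvs_bounded B" "open N" "0 \<in> N"
      and sub: "{A' \<in> cont_linear_maps G. \<forall>b\<in>B. A' b - D u b \<in> N} \<subseteq> S"
      using beta_openE[OF S u(2)] .
    obtain T where T: "open T" "u \<in> T" "\<forall>x\<in>T. x \<in> U \<longrightarrow> (\<forall>b\<in>B. D x b - D u b \<in> N)"
      using ev[OF u(1) BN] unfolding eventually_nhds by blast
    have "U \<inter> T \<subseteq> {x \<in> topspace (top_of_set U). D x \<in> S}"
      using T(3) lin sub by auto
    then show "\<exists>T. openin (top_of_set U) T \<and> u \<in> T \<and> T \<subseteq> {x \<in> topspace (top_of_set U). D x \<in> S}"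
      using T(1,2) u(1) by (intro exI[of _ "U \<inter> T"]) auto
  qed
qed

lemma has_dir_deriv_eq:
  assumes "has_dir_deriv f u v w" shows "dir_deriv f u v = w"
  using assms unfolding has_dir_deriv_def dir_deriv_def by (intro tendsto_Lim) auto

lemma hadamard_C1_dir_deriv:
  assumes "hadamard_C1 V f D" shows "hadamard_C1 V f (dir_deriv f)"
  using assms by (rule hadamard_C1_cong)
    (auto intro: has_dir_deriv_eq[symmetric] hadamard_deriv_imp_dir hadamard_C1D(4)[OF assms])

text \<open>U is open only relative to G, but for a direction in G the points u + t v remain in U
  for small t.\<close>

lemma has_dir_deriv_cong:
  fixes f :: "'a::tvs \<Rightarrow> 'b::tvs"
  assumes f: "has_dir_deriv f u v w" and G: "subspace G" "openin (top_of_set G) U" "u \<in> U" "v \<in> G"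
    and eq: "\<And>x. x \<in> U \<Longrightarrow> f x = g x"
  shows "has_dir_deriv g u v w"
proof -
  obtain T where T: "open T" "U = G \<inter> T" using G(2) unfolding openin_open by blast
  have "((\<lambda>t::real. u + t *\<^sub>R v) \<longlongrightarrow> u + 0 *\<^sub>R v) (at 0)" by (intro tendsto_intros)
  then have "\<forall>\<^sub>F t in at (0::real). u + t *\<^sub>R v \<in> T"
    using T G(3) by (intro topological_tendstoD) auto
  then have "\<forall>\<^sub>F t in at (0::real). (1 / t) *\<^sub>R (f (u + t *\<^sub>R v) - f u) = (1 / t) *\<^sub>R (g (u + t *\<^sub>R v) - g u)"
  proof eventually_elim
    case (elim t)
    then have "u + t *\<^sub>R v \<in> U"
      using T(2) G by (auto intro: subspace_add subspace_scale)
    then show ?case using eq[of "u + t *\<^sub>R v"] eq[OF G(3)] by simp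
  qed
  then show ?thesis using f unfolding has_dir_deriv_def using tendsto_cong by fast
qed

lemma C1_curve_tendsto:
  fixes c :: "real \<Rightarrow> 'a::tvs"
  assumes "C1_curve M m \<eta> c" shows "(c \<longlongrightarrow> m) (at 0)"
proof -
  have c: "has_dir_deriv c 0 1 \<eta>" "c 0 = m" using assms unfolding C1_curve_def by auto
  have "((\<lambda>t. t *\<^sub>R ((1 / t) *\<^sub>R (c (0 + t *\<^sub>R 1) - c 0)) + c 0) \<longlongrightarrow> 0 *\<^sub>R \<eta> + c 0) (at 0)"
    using c(1) unfolding has_dir_deriv_def by (intro tendsto_intros)
  then have "((\<lambda>t. t *\<^sub>R ((1 / t) *\<^sub>R (c (0 + t *\<^sub>R 1) - c 0)) + c 0) \<longlongrightarrow> m) (at 0)"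
    using c(2) by simp
  then show ?thesis
    by (rule filterlim_mono_eventually) (auto simp: eventually_at_filter)
qed

lemma C1F_on_deriv:
  assumes "C1F_on G U f" "u \<in> U" "v \<in> G"
  shows "has_dir_deriv f u v (dir_deriv f u v)"
  using assms has_dir_deriv_eq unfolding C1F_on_def by metis

lemma C1F_onI:
  fixes f :: "'a::tvs \<Rightarrow> 'b::tvs"
  assumes G: "subspace G" "openin (top_of_set G) U" and f: "continuous_on U f"
    and der: "\<And>u v. u \<in> U \<Longrightarrow> v \<in> G \<Longrightarrow> has_dir_deriv f u v (D u v)"
    and lin: "\<And>u. u \<in> U \<Longrightarrow> D u \<in> cont_linear_maps G"
    and ev: "\<And>u B N. u \<in> U \<Longrightarrow> B \<subseteq> G \<Longrightarrow> tvs_bounded B \<Longrightarrow> open N \<Longrightarrow> 0 \<in> N \<Longrightarrow>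
      \<forall>\<^sub>F u' in nhds u. u' \<in> U \<longrightarrow> (\<forall>b\<in>B. D u' b - D u b \<in> N)"
  shows "C1F_on G U f"
proof -
  have eq: "dir_deriv f u v = D u v" if "u \<in> U" "v \<in> G" for u v
    using has_dir_deriv_eq[OF der[OF that]] .
  have "continuous_map (top_of_set U) (beta_topology G) (dir_deriv f)"
  proof (rule beta_continuousI)
    fix u assume u: "u \<in> U"
    have "continuous_on G (dir_deriv f u)"
      using lin[OF u] eq[OF u] unfolding cont_linear_maps_def by (auto intro: continuous_on_eq)
    moreover have "linear_map_on G (dir_deriv f u)"
      using lin[OF u] eq[OF u] subspace_add[OF G(1)] subspace_scale[OF G(1)]
      unfolding cont_linear_maps_def linear_map_on_def by simp
    ultimately show "dir_deriv f u \<in> cont_linear_maps G" unfolding cont_linear_maps_def by blast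
    fix B N assume BN: "B \<subseteq> G" "tvs_bounded B" "open (N :: 'b set)" "0 \<in> N"
    show "\<forall>\<^sub>F u' in nhds u. u' \<in> U \<longrightarrow> (\<forall>b\<in>B. dir_deriv f u' b - dir_deriv f u b \<in> N)"
      using ev[OF u BN]
    proof eventually_elim
      case (elim u')
      show ?case
      proof (intro impI ballI)
        fix b assume "u' \<in> U" "b \<in> B"
        then show "dir_deriv f u' b - dir_deriv f u b \<in> N"
          using elim eq[of u' b] eq[OF u, of b] BN(1) by auto
      qed
    qed
  qed
  then show ?thesis unfolding C1F_on_def using G f der by blast
qed

lemma C1F_on_UNIVI:
  assumes "hadamard_C1 V f D"
  shows "C1F_on UNIV V f"
proof (rule C1F_onI)
  show "D u \<in> cont_linear_maps UNIV" if "u \<in> V" for u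
    using hadamard_C1D(3)[OF assms that] hadamard_C1_continuous_deriv[OF assms that]
    unfolding cont_linear_maps_def linear_map_on_def by (simp add: linear_add linear_cmul)
  show "\<forall>\<^sub>F u' in nhds u. u' \<in> V \<longrightarrow> (\<forall>b\<in>B. D u' b - D u b \<in> N)"
    if "u \<in> V" "B \<subseteq> UNIV" "tvs_bounded B" "open N" "0 \<in> N" for u B N
    using hadamard_C1D(6)[OF assms that(1,3-5)] by eventually_elim simp
qed (use hadamard_C1D(1,2)[OF assms] hadamard_deriv_imp_dir[OF hadamard_C1D(4)[OF assms]] in auto)

lemma C1F_on_cong:
  fixes f :: "'a::tvs \<Rightarrow> 'b::tvs"
  assumes f: "C1F_on G U f" and eq: "\<And>x. x \<in> U \<Longrightarrow> f x = g x"
  shows "C1F_on G U g"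
proof -
  have G: "subspace G" "openin (top_of_set G) U" "continuous_on U f"
    and cD: "continuous_map (top_of_set U) (beta_topology G) (dir_deriv f)"
    using f unfolding C1F_on_def by auto
  show ?thesis
  proof (rule C1F_onI[OF G(1,2)])
    show "continuous_on U g" using G(3) eq by (rule continuous_on_eq)
    show "has_dir_deriv g u v (dir_deriv f u v)" if "u \<in> U" "v \<in> G" for u v
      using has_dir_deriv_cong[OF C1F_on_deriv[OF f that] G(1,2) that eq] .
    show "dir_deriv f u \<in> cont_linear_maps G" if "u \<in> U" for u
      using cD that unfolding continuous_map_def topspace_beta_topology by auto
  qed (rule beta_continuousD[OF cD])
qed

text \<open>
  The inner map will be a local parametrization, which need not be differentiable in the sense of
  Hadamard.
\<close>

lemma C1F_on_compose:
  fixes k :: "'a::tvs \<Rightarrow> 'b::tvs" and g :: "'b \<Rightarrow> 'c::tvs"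
  assumes k: "C1F_on UNIV W k" and g: "hadamard_C1 V g D" and G: "subspace G"
    and sub: "k ` (W \<inter> G) \<subseteq> V"
  shows "C1F_on G (W \<inter> G) (g \<circ> k)"
proof -
  have W: "open W" and ck: "continuous_on W k"
    and cD: "continuous_map (top_of_set W) (beta_topology UNIV) (dir_deriv k)"
    using k unfolding C1F_on_def by auto
  have kV: "k u \<in> V" if "u \<in> W \<inter> G" for u using sub that by blast
  have Dk: "dir_deriv k u \<in> cont_linear_maps UNIV" if "u \<in> W" for u
    using cD that unfolding continuous_map_def topspace_beta_topology by auto
  have Dk_lin: "linear (dir_deriv k u)" and Dk_cont: "continuous_on UNIV (dir_deriv k u)" if "u \<in> W" for u
    using Dk[OF that] unfolding cont_linear_maps_def linear_map_on_def by (auto intro: linearI)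
  show ?thesis
  proof (rule C1F_onI[OF G, where D = "\<lambda>u v. D (k u) (dir_deriv k u v)"])
    show "openin (top_of_set G) (W \<inter> G)" using W by (metis inf_commute openin_open_Int)
    show "continuous_on (W \<inter> G) (g \<circ> k)"
      using continuous_on_subset[OF ck, of "W \<inter> G"] continuous_on_subset[OF hadamard_C1D(2)[OF g] sub]
      by (intro continuous_on_compose) auto
    show "has_dir_deriv (g \<circ> k) u v (D (k u) (dir_deriv k u v))" if "u \<in> W \<inter> G" "v \<in> G" for u v
      using has_dir_deriv_compose[OF hadamard_C1D(4)[OF g kV[OF that(1)]] C1F_on_deriv[OF k]] that by blast
    show "(\<lambda>v. D (k u) (dir_deriv k u v)) \<in> cont_linear_maps G" if u: "u \<in> W \<inter> G" for u
    proof -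
      have "linear (D (k u))" "linear (dir_deriv k u)"
        using hadamard_C1D(3)[OF g kV[OF u]] Dk_lin u by auto
      moreover have "continuous_on UNIV (\<lambda>v. D (k u) (dir_deriv k u v))"
        using continuous_on_compose2[OF hadamard_C1_continuous_deriv[OF g kV[OF u]] Dk_cont] u by auto
      ultimately show ?thesis unfolding cont_linear_maps_def linear_map_on_def
        by (auto simp: linear_add linear_cmul intro: continuous_on_subset)
    qed
    fix u B and N :: "'c set"
    assume u: "u \<in> W \<inter> G" and B: "B \<subseteq> G" "tvs_bounded B" and N: "open N" "0 \<in> N"
    then have uW: "u \<in> W" by blast
    obtain N' where N': "open N'" "0 \<in> N'" "\<And>x y. x \<in> N' \<Longrightarrow> y \<in> N' \<Longrightarrow> x + y \<in> N"
      using eventually_nhds_0_half[OF N] by metis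
    obtain P Q where PQ: "open P" "k u \<in> P" "open Q" "0 \<in> Q"
      "\<And>x v. x \<in> P \<Longrightarrow> v \<in> Q \<Longrightarrow> D x v \<in> N'"
      using eventually_deriv_small[OF g kV[OF u] N'(1,2)] by metis
    have lim: "filterlim k (nhds (k u)) (nhds u)"
      using continuous_on_open_nhds[OF ck W uW] .
    have "tvs_bounded (dir_deriv k u ` B)"
      using tvs_bounded_linear_image[OF B(2) Dk_lin[OF uW] Dk_cont[OF uW]] .
    from filterlim_iff[THEN iffD1, OF lim, rule_format, OF hadamard_C1D(6)[OF g kV[OF u] this N'(1,2)]]
    have "\<forall>\<^sub>F u' in nhds u. \<forall>b\<in>B. D (k u') (dir_deriv k u b) - D (k u) (dir_deriv k u b) \<in> N'" by simp
    moreover have "\<forall>\<^sub>F u' in nhds u. u' \<in> W \<longrightarrow> (\<forall>b\<in>B. dir_deriv k u' b - dir_deriv k u b \<in> Q)"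
      by (rule beta_continuousD[OF cD uW subset_UNIV B(2) PQ(3,4)])
    moreover have "\<forall>\<^sub>F u' in nhds u. k u' \<in> P"
      using topological_tendstoD[OF lim PQ(1,2)] .
    ultimately show "\<forall>\<^sub>F u' in nhds u. u' \<in> W \<inter> G \<longrightarrow>
        (\<forall>b\<in>B. D (k u') (dir_deriv k u' b) - D (k u) (dir_deriv k u b) \<in> N)"
    proof eventually_elim
      case (elim u')
      show ?case
      proof (intro impI ballI)
        fix b assume u': "u' \<in> W \<inter> G" and b: "b \<in> B"
        have "D (k u') (dir_deriv k u' b - dir_deriv k u b) +
            (D (k u') (dir_deriv k u b) - D (k u) (dir_deriv k u b)) \<in> N"
          using b u' elim by (intro N'(3) PQ(5)) auto
        then show "D (k u') (dir_deriv k u' b) - D (k u) (dir_deriv k u b) \<in> N"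
          using linear_diff[OF hadamard_C1D(3)[OF g kV[OF u']]] by simp
      qed
    qed
  qed
qed

section \<open>Consequences of property (e)\<close>

lemma c_seminorm_c1_to_c: "c_seminorm j (c1_to_c \<eta>) \<le> c1_seminorm j \<eta>"
  unfolding c_seminorm_def c1_seminorm_def c1_to_c.rep_eq
  using max_norm_nonneg[OF continuous_half_deriv, of j \<eta>] by simp

lemma c1_seminorm_mono: "i \<le> j \<Longrightarrow> c1_seminorm i x \<le> c1_seminorm j x"
  unfolding c1_seminorm_def by (intro add_mono max_norm_mono continuous_c1_fun continuous_half_deriv)

lemma c_seminorm_mono: "i \<le> j \<Longrightarrow> c_seminorm i x \<le> c_seminorm j x"
  unfolding c_seminorm_def by (intro max_norm_mono continuous_c_fun)

lemma c1_to_c_diff: "c1_to_c (x - y) = c1_to_c x - c1_to_c y"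
  by transfer simp

lemma tendsto_c1_to_c: "(c1_to_c \<longlongrightarrow> c1_to_c \<eta>) (nhds \<eta>)"
  unfolding c_space.tendsto_seminorm
proof
  fix j
  have "((\<lambda>x. c1_seminorm j (x - \<eta>)) \<longlongrightarrow> 0) (nhds \<eta>)"
    using c1_space.tendsto_seminorm[THEN iffD1, OF filterlim_ident] by blast
  then show "((\<lambda>x. c_seminorm j (c1_to_c x - c1_to_c \<eta>)) \<longlongrightarrow> 0) (nhds \<eta>)"
    by (rule Lim_null_comparison[rotated], intro always_eventually allI)
      (simp add: c_space.p_nonneg c1_to_c_diff[symmetric] c_seminorm_c1_to_c)
qed

lemma c1_space_open_ball:
  assumes "open U" "\<phi> \<in> U"
  obtains j e where "e > 0" "{\<psi>. c1_seminorm j (\<psi> - \<phi>) < e} \<subseteq> U"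
  using assms unfolding c1_space.open_iff seminorm_open_def by blast

lemma c1_space_ball_mono:
  assumes "{\<psi>. c1_seminorm i (\<psi> - \<phi>) < e} \<subseteq> U" "i \<le> j"
  shows "{\<psi>. c1_seminorm j (\<psi> - \<phi>) < e} \<subseteq> U"
  using assms c1_seminorm_mono[OF assms(2)] by (force intro: le_less_trans)

text \<open>Joint continuity of Df is obtained from that of the extension in property (e) and the
  continuous inclusion of C^1 in C; it turns directional derivatives into Hadamard
  derivatives.\<close>

lemma hadamard_C1_of_property_e:
  fixes f :: "'n::finite c1_space \<Rightarrow> real ^ 'n"
  assumes U: "open U" and f: "C1F_on UNIV U f" and e: "property_e f U"
  shows "hadamard_C1 U f (dir_deriv f)"
proof (rule hadamard_C1_of_dir_deriv[OF U])
  have cD: "continuous_map (top_of_set U) (beta_topology UNIV) (dir_deriv f)"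
    using f unfolding C1F_on_def by blast
  show "continuous_on U f" using f unfolding C1F_on_def by blast
  show "linear (dir_deriv f u)" if "u \<in> U" for u
  proof -
    have "dir_deriv f u \<in> cont_linear_maps UNIV"
      using cD that unfolding continuous_map_def topspace_beta_topology by auto
    then show ?thesis unfolding cont_linear_maps_def linear_map_on_def by (auto intro!: linearI)
  qed
  show "has_dir_deriv f u v (dir_deriv f u v)" if "u \<in> U" for u v
    using C1F_on_deriv[OF f that] by simp
  show "\<forall>\<^sub>F u' in nhds u. \<forall>b\<in>B. dir_deriv f u' b - dir_deriv f u b \<in> N"
    if "u \<in> U" "tvs_bounded B" "open N" "0 \<in> N" for u B N
    using beta_continuousD[OF cD that(1) subset_UNIV that(2-4)] eventually_nhds_in_open[OF U that(1)]
    by eventually_elim simp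
  obtain De where De: "\<And>\<phi> \<eta>. \<phi> \<in> U \<Longrightarrow> De \<phi> (c1_to_c \<eta>) = dir_deriv f \<phi> \<eta>"
    and cDe: "continuous_on (U \<times> UNIV) (\<lambda>(\<phi>, \<eta>). De \<phi> \<eta>)"
    using e unfolding property_e_def by blast
  have "continuous_on UNIV c1_to_c"
    using tendsto_c1_to_c by (rule continuous_on_nhdsI)
  then have "continuous_on (U \<times> UNIV) (\<lambda>p. c1_to_c (snd p))"
    by (rule continuous_on_compose2) (auto intro: continuous_intros)
  then have "continuous_on (U \<times> UNIV) (\<lambda>p. (fst p, c1_to_c (snd p)))"
    by (intro continuous_on_Pair continuous_intros)
  from continuous_on_compose2[OF cDe this] have "continuous_on (U \<times> UNIV) (\<lambda>p. De (fst p) (c1_to_c (snd p)))"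
    by (simp add: image_subset_iff mem_Times_iff)
  then show "continuous_on (U \<times> UNIV) (\<lambda>p. dir_deriv f (fst p) (snd p))"
    by (rule continuous_on_eq) (auto simp: De)
qed

text \<open>Joint continuity of the extended derivative at (\<phi>, 0) bounds it by 1 for base
  points near \<phi> and arguments in a \<delta>-ball of C. Homogeneity gives the constant 1 /
  \<delta>, and the mean value inequality on the convex ball around \<phi> carries the estimate over
  to f.\<close>

lemma property_e_lipschitz:
  fixes f :: "'n::finite c1_space \<Rightarrow> real ^ 'n"
  assumes U: "open U" and f: "C1F_on UNIV U f" and e: "property_e f U" and \<phi>: "\<phi> \<in> U"
  obtains j \<epsilon> \<Lambda> where "\<epsilon> > 0" "\<Lambda> > 0" "{\<psi>. c1_seminorm j (\<psi> - \<phi>) < \<epsilon>} \<subseteq> U"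
    "\<And>\<psi> \<eta>. c1_seminorm j (\<psi> - \<phi>) < \<epsilon> \<Longrightarrow> norm (dir_deriv f \<psi> \<eta>) \<le> \<Lambda> * c_seminorm j (c1_to_c \<eta>)"
    "\<And>\<psi> \<psi>'. c1_seminorm j (\<psi> - \<phi>) < \<epsilon> \<Longrightarrow> c1_seminorm j (\<psi>' - \<phi>) < \<epsilon> \<Longrightarrow>
      norm (f \<psi> - f \<psi>') \<le> \<Lambda> * c_seminorm j (c1_to_c (\<psi> - \<psi>'))"
proof -
  obtain De where lin: "\<And>\<phi>. \<phi> \<in> U \<Longrightarrow> linear (De \<phi>)"
    and De: "\<And>\<phi> \<eta>. \<phi> \<in> U \<Longrightarrow> De \<phi> (c1_to_c \<eta>) = dir_deriv f \<phi> \<eta>"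
    and cDe: "continuous_on (U \<times> UNIV) (\<lambda>(\<phi>, \<eta>). De \<phi> \<eta>)"
    using e unfolding property_e_def by blast
  have "filterlim (\<lambda>(\<phi>, \<eta>). De \<phi> \<eta>) (nhds (De \<phi> 0)) (nhds \<phi> \<times>\<^sub>F nhds 0)"
    using continuous_on_open_nhds[OF cDe open_Times[OF U open_UNIV], of "(\<phi>, 0)"] \<phi>
    by (simp add: nhds_prod)
  then have "\<forall>\<^sub>F p in nhds \<phi> \<times>\<^sub>F nhds 0. dist (De (fst p) (snd p)) 0 < 1"
    using linear_0[OF lin[OF \<phi>]] by (simp add: case_prod_beta' tendsto_iff)
  then obtain P Q where "eventually P (nhds \<phi>)" "eventually Q (nhds 0)"
    and PQ: "\<And>x y. P x \<Longrightarrow> Q y \<Longrightarrow> norm (De x y) < 1"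
    unfolding eventually_prod_filter by auto
  then obtain A B where A: "open A" "\<phi> \<in> A" "\<And>x. x \<in> A \<Longrightarrow> P x" and B: "open B" "0 \<in> B" "\<And>y. y \<in> B \<Longrightarrow> Q y"
    unfolding eventually_nhds by blast
  obtain i \<epsilon> where i: "\<epsilon> > 0" "{\<psi>. c1_seminorm i (\<psi> - \<phi>) < \<epsilon>} \<subseteq> A \<inter> U"
    using c1_space_open_ball[OF open_Int[OF A(1) U] IntI[OF A(2) \<phi>]] .
  obtain k \<delta> where k: "\<delta> > 0" "{y. c_seminorm k (y - 0) < \<delta>} \<subseteq> B"
    using B(1,2) unfolding c_space.open_iff seminorm_open_def by blast
  define j where "j = max i k"
  have ball: "{\<psi>. c1_seminorm j (\<psi> - \<phi>) < \<epsilon>} \<subseteq> A \<inter> U"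
    using c1_space_ball_mono[OF i(2)] unfolding j_def by simp
  have le: "norm (dir_deriv f \<psi> \<eta>) \<le> 1 / \<delta> * c_seminorm j (c1_to_c \<eta>)"
    if \<psi>: "c1_seminorm j (\<psi> - \<phi>) < \<epsilon>" for \<psi> \<eta>
  proof -
    have \<psi>': "\<psi> \<in> A" "\<psi> \<in> U" using ball \<psi> by auto
    let ?a = "c_seminorm k (c1_to_c \<eta>)"
    have a: "0 \<le> ?a" by (rule c_space.p_nonneg)
    \<comment> \<open>The seminorm of \<eta> may vanish, so \<eta> is scaled by \<delta> / (?a + e)
      with e > 0 before e tends to 0.\<close>
    have "norm (De \<psi> (c1_to_c \<eta>)) * \<delta> \<le> ?a"
    proof (rule field_le_epsilon)
      fix e :: real assume e: "0 < e"
      have "c_seminorm k ((\<delta> / (?a + e)) *\<^sub>R c1_to_c \<eta>) < \<delta>"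
        unfolding c_space.p_scale using a e k(1) by (simp add: field_simps)
      then have "norm (De \<psi> ((\<delta> / (?a + e)) *\<^sub>R c1_to_c \<eta>)) < 1"
        using k(2) by (intro PQ A(3) B(3) \<psi>') auto
      then have "\<delta> / (?a + e) * norm (De \<psi> (c1_to_c \<eta>)) < 1"
        unfolding linear_cmul[OF lin[OF \<psi>'(2)]] using a e k(1) by simp
      then show "norm (De \<psi> (c1_to_c \<eta>)) * \<delta> \<le> ?a + e" using a e by (simp add: field_simps)
    qed
    also have "?a \<le> c_seminorm j (c1_to_c \<eta>)" unfolding j_def by (intro c_seminorm_mono) simp
    finally show ?thesis using De[OF \<psi>'(2)] k(1) by (simp add: field_simps)
  qed
  have "norm (f \<psi> - f \<psi>') \<le> 1 / \<delta> * c_seminorm j (c1_to_c (\<psi> - \<psi>'))"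
    if \<psi>: "c1_seminorm j (\<psi> - \<phi>) < \<epsilon>" "c1_seminorm j (\<psi>' - \<phi>) < \<epsilon>" for \<psi> \<psi>'
  proof -
    have conv: "c1_seminorm j (\<psi>' + \<theta> *\<^sub>R (\<psi> - \<psi>') - \<phi>) < \<epsilon>" if \<theta>: "\<theta> \<in> {0..1}" for \<theta>
    proof -
      have eq: "\<psi>' + \<theta> *\<^sub>R (\<psi> - \<psi>') - \<phi> = (1 - \<theta>) *\<^sub>R (\<psi>' - \<phi>) + \<theta> *\<^sub>R (\<psi> - \<phi>)"
        by (simp add: algebra_simps)
      have "c1_seminorm j (\<psi>' + \<theta> *\<^sub>R (\<psi> - \<psi>') - \<phi>) \<le> (1 - \<theta>) * c1_seminorm j (\<psi>' - \<phi>) + \<theta> * c1_seminorm j (\<psi> - \<phi>)"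
        unfolding eq using c1_space.p_add[of j "(1 - \<theta>) *\<^sub>R (\<psi>' - \<phi>)" "\<theta> *\<^sub>R (\<psi> - \<phi>)"] \<theta>
        by (simp add: c1_space.p_scale)
      also have "\<dots> < \<epsilon>"
        using convex_bound_lt[OF \<psi>(2,1), of "1 - \<theta>" \<theta>] \<theta> by simp
      finally show ?thesis .
    qed
    have "norm (f (\<psi>' + (\<psi> - \<psi>')) - f \<psi>' - 0) \<le> 1 / \<delta> * c_seminorm j (c1_to_c (\<psi> - \<psi>'))"
    proof (rule mvt_line)
      fix \<theta> :: real assume \<theta>: "\<theta> \<in> {0..1}"
      show "has_dir_deriv f (\<psi>' + \<theta> *\<^sub>R (\<psi> - \<psi>')) (\<psi> - \<psi>')
          (dir_deriv f (\<psi>' + \<theta> *\<^sub>R (\<psi> - \<psi>')) (\<psi> - \<psi>'))"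
        using ball conv[OF \<theta>] by (intro C1F_on_deriv[OF f]) auto
      show "norm (dir_deriv f (\<psi>' + \<theta> *\<^sub>R (\<psi> - \<psi>')) (\<psi> - \<psi>') - 0) \<le> 1 / \<delta> * c_seminorm j (c1_to_c (\<psi> - \<psi>'))"
        using le[OF conv[OF \<theta>]] by simp
    qed
    then show ?thesis by simp
  qed
  then show thesis using that[of \<epsilon> "1 / \<delta>" j] i(1) k(1) ball le by auto
qed

section \<open>Segments of differentiable maps\<close>

lemma c1_fun_segment: "segment x t \<in> c1_maps \<Longrightarrow> c1_fun (c1_segment x t) = segment x t"
  unfolding c1_segment_def by (rule Abs_c1_space_inverse)

lemma c1_segment_eqI: "segment x t = c1_fun \<phi> \<Longrightarrow> c1_segment x t = \<phi>"
  unfolding c1_segment_def by (simp add: c1_fun_inverse)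

lemma c1_space_eqI:
  assumes "\<And>s. s \<le> 0 \<Longrightarrow> c1_fun \<phi> s = c1_fun \<psi> s"
  shows "\<phi> = \<psi>"
proof -
  have "c1_fun \<phi> s = c1_fun \<psi> s" for s
    using assms[of s] c1_mapsD(3)[OF c1_fun, of s \<phi>] c1_mapsD(3)[OF c1_fun, of s \<psi>]
    by (cases "s \<le> 0") auto
  then show ?thesis by (simp add: c1_fun_inject[symmetric] fun_eq_iff)
qed

lemma half_deriv_minus:
  assumes "s \<le> 0"
  shows "half_deriv (c1_fun (\<phi> - \<psi>)) s = half_deriv (c1_fun \<phi>) s - half_deriv (c1_fun \<psi>) s"
  unfolding minus_c1_space.rep_eq
  using assms by (intro half_derivI has_vector_derivative_diff c1_mapsD(2) c1_fun)

lemma c1_seminorm_leI: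
  assumes "\<And>s. s \<in> {- real j..0} \<Longrightarrow> norm (c1_fun \<phi> s) \<le> a"
    and "\<And>s. s \<in> {- real j..0} \<Longrightarrow> norm (half_deriv (c1_fun \<phi>) s) \<le> b"
  shows "c1_seminorm j \<phi> \<le> a + b"
  unfolding c1_seminorm_def using assms by (intro add_mono max_norm_le)

lemma segment_c1:
  assumes "\<And>s. s \<le> t \<Longrightarrow> (x has_vector_derivative x' s) (at s within {..t})"
    and "continuous_on {..t} x'"
  shows "segment x t \<in> c1_maps"
    and "s \<le> 0 \<Longrightarrow> half_deriv (segment x t) s = x' (t + s)"
proof -
  have der: "(segment x t has_vector_derivative x' (t + s)) (at s within {..0})" if s: "s \<le> 0" for s
  proof -
    have "((x \<circ> (\<lambda>s. t + s)) has_vector_derivative 1 *\<^sub>R x' (t + s)) (at s within {..0})"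
    proof (rule vector_diff_chain_within)
      show "((\<lambda>s. t + s) has_vector_derivative 1) (at s within {..0})"
        by (auto intro!: derivative_eq_intros)
      show "(x has_vector_derivative x' (t + s)) (at (t + s) within (\<lambda>s. t + s) ` {..0})"
        using assms(1)[of "t + s"] s by (rule_tac has_vector_derivative_within_subset) auto
    qed
    then have "((\<lambda>s. x (t + s)) has_vector_derivative x' (t + s)) (at s within {..0})"
      by (simp add: o_def)
    then show ?thesis
      by (rule has_vector_derivative_transform[rotated 2]) (use s in \<open>auto simp: segment_def\<close>)
  qed
  show "segment x t \<in> c1_maps"
  proof (rule c1_mapsI)
    show "continuous_on {..0} (\<lambda>s. x' (t + s))"
      by (rule continuous_on_compose2[OF assms(2)]) (auto intro!: continuous_intros)
  qed (use der in \<open>auto simp: segment_def\<close>)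
  show "half_deriv (segment x t) s = x' (t + s)" if "s \<le> 0"
    using half_derivI[OF der[OF that] that] .
qed

lemma segment_c1_UNIV:
  assumes "\<And>s. (x has_vector_derivative x' s) (at s)" and "continuous_on UNIV x'"
  shows "segment x t \<in> c1_maps"
    and "s \<le> 0 \<Longrightarrow> half_deriv (segment x t) s = x' (t + s)"
  using segment_c1[OF has_vector_derivative_at_within[OF assms(1)] continuous_on_subset[OF assms(2) subset_UNIV]]
  by auto

text \<open>A seminorm sees only a compact window, on which x and its derivative are uniformly
  continuous.\<close>

lemma c1_segment_continuous:
  fixes x :: "real \<Rightarrow> real ^ 'n::finite"
  assumes der: "\<And>s. (x has_vector_derivative x' s) (at s)" and cont: "continuous_on UNIV x'"
  shows "(c1_segment x \<longlongrightarrow> c1_segment x t) (nhds t)"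
  unfolding c1_space.tendsto_seminorm
proof (intro allI tendstoI)
  fix j and e :: real assume e: "0 < e"
  have seg: "segment x t \<in> c1_maps" "s \<le> 0 \<Longrightarrow> half_deriv (segment x t) s = x' (t + s)" for t s
    using segment_c1_UNIV[OF assms] by auto
  have unif: "\<forall>\<^sub>F r in nhds t. \<forall>s\<in>{- real j..0}. norm (y (r + s) - y (t + s)) < e / 3"
    if y: "continuous_on UNIV y" for y :: "real \<Rightarrow> real ^ 'n"
  proof (rule eventually_tube[OF compact_Icc])
    fix s :: real
    have "continuous_on UNIV (\<lambda>p. y (snd p + fst p) - y (t + fst p))"
      by (intro continuous_intros continuous_on_compose2[OF y]) auto
    from continuous_on_open_nhds[OF this, of "(s, t)"]
    have "((\<lambda>p. y (snd p + fst p) - y (t + fst p)) \<longlongrightarrow> 0) (nhds s \<times>\<^sub>F nhds t)"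
      by (simp add: nhds_prod)
    from tendstoD[OF this, of "e / 3"] e
    show "\<forall>\<^sub>F p in nhds s \<times>\<^sub>F nhds t. fst p \<in> {- real j..0} \<longrightarrow>
        norm (y (snd p + fst p) - y (t + fst p)) < e / 3"
      by (auto elim: eventually_mono)
  qed
  have "continuous_on UNIV x"
    by (intro continuous_at_imp_continuous_on ballI has_vector_derivative_continuous[OF der])
  from unif[OF this] unif[OF cont]
  show "\<forall>\<^sub>F r in nhds t. dist (c1_seminorm j (c1_segment x r - c1_segment x t)) 0 < e"
  proof eventually_elim
    case (elim r)
    have "c1_seminorm j (c1_segment x r - c1_segment x t) \<le> e / 3 + e / 3"
    proof (rule c1_seminorm_leI)
      fix s assume s: "s \<in> {- real j..0}"
      show "norm (c1_fun (c1_segment x r - c1_segment x t) s) \<le> e / 3"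
        using elim(1) s by (simp add: minus_c1_space.rep_eq c1_fun_segment[OF seg(1)] segment_def less_imp_le)
      show "norm (half_deriv (c1_fun (c1_segment x r - c1_segment x t)) s) \<le> e / 3"
        using elim(2) s by (simp add: half_deriv_minus c1_fun_segment[OF seg(1)] seg(2) less_imp_le)
    qed
    then show ?case using e c1_space.p_nonneg[of j "c1_segment x r - c1_segment x t"] by (simp add: dist_norm)
  qed
qed

text \<open>The pieces meet only at a, where their values and their one-sided slopes agree; so the
  one-sided derivatives combine to a derivative within I.\<close>

lemma has_vector_derivative_glue:
  fixes f g :: "real \<Rightarrow> 'a::real_normed_vector"
  assumes f: "\<And>t. t \<le> a \<Longrightarrow> (f has_vector_derivative f' t) (at t within {..a})"
    and g: "\<And>t. a \<le> t \<Longrightarrow> t \<in> I \<Longrightarrow> (g has_vector_derivative g' t) (at t within {a..} \<inter> I)"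
    and eq: "f a = g a" "f' a = g' a" and t: "t \<in> I" and I: "{..a} \<subseteq> I"
  shows "((\<lambda>t. if t \<le> a then f t else g t) has_vector_derivative (if t \<le> a then f' t else g' t)) (at t within I)"
proof -
  have cl: "closure {..a} \<inter> closure ({a<..} \<inter> I) \<subseteq> {a}"
    using closure_mono[of "{a<..} \<inter> I" "{a<..}"] by auto
  have "((\<lambda>t. if t \<in> {..a} then f t else g t) has_vector_derivative
      (if t \<in> {..a} then f' t else g' t)) (at t within I)"
  proof (rule has_vector_derivative_If_within_closures[where T = "{a<..} \<inter> I"])
    show "t \<in> {..a} \<union> {a<..} \<inter> I" using t I by auto
    show "I = {..a} \<union> {a<..} \<inter> I" using I by auto
    show "(f has_vector_derivative f' t) (at t within {..a} \<union> closure {..a} \<inter> closure ({a<..} \<inter> I))"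
      if "t \<in> {..a} \<union> closure {..a} \<inter> closure ({a<..} \<inter> I)"
    proof -
      have "{..a} \<union> closure {..a} \<inter> closure ({a<..} \<inter> I) = {..a}" using cl by auto
      then show ?thesis using f that by auto
    qed
    show "(g has_vector_derivative g' t) (at t within {a<..} \<inter> I \<union> closure {..a} \<inter> closure ({a<..} \<inter> I))"
      if "t \<in> {a<..} \<inter> I \<union> closure {..a} \<inter> closure ({a<..} \<inter> I)"
    proof -
      have sub: "{a<..} \<inter> I \<union> closure {..a} \<inter> closure ({a<..} \<inter> I) \<subseteq> {a..} \<inter> I" using cl I by auto
      show ?thesis
        by (rule has_vector_derivative_within_subset[OF g sub]) (use sub that in auto)
    qed
  qed (use cl eq in auto)
  then show ?thesis by simp
qed

section \<open>Prolongation of initial data by prescribed derivatives\<close>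

text \<open>
  The derivative of the prolongation on \<open>[0,\<infinity>)\<close> is \<open>z\<close> up to an additive constant chosen
  such that the prolongation is continuously differentiable at \<open>0\<close>.
\<close>

definition prolong :: "'n::finite c1_space \<Rightarrow> (real \<Rightarrow>\<^sub>C (real ^ 'n)) \<Rightarrow> real \<Rightarrow> real ^ 'n"
  where "prolong \<phi> z t = (if t \<le> 0 then c1_fun \<phi> t
    else c1_fun \<phi> 0 + t *\<^sub>R half_deriv (c1_fun \<phi>) 0 + integral {0..t} (\<lambda>s. z s - z 0))"

definition prolong_deriv :: "'n::finite c1_space \<Rightarrow> (real \<Rightarrow>\<^sub>C (real ^ 'n)) \<Rightarrow> real \<Rightarrow> real ^ 'n"
  where "prolong_deriv \<phi> z t = (if t \<le> 0 then half_deriv (c1_fun \<phi>) t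
    else half_deriv (c1_fun \<phi>) 0 + (z t - z 0))"

definition prolong_segment :: "real \<Rightarrow> 'n::finite c1_space \<times> (real \<Rightarrow>\<^sub>C (real ^ 'n)) \<Rightarrow> 'n c1_space"
  where "prolong_segment t p = c1_segment (prolong (fst p) (snd p)) t"

lemma has_vector_derivative_prolong:
  "(prolong \<phi> z has_vector_derivative prolong_deriv \<phi> z t) (at t)"
proof -
  let ?g = "\<lambda>t. c1_fun \<phi> 0 + t *\<^sub>R half_deriv (c1_fun \<phi>) 0 + integral {0..t} (\<lambda>s. z s - z 0)"
  have "((\<lambda>t. if t \<le> 0 then c1_fun \<phi> t else ?g t) has_vector_derivative
      (if t \<le> 0 then half_deriv (c1_fun \<phi>) t else half_deriv (c1_fun \<phi>) 0 + (z t - z 0))) (at t within UNIV)"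
  proof (rule has_vector_derivative_glue)
    show "(c1_fun \<phi> has_vector_derivative half_deriv (c1_fun \<phi>) t) (at t within {..0})" if "t \<le> 0" for t
      using c1_mapsD(2)[OF c1_fun that] .
    fix t :: real assume t: "0 \<le> t"
    have "((\<lambda>t. integral {0..t} (\<lambda>s. z s - z 0)) has_vector_derivative (z t - z 0)) (at t within {0..t + 1})"
      using t by (intro integral_has_vector_derivative continuous_intros) auto
    moreover have "at t within {0..t + 1} = at t within {0..}"
      by (rule at_within_nhd[of t "{..<t + 1}"]) auto
    ultimately show "(?g has_vector_derivative half_deriv (c1_fun \<phi>) 0 + (z t - z 0)) (at t within {0..} \<inter> UNIV)"
      by (auto intro!: derivative_eq_intros)
  qed auto
  then show ?thesis by (simp add: prolong_def[abs_def] prolong_deriv_def)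
qed

lemma continuous_prolong_deriv: "continuous_on UNIV (prolong_deriv \<phi> z)"
proof -
  have "continuous_on ({..0} \<union> {0..}) (\<lambda>t. if t \<le> 0 then half_deriv (c1_fun \<phi>) t
      else half_deriv (c1_fun \<phi>) 0 + (z t - z 0))"
    by (intro continuous_on_If continuous_half_deriv continuous_intros) auto
  moreover have "{..0} \<union> {0..} = (UNIV :: real set)" by auto
  ultimately show ?thesis by (simp add: prolong_deriv_def[abs_def])
qed

lemmas segment_prolong = segment_c1_UNIV[OF has_vector_derivative_prolong continuous_prolong_deriv]

lemma c1_fun_prolong_segment:
  "c1_fun (prolong_segment t p) = segment (prolong (fst p) (snd p)) t"
  unfolding prolong_segment_def by (rule c1_fun_segment[OF segment_prolong(1)])

lemma half_deriv_prolong_segment: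
  "s \<le> 0 \<Longrightarrow> half_deriv (c1_fun (prolong_segment t p)) s = prolong_deriv (fst p) (snd p) (t + s)"
  unfolding c1_fun_prolong_segment by (rule segment_prolong(2))

lemma prolong_segment_0: "prolong_segment 0 p = fst p"
  by (rule c1_space_eqI) (simp add: c1_fun_prolong_segment segment_def prolong_def)

text \<open>Linearity on the whole product is possible because subtracting \<open>z 0\<close> in
  \<open>prolong\<close> leaves z free of any matching condition with \<phi>.\<close>

lemma linear_prolong_segment: "linear (prolong_segment t)"
proof (rule linearI)
  have int: "(\<lambda>s. apply_bcontfun z s - z 0) integrable_on {0..t}" for t and z :: "real \<Rightarrow>\<^sub>C (real ^ 'n)"
    by (intro integrable_continuous_interval continuous_intros) auto
  fix p q :: "'n c1_space \<times> (real \<Rightarrow>\<^sub>C (real ^ 'n))"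
  have "prolong (fst (p + q)) (snd (p + q)) t = prolong (fst p) (snd p) t + prolong (fst q) (snd q) t" for t
    using integral_add[OF int[of "snd p" t] int[of "snd q" t]]
    by (simp add: prolong_def plus_c1_space.rep_eq half_deriv_add[OF c1_fun c1_fun] algebra_simps)
  then show "prolong_segment t (p + q) = prolong_segment t p + prolong_segment t q"
    by (intro c1_space_eqI) (simp add: c1_fun_prolong_segment plus_c1_space.rep_eq segment_def)
  fix r :: real
  have "prolong (fst (r *\<^sub>R p)) (snd (r *\<^sub>R p)) t = r *\<^sub>R prolong (fst p) (snd p) t" for t
    using integral_cmul[of "{0..t}" r "\<lambda>s. snd p s - snd p 0"]
    by (simp add: prolong_def scaleR_c1_space.rep_eq half_deriv_scale[OF c1_fun] algebra_simps
        flip: scaleR_diff_right)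
  then show "prolong_segment t (r *\<^sub>R p) = r *\<^sub>R prolong_segment t p"
    by (intro c1_space_eqI) (simp add: c1_fun_prolong_segment scaleR_c1_space.rep_eq segment_def)
qed

lemma bcontfun_diff_le: "norm (apply_bcontfun z s - z r) \<le> 2 * norm z"
  using norm_triangle_ineq4[of "z s" "z r"] norm_bounded[of z s] norm_bounded[of z r] by linarith

text \<open>The factor 2 is caused by the constant \<open>z 0\<close> in the integrand.\<close>

lemma norm_integral_prolong:
  assumes "0 \<le> s" "s \<le> h"
  shows "norm (integral {0..s} (\<lambda>s. apply_bcontfun z s - z 0)) \<le> 2 * h * norm (z :: real \<Rightarrow>\<^sub>C (real ^ 'n))"
proof -
  have "norm (integral {0..s} (\<lambda>s. apply_bcontfun z s - z 0)) \<le> 2 * norm z * (s - 0)"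
    using assms by (intro integral_bound bcontfun_diff_le continuous_intros) auto
  also have "\<dots> \<le> 2 * norm z * h" using assms by (intro mult_left_mono) auto
  finally show ?thesis by (simp add: mult_ac)
qed

text \<open>For t \<ge> 0 the window [t - j, t] meets the negative half-line only inside [-j, 0], so
  the same index j serves on both sides. The bound is uniform in t, which joint continuity in time
  and data requires.\<close>

lemma c1_seminorm_prolong_segment:
  assumes t: "0 \<le> t" "t \<le> h"
  shows "c1_seminorm j (prolong_segment t p) \<le> (2 + h) * c1_seminorm j (fst p) + (2 + 2 * h) * norm (snd p)"
proof -
  obtain \<phi> z where p: "p = (\<phi>, z)" by (cases p)
  let ?A = "max_norm j (c1_fun \<phi>)" and ?B = "max_norm j (half_deriv (c1_fun \<phi>))"
  have A: "norm (c1_fun \<phi> s) \<le> ?A" and B: "norm (half_deriv (c1_fun \<phi>) s) \<le> ?B" if "s \<in> {- real j..0}" for s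
    using norm_le_max_norm[OF continuous_c1_fun that] norm_le_max_norm[OF continuous_half_deriv that] .
  have nn: "0 \<le> ?A" "0 \<le> ?B" by (intro max_norm_nonneg continuous_c1_fun continuous_half_deriv)+
  have "c1_seminorm j (prolong_segment t p) \<le> (?A + h * ?B + 2 * h * norm z) + (?B + 2 * norm z)"
  proof (rule c1_seminorm_leI)
    fix s assume s: "s \<in> {- real j..0}"
    show "norm (c1_fun (prolong_segment t p) s) \<le> ?A + h * ?B + 2 * h * norm z"
    proof (cases "t + s \<le> 0")
      case True
      then have "norm (c1_fun \<phi> (t + s)) \<le> ?A" using s t by (intro A) auto
      moreover have "0 \<le> h * ?B" "0 \<le> 2 * h * norm z" using t nn by auto
      ultimately show ?thesis using True s
        by (simp add: c1_fun_prolong_segment segment_def prolong_def p)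
    next
      case False
      let ?I = "integral {0..t + s} (\<lambda>s. z s - z 0)"
      have "norm (c1_fun \<phi> 0 + (t + s) *\<^sub>R half_deriv (c1_fun \<phi>) 0 + ?I) \<le>
          norm (c1_fun \<phi> 0) + norm ((t + s) *\<^sub>R half_deriv (c1_fun \<phi>) 0) + norm ?I"
        by (intro order_trans[OF norm_triangle_ineq] add_mono norm_triangle_ineq order.refl)
      moreover have "norm (c1_fun \<phi> 0) \<le> ?A" by (intro A) simp
      moreover have "norm ?I \<le> 2 * h * norm z" using False s t by (intro norm_integral_prolong) auto
      moreover have "norm ((t + s) *\<^sub>R half_deriv (c1_fun \<phi>) 0) \<le> h * ?B"
        unfolding norm_scaleR using False s t B[of 0] by (intro mult_mono) auto
      ultimately show ?thesis using False s
        by (simp add: c1_fun_prolong_segment segment_def prolong_def p)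
    qed
    show "norm (half_deriv (c1_fun (prolong_segment t p)) s) \<le> ?B + 2 * norm z"
    proof (cases "t + s \<le> 0")
      case True
      then have "norm (half_deriv (c1_fun \<phi>) (t + s)) \<le> ?B" using s t by (intro B) auto
      then show ?thesis using True s
        by (simp add: half_deriv_prolong_segment prolong_deriv_def p add_increasing2)
    next
      case False
      have "norm (half_deriv (c1_fun \<phi>) 0 + (z (t + s) - z 0)) \<le> ?B + 2 * norm z"
        using B[of 0] by (intro norm_triangle_mono bcontfun_diff_le) auto
      then show ?thesis using False s by (simp add: half_deriv_prolong_segment prolong_deriv_def p)
    qed
  qed
  also have "\<dots> \<le> (2 + h) * c1_seminorm j (fst p) + (2 + 2 * h) * norm (snd p)"
    using t nn mult_nonneg_nonneg[of h ?A] by (simp add: p c1_seminorm_def algebra_simps)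
  finally show ?thesis .
qed

text \<open>Here the small factor h appears: the integral of z is small on short intervals, though
  its derivative is not.\<close>

lemma c_seminorm_prolong_segment:
  fixes z :: "real \<Rightarrow>\<^sub>C (real ^ 'n::finite)"
  assumes t: "0 \<le> t" "t \<le> h"
  shows "c_seminorm j (c1_to_c (prolong_segment t (0, z))) \<le> 2 * h * norm z"
  unfolding c_seminorm_def c1_to_c.rep_eq
proof (rule max_norm_le)
  fix s assume s: "s \<in> {- real j..0}"
  have "half_deriv (c1_fun (0 :: 'n c1_space)) 0 = 0"
    by (rule half_derivI) (simp_all add: zero_c1_space.rep_eq)
  then show "norm (c1_fun (prolong_segment t (0, z)) s) \<le> 2 * h * norm z"
    using s t norm_integral_prolong[of "t + s" h z]
    by (auto simp: c1_fun_prolong_segment segment_def prolong_def zero_c1_space.rep_eq)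
qed

text \<open>A change of the data is controlled uniformly in time by linearity and the preceding
  seminorm bound; for fixed data, continuity in time is that of segments of a continuously
  differentiable map.\<close>

lemma continuous_prolong_segment:
  "continuous_on ({0..h} \<times> UNIV) (\<lambda>p. prolong_segment (fst p) (snd p))"
  unfolding continuous_on_def
proof
  fix q :: "real \<times> ('n c1_space \<times> (real \<Rightarrow>\<^sub>C (real ^ 'n)))" assume q: "q \<in> {0..h} \<times> UNIV"
  obtain t \<phi> z where q_eq: "q = (t, (\<phi>, z))" by (cases q) auto
  let ?F = "at q within {0..h} \<times> UNIV"
  have lim: "((\<lambda>p. p) \<longlongrightarrow> q) ?F" by (rule tendsto_ident_at)
  show "((\<lambda>p. prolong_segment (fst p) (snd p)) \<longlongrightarrow> prolong_segment (fst q) (snd q)) ?F"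
    unfolding c1_space.tendsto_seminorm
  proof
    fix j
    let ?b = "\<lambda>p. ((2 + h) * c1_seminorm j (fst (snd p) - \<phi>) + (2 + 2 * h) * norm (snd (snd p) - z)) +
      c1_seminorm j (c1_segment (prolong \<phi> z) (fst p) - c1_segment (prolong \<phi> z) t)"
    have 1: "((\<lambda>p. c1_seminorm j (fst (snd p) - \<phi>)) \<longlongrightarrow> 0) ?F"
      using tendsto_fst[OF tendsto_snd[OF lim]] unfolding c1_space.tendsto_seminorm by (simp add: q_eq)
    have 2: "((\<lambda>p. norm (snd (snd p) - z)) \<longlongrightarrow> 0) ?F"
      using tendsto_snd[OF tendsto_snd[OF lim]] by (simp add: q_eq tendsto_norm_zero Lim_null[symmetric])
    have "((\<lambda>p. c1_segment (prolong \<phi> z) (fst p)) \<longlongrightarrow> c1_segment (prolong \<phi> z) t) ?F"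
      using filterlim_compose[OF c1_segment_continuous[OF has_vector_derivative_prolong continuous_prolong_deriv]
          tendsto_fst[OF lim]] by (simp add: q_eq)
    then have 3: "((\<lambda>p. c1_seminorm j (c1_segment (prolong \<phi> z) (fst p) - c1_segment (prolong \<phi> z) t)) \<longlongrightarrow> 0) ?F"
      unfolding c1_space.tendsto_seminorm by blast
    have b: "(?b \<longlongrightarrow> 0) ?F"
      using tendsto_add[OF tendsto_add[OF tendsto_mult_right_zero[OF 1] tendsto_mult_right_zero[OF 2]] 3] by simp
    have "\<forall>\<^sub>F p in ?F. norm (c1_seminorm j (prolong_segment (fst p) (snd p) - prolong_segment (fst q) (snd q))) \<le> ?b p"
      unfolding eventually_at_filter
    proof (rule always_eventually, intro allI impI)
      fix p :: "real \<times> ('n c1_space \<times> (real \<Rightarrow>\<^sub>C (real ^ 'n)))" assume "p \<in> {0..h} \<times> UNIV"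
      then have p: "0 \<le> fst p" "fst p \<le> h" by (auto simp: mem_Times_iff)
      have "prolong_segment (fst p) (snd p) - prolong_segment (fst q) (snd q) =
          prolong_segment (fst p) (snd p - (\<phi>, z)) + (prolong_segment (fst p) (\<phi>, z) - prolong_segment t (\<phi>, z))"
        by (simp add: linear_diff[OF linear_prolong_segment] q_eq)
      also have "c1_seminorm j \<dots> \<le> c1_seminorm j (prolong_segment (fst p) (snd p - (\<phi>, z))) +
          c1_seminorm j (prolong_segment (fst p) (\<phi>, z) - prolong_segment t (\<phi>, z))"
        by (rule c1_space.p_add)
      also have "\<dots> \<le> ?b p"
        using c1_seminorm_prolong_segment[OF p, of j "snd p - (\<phi>, z)"]
        by (simp add: prolong_segment_def)
      finally show "norm (c1_seminorm j (prolong_segment (fst p) (snd p) - prolong_segment (fst q) (snd q))) \<le> ?b p"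
        by (simp add: c1_space.p_nonneg)
    qed
    then show "((\<lambda>p. c1_seminorm j (prolong_segment (fst p) (snd p) - prolong_segment (fst q) (snd q))) \<longlongrightarrow> 0) ?F"
      using b by (rule Lim_null_comparison)
  qed
qed

section \<open>Solutions in terms of left derivatives\<close>

lemma segment_0: "c1_fun \<phi> = segment x 0 \<longleftrightarrow> (\<forall>s\<le>0. x s = c1_fun \<phi> s)"
  using c1_mapsD(3)[OF c1_fun, of _ \<phi>] by (auto simp: segment_def fun_eq_iff)

lemma segment_cong: "(\<And>s. s \<le> t \<Longrightarrow> x s = y s) \<Longrightarrow> segment x t = segment y t"
  by (simp add: segment_def fun_eq_iff)

text \<open>Prolongation by 0 is the affine continuation. It replaces a map whose behaviour beyond T
  is unknown by one that is continuously differentiable on the whole line and has the same segments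
  up to T.\<close>

lemma segment_eq_prolong:
  assumes "segment x T \<in> c1_maps" "t \<le> T"
  shows "segment x t = segment (prolong (c1_segment x T) 0) (t - T)"
  using assms(2) by (auto simp: segment_def prolong_def c1_fun_segment[OF assms(1)] fun_eq_iff)

lemma segment_c1_mono:
  assumes "segment x T \<in> c1_maps" "t \<le> T"
  shows "segment x t \<in> c1_maps"
  unfolding segment_eq_prolong[OF assms] by (rule segment_prolong(1))

lemma c1_segment_tendsto:
  assumes "segment x T \<in> c1_maps" "(\<tau> \<longlongrightarrow> t) F" "\<forall>\<^sub>F r in F. \<tau> r \<le> T" "t \<le> T"
  shows "((\<lambda>r. c1_segment x (\<tau> r)) \<longlongrightarrow> c1_segment x t) F"
proof -
  let ?X = "prolong (c1_segment x T) 0"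
  have eq: "c1_segment x t = c1_segment ?X (t - T)" if "t \<le> T" for t
    using segment_eq_prolong[OF assms(1) that] by (simp add: c1_segment_def)
  have "((\<lambda>r. \<tau> r - T) \<longlongrightarrow> t - T) F" by (intro tendsto_intros assms(2))
  with c1_segment_continuous[OF has_vector_derivative_prolong continuous_prolong_deriv]
  have "((\<lambda>r. c1_segment ?X (\<tau> r - T)) \<longlongrightarrow> c1_segment ?X (t - T)) F" by (rule filterlim_compose)
  moreover have "\<forall>\<^sub>F r in F. c1_segment ?X (\<tau> r - T) = c1_segment x (\<tau> r)"
    using assms(3) by eventually_elim (rule eq[symmetric])
  ultimately show ?thesis unfolding eq[OF assms(4)] by (simp add: tendsto_cong)
qed

lemma segment_has_derivative:
  assumes "segment x T \<in> c1_maps" "t \<le> T"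
  shows "(x has_vector_derivative half_deriv (segment x t) 0) (at t within {..T})"
proof -
  let ?X = "prolong (c1_segment x T) 0" and ?d = "prolong_deriv (c1_segment x T) 0"
  have "((?X \<circ> (\<lambda>t. t - T)) has_vector_derivative 1 *\<^sub>R ?d (t - T)) (at t within {..T})"
  proof (rule vector_diff_chain_within)
    show "((\<lambda>t. t - T) has_vector_derivative 1) (at t within {..T})"
      by (auto intro!: derivative_eq_intros)
    show "(?X has_vector_derivative ?d (t - T)) (at (t - T) within (\<lambda>t. t - T) ` {..T})"
      by (rule has_vector_derivative_at_within[OF has_vector_derivative_prolong])
  qed
  then have "(x has_vector_derivative ?d (t - T)) (at t within {..T})"
    unfolding o_def scaleR_one
    by (rule has_vector_derivative_transform[rotated 2])
      (use assms(2) in \<open>auto simp: prolong_def c1_fun_segment[OF assms(1)] segment_def\<close>)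
  moreover have "half_deriv (segment x t) 0 = ?d (t - T)"
    unfolding segment_eq_prolong[OF assms] using segment_prolong(2)[of 0] by simp
  ultimately show ?thesis by simp
qed

lemma continuous_on_of_segment:
  assumes "segment x T \<in> c1_maps" shows "continuous_on {..T} x"
  using segment_has_derivative[OF assms] has_vector_derivative_continuous
  unfolding continuous_on_eq_continuous_within by blast

text \<open>
  Prescribing the left derivative at every $t\in[0,T]$ is a condition on single segments; at
  $t=0$ it is the compatibility condition on the initial value.
\<close>

definition left_solution ::
    "(real \<Rightarrow> 'n::finite c1_space \<Rightarrow> real ^ 'n) \<Rightarrow> (real \<times> 'n c1_space) set \<Rightarrow> 'n c1_space
      \<Rightarrow> real \<Rightarrow> (real \<Rightarrow> real ^ 'n) \<Rightarrow> bool"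
  where "left_solution F D \<phi> T x \<longleftrightarrow> 0 \<le> T \<and> (\<forall>s\<le>0. x s = c1_fun \<phi> s) \<and> segment x T \<in> c1_maps \<and>
    (\<forall>t\<in>{0..T}. (t, c1_segment x t) \<in> D \<and> half_deriv (segment x t) 0 = F t (c1_segment x t))"

lemma left_solutionD:
  assumes "left_solution F D \<phi> T x"
  shows "0 \<le> T" "s \<le> 0 \<Longrightarrow> x s = c1_fun \<phi> s" "t \<le> T \<Longrightarrow> segment x t \<in> c1_maps"
    "0 \<le> t \<Longrightarrow> t \<le> T \<Longrightarrow> (t, c1_segment x t) \<in> D"
    "0 \<le> t \<Longrightarrow> t \<le> T \<Longrightarrow> half_deriv (segment x t) 0 = F t (c1_segment x t)"
    "c1_segment x 0 = \<phi>"
proof -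
  show "segment x t \<in> c1_maps" if "t \<le> T"
    using assms segment_c1_mono[OF _ that] unfolding left_solution_def by blast
  have "segment x 0 = c1_fun \<phi>" using assms segment_0[of \<phi> x] unfolding left_solution_def by simp
  then show "c1_segment x 0 = \<phi>" by (rule c1_segment_eqI)
qed (use assms in \<open>auto simp: left_solution_def\<close>)

lemma left_solution_mono:
  assumes "left_solution F D \<phi> T x" "0 \<le> t" "t \<le> T"
  shows "left_solution F D \<phi> t x"
  using left_solutionD[OF assms(1)] assms(2,3) unfolding left_solution_def by auto

lemma left_solution_change:
  assumes "left_solution F D \<phi> T x"
    and "\<And>t \<psi>. 0 \<le> t \<Longrightarrow> t \<le> T \<Longrightarrow> (t, \<psi>) \<in> D \<Longrightarrow> (t, \<psi>) \<in> D' \<and> F' t \<psi> = F t \<psi>"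
  shows "left_solution F' D' \<phi> T x"
  using assms unfolding left_solution_def by auto

lemma left_solution_cong:
  assumes "left_solution F D \<phi> T x" "\<And>s. s \<le> T \<Longrightarrow> x s = y s"
  shows "left_solution F D \<phi> T y"
proof -
  have "segment y t = segment x t" if "t \<le> T" for t
    using assms(2) that by (intro segment_cong) auto
  then show ?thesis using left_solutionD[OF assms(1)] assms(2) 
    unfolding left_solution_def c1_segment_def by auto
qed

text \<open>As \<open>y\<close> continues the segment of \<open>x\<close> at \<open>s\<close>, the concatenation is just the shifted map \<open>y\<close>.\<close>

lemma left_solution_glue:
  assumes x: "left_solution F D \<phi> s x" and y: "left_solution F' D' (c1_segment x s) r y"
    and F: "\<And>t \<psi>. 0 \<le> t \<Longrightarrow> t \<le> r \<Longrightarrow> (t, \<psi>) \<in> D' \<Longrightarrow> (s + t, \<psi>) \<in> D \<and> F' t \<psi> = F (s + t) \<psi>"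
  shows "left_solution F D \<phi> (s + r) (\<lambda>t. y (t - s))"
    and "\<And>t. t \<le> s \<Longrightarrow> y (t - s) = x t"
    and "\<And>t. c1_segment (\<lambda>t. y (t - s)) (s + t) = c1_segment y t"
proof -
  let ?g = "\<lambda>t. y (t - s)"
  have eq: "y (t - s) = x t" if "t \<le> s" for t
    using left_solutionD(2)[OF y, of "t - s"] that
    by (simp add: c1_fun_segment[OF left_solutionD(3)[OF x order.refl]] segment_def)
  then show "\<And>t. t \<le> s \<Longrightarrow> y (t - s) = x t" .
  have seg: "segment ?g (s + t) = segment y t" for t by (simp add: segment_def fun_eq_iff)
  then show "\<And>t. c1_segment ?g (s + t) = c1_segment y t" by (simp add: c1_segment_def)
  have seg': "segment ?g t = segment x t" if "t \<le> s" for t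
    using eq that by (intro segment_cong) auto
  have "(t, c1_segment ?g t) \<in> D \<and> half_deriv (segment ?g t) 0 = F t (c1_segment ?g t)"
    if t: "t \<in> {0..s + r}" for t
  proof (cases "t \<le> s")
    case True
    then show ?thesis using left_solutionD(4,5)[OF x, of t] seg'[OF True] t by (simp add: c1_segment_def)
  next
    case False
    then show ?thesis using left_solutionD(4,5)[OF y, of "t - s"] F[of "t - s"] seg[of "t - s"] t
      by (simp add: c1_segment_def)
  qed
  then show "left_solution F D \<phi> (s + r) ?g"
    using left_solutionD(1,2)[OF x] left_solutionD(1)[OF y] eq left_solutionD(3)[OF y order.refl]
    unfolding left_solution_def by (auto simp: seg)
qed

text \<open>Since the segment at T is continuously differentiable, the left derivative at t is the
  derivative within the half-line up to T, and the points of I close to t lie in that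
  half-line.\<close>

lemma ivp_solution_of_left:
  assumes "\<And>t. t \<in> I \<Longrightarrow> \<exists>T\<ge>t. left_solution F D \<phi> T x \<and> (\<forall>\<^sub>F s in at t within I. s \<le> T)"
    and "\<And>t. t \<in> I \<Longrightarrow> 0 \<le> t" and "I \<noteq> {}"
  shows "ivp_solution F D \<phi> I x"
  unfolding ivp_solution_def solution_on_def
proof (intro conjI ballI allI impI)
  fix t assume t: "t \<in> I"
  then obtain T where T: "t \<le> T" "left_solution F D \<phi> T x" and ev: "\<forall>\<^sub>F s in at t within I. s \<le> T"
    using assms(1) by blast
  show "segment x t \<in> c1_maps" "(t, c1_segment x t) \<in> D"
    using left_solutionD(3,4)[OF T(2)] T(1) assms(2)[OF t] by auto
  have "(x has_vector_derivative F t (c1_segment x t)) (at t within {..T})"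
    using segment_has_derivative[OF left_solutionD(3)[OF T(2) order.refl] T(1)]
      left_solutionD(5)[OF T(2) assms(2)[OF t] T(1)] by simp
  moreover have "at t within I \<le> at t within {..T}"
    unfolding at_within_def[of t "{..T}"] using ev
    by (intro inf_greatest) (auto simp: at_within_def le_principal eventually_inf_principal elim: eventually_mono)
  ultimately show "(x has_vector_derivative F t (c1_segment x t)) (at t within I)"
    unfolding has_vector_derivative_def has_derivative_within by (auto intro: tendsto_mono)
next
  fix s :: real assume "s \<le> 0"
  then show "x s = c1_fun \<phi> s" using assms(1,3) left_solutionD(2) by blast
qed

text \<open>For s > 0 the left derivative and the derivative within I are both derivatives within
  [s / 2, s], hence equal. As I may omit 0, the condition at 0 is a separate hypothesis.\<close>

lemma left_solution_of_ivp:
  assumes y: "ivp_solution F D \<phi> I y" and I: "is_interval I" "t \<in> I" "0 \<le> t" "\<And>s. 0 < s \<Longrightarrow> s \<le> t \<Longrightarrow> s \<in> I"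
    and compat: "(0, \<phi>) \<in> D" "half_deriv (c1_fun \<phi>) 0 = F 0 \<phi>"
  shows "left_solution F D \<phi> t y"
proof -
  have init: "\<And>s. s \<le> 0 \<Longrightarrow> y s = c1_fun \<phi> s"
    and sol: "\<And>t. t \<in> I \<Longrightarrow> segment y t \<in> c1_maps \<and> (t, c1_segment y t) \<in> D \<and>
      (y has_vector_derivative F t (c1_segment y t)) (at t within I)"
    using y unfolding ivp_solution_def solution_on_def by blast+
  have seg0: "segment y 0 = c1_fun \<phi>" using init segment_0[of \<phi> y] by simp
  have "(s, c1_segment y s) \<in> D \<and> half_deriv (segment y s) 0 = F s (c1_segment y s)" if s: "s \<in> {0..t}" for s
  proof (cases "s = 0")
    case True
    then show ?thesis using compat seg0 c1_segment_eqI[OF seg0] by simp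
  next
    case False
    then have sI: "s \<in> I" "0 < s" using I(4) s by auto
    have "(y has_vector_derivative half_deriv (segment y s) 0) (at s within {s / 2..s})"
      using segment_has_derivative[of y s s] sol[OF sI(1)] by (auto intro: has_vector_derivative_within_subset)
    moreover have "{s / 2..s} \<subseteq> I" using sI(2) s by (auto intro!: I(4))
    then have "(y has_vector_derivative F s (c1_segment y s)) (at s within {s / 2..s})"
      using sol[OF sI(1)] by (blast intro: has_vector_derivative_within_subset)
    moreover have "at s within {s / 2..s} \<noteq> bot"
      using sI(2) by (simp add: trivial_limit_within islimpt_Icc)
    ultimately show ?thesis using vector_derivative_within sol[OF sI(1)] by metis
  qed
  then show ?thesis unfolding left_solution_def using I(3) init sol[OF I(2)] by blast
qed

section \<open>Uniqueness and maximal solutions\<close>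

text \<open>The arguments are localized in C^1, but their distance is measured in C, as property (e)
  permits. Only times from t0 on are considered because solutions are continued forward. The
  explicit time dependence is there for the variational equation.\<close>

definition local_lipschitz_dde ::
    "(real \<Rightarrow> 'n::finite c1_space \<Rightarrow> real ^ 'n) \<Rightarrow> (real \<times> 'n c1_space) set \<Rightarrow> bool"
  where "local_lipschitz_dde F D \<longleftrightarrow> (\<forall>t0 \<psi>0. 0 \<le> t0 \<longrightarrow> (t0, \<psi>0) \<in> D \<longrightarrow>
    (\<exists>\<delta>>0. \<exists>\<epsilon>>0. \<exists>j. \<exists>\<Lambda>>0. \<forall>t \<psi> \<psi>'. t0 \<le> t \<longrightarrow> t < t0 + \<delta> \<longrightarrow> (t, \<psi>) \<in> D \<longrightarrow> (t, \<psi>') \<in> D \<longrightarrow>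
      c1_seminorm j (\<psi> - \<psi>0) < \<epsilon> \<longrightarrow> c1_seminorm j (\<psi>' - \<psi>0) < \<epsilon> \<longrightarrow>
      norm (F t \<psi> - F t \<psi>') \<le> \<Lambda> * c_seminorm j (c1_to_c (\<psi> - \<psi>'))))"

text \<open>A maximum argument in place of Gronwall's inequality: at the point u of [s, r] where the
  distance of x and y is largest, the mean value inequality bounds this distance by (u - s) *
  \<Lambda> times itself. Since x and y agree up to s, the C-seminorm of a difference of segments at
  a time before u involves only distances on [s, u].\<close>

lemma left_solution_unique_step:
  assumes lip: "local_lipschitz_dde F D"
    and x: "left_solution F D \<phi> T x" and y: "left_solution F D \<phi> T y"
    and s: "0 \<le> s" "s < T" and eq: "\<And>t. t \<le> s \<Longrightarrow> x t = y t"
  obtains r where "s < r" "r \<le> T" "\<And>t. t \<le> r \<Longrightarrow> x t = y t"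
proof -
  have "(s, c1_segment x s) \<in> D" using left_solutionD(4)[OF x] s by simp
  then obtain \<delta> \<epsilon> j \<Lambda> where pos: "\<delta> > 0" "\<epsilon> > 0" "\<Lambda> > 0"
    and L: "\<forall>t \<psi> \<psi>'. s \<le> t \<longrightarrow> t < s + \<delta> \<longrightarrow> (t, \<psi>) \<in> D \<longrightarrow> (t, \<psi>') \<in> D \<longrightarrow>
      c1_seminorm j (\<psi> - c1_segment x s) < \<epsilon> \<longrightarrow> c1_seminorm j (\<psi>' - c1_segment x s) < \<epsilon> \<longrightarrow>
      norm (F t \<psi> - F t \<psi>') \<le> \<Lambda> * c_seminorm j (c1_to_c (\<psi> - \<psi>'))"
    using lip[unfolded local_lipschitz_dde_def, rule_format, OF s(1)] by blast
  have near: "\<forall>\<^sub>F t in at_right s. c1_seminorm j (c1_segment w t - c1_segment w s) < \<epsilon>"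
    if w: "left_solution F D \<phi> T w" for w
  proof -
    have "((\<lambda>r. c1_segment w r) \<longlongrightarrow> c1_segment w s) (at_right s)"
    proof (rule c1_segment_tendsto[OF left_solutionD(3)[OF w order.refl]])
      show "\<forall>\<^sub>F r in at_right s. r \<le> T" using s(2) by (auto simp: eventually_at_right intro!: exI[of _ T])
    qed (use s in auto)
    then have "((\<lambda>r. c1_seminorm j (c1_segment w r - c1_segment w s)) \<longlongrightarrow> 0) (at_right s)"
      unfolding c1_space.tendsto_seminorm by blast
    from order_tendstoD(2)[OF this pos(2)] show ?thesis .
  qed
  have seg_eq: "c1_segment y s = c1_segment x s"
    using segment_cong[of s y x] eq by (simp add: c1_segment_def)
  have "\<forall>\<^sub>F t in at_right s. c1_seminorm j (c1_segment x t - c1_segment x s) < \<epsilon> \<and>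
      c1_seminorm j (c1_segment y t - c1_segment x s) < \<epsilon>"
    using near[OF x] near[OF y] unfolding seg_eq by (rule eventually_conj)
  then obtain b where b: "s < b" "\<And>t. s < t \<Longrightarrow> t < b \<Longrightarrow> c1_seminorm j (c1_segment x t - c1_segment x s) < \<epsilon> \<and>
      c1_seminorm j (c1_segment y t - c1_segment x s) < \<epsilon>"
    unfolding eventually_at_right[OF s(2)] by blast
  \<comment> \<open>The last bound makes \<Lambda> * (r - s) at most 1/2, which forces the maximal
    distance to be 0.\<close>
  define r where "r = min (min b T) (min (s + \<delta>) (s + 1 / (2 * \<Lambda>)))"
  have r: "s < r" "r \<le> b" "r \<le> T" "r \<le> s + \<delta>" "\<Lambda> * (r - s) \<le> 1 / 2"
  proof -
    show "s < r" "r \<le> b" "r \<le> T" "r \<le> s + \<delta>" using b(1) s pos by (auto simp: r_def)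
    have "r - s \<le> 1 / (2 * \<Lambda>)" unfolding r_def by linarith
    then have "\<Lambda> * (r - s) \<le> \<Lambda> * (1 / (2 * \<Lambda>))" using pos(3) by (intro mult_left_mono) auto
    then show "\<Lambda> * (r - s) \<le> 1 / 2" using pos(3) by simp
  qed
  let ?d = "\<lambda>t. x t - y t"
  have cont: "continuous_on {..T} ?d"
    by (intro continuous_intros continuous_on_of_segment left_solutionD(3)[OF x] left_solutionD(3)[OF y]) auto
  have "\<exists>u\<in>{s..r}. \<forall>t\<in>{s..r}. norm (?d t) \<le> norm (?d u)"
    using r by (intro continuous_attains_sup continuous_intros continuous_on_subset[OF cont]) auto
  then obtain u where u: "u \<in> {s..r}" and max: "\<And>t. t \<in> {s..r} \<Longrightarrow> norm (?d t) \<le> norm (?d u)" by blast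
  have "norm (?d u) \<le> 0"
  proof (cases "u = s")
    case True
    then show ?thesis using eq by simp
  next
    case False
    then have su: "s < u" using u by simp
    have der: "(?d has_derivative (\<lambda>h. h *\<^sub>R (half_deriv (segment x t) 0 - half_deriv (segment y t) 0))) (at t)"
      if t: "s < t" "t < u" for t
    proof -
      have tT: "t < T" using t u r(3) by auto
      have "(?d has_vector_derivative half_deriv (segment x t) 0 - half_deriv (segment y t) 0) (at t within {..T})"
        using tT by (intro has_vector_derivative_diff segment_has_derivative left_solutionD(3)[OF x]
            left_solutionD(3)[OF y]) auto
      moreover have "at t within {..T} = at t" using tT by (intro at_within_interior) auto
      ultimately show ?thesis by (simp add: has_vector_derivative_def)
    qed
    have "continuous_on {s..u} ?d" using u r(3) by (intro continuous_on_subset[OF cont]) auto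
    from mvt_general[OF su this der] obtain \<xi> where \<xi>: "s < \<xi>" "\<xi> < u"
      and le: "norm (?d u - ?d s) \<le> norm ((u - s) *\<^sub>R (half_deriv (segment x \<xi>) 0 - half_deriv (segment y \<xi>) 0))"
      by auto
    have \<xi>': "0 \<le> \<xi>" "\<xi> \<le> T" "\<xi> < b" "\<xi> < s + \<delta>" using \<xi> u r s by auto
    have "norm (F \<xi> (c1_segment x \<xi>) - F \<xi> (c1_segment y \<xi>)) \<le>
        \<Lambda> * c_seminorm j (c1_to_c (c1_segment x \<xi> - c1_segment y \<xi>))"
      using b(2)[OF \<xi>(1) \<xi>'(3)] \<xi> \<xi>' by (intro L[rule_format] left_solutionD(4)[OF x] left_solutionD(4)[OF y]) auto
    also have "c_seminorm j (c1_to_c (c1_segment x \<xi> - c1_segment y \<xi>)) \<le> norm (?d u)"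
      unfolding c_seminorm_def c1_to_c.rep_eq
    proof (rule max_norm_le)
      fix t assume t: "t \<in> {- real j..0}"
      show "norm (c1_fun (c1_segment x \<xi> - c1_segment y \<xi>) t) \<le> norm (?d u)"
      proof (cases "\<xi> + t \<le> s")
        case True
        then show ?thesis using eq[OF True] t
          by (simp add: minus_c1_space.rep_eq c1_fun_segment[OF left_solutionD(3)[OF x \<xi>'(2)]]
              c1_fun_segment[OF left_solutionD(3)[OF y \<xi>'(2)]] segment_def)
      next
        case False
        then have "norm (?d (\<xi> + t)) \<le> norm (?d u)" using t u \<xi> by (intro max) auto
        then show ?thesis using t
          by (simp add: minus_c1_space.rep_eq c1_fun_segment[OF left_solutionD(3)[OF x \<xi>'(2)]]
              c1_fun_segment[OF left_solutionD(3)[OF y \<xi>'(2)]] segment_def)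
      qed
    qed
    finally have *: "norm (F \<xi> (c1_segment x \<xi>) - F \<xi> (c1_segment y \<xi>)) \<le> \<Lambda> * norm (?d u)"
      using pos(3) by simp
    have "norm (?d u) \<le> (u - s) * norm (F \<xi> (c1_segment x \<xi>) - F \<xi> (c1_segment y \<xi>))"
      using le eq[of s] su left_solutionD(5)[OF x \<xi>'(1,2)] left_solutionD(5)[OF y \<xi>'(1,2)] by simp
    also have "\<dots> \<le> (r - s) * (\<Lambda> * norm (?d u))"
      using u su * by (intro mult_mono) auto
    also have "\<dots> = (\<Lambda> * (r - s)) * norm (?d u)" by simp
    also have "\<dots> \<le> 1 / 2 * norm (?d u)" by (intro mult_right_mono r(5)) simp
    finally show ?thesis by simp
  qed
  then have "x t = y t" if "t \<in> {s..r}" for t using max[OF that] by simp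
  then have "x t = y t" if "t \<le> r" for t using eq[of t] that by (cases "t \<le> s") auto
  then show thesis using that r(1,3) by blast
qed

text \<open>Agreement reaches the supremum of the times of agreement by continuity, and the step
  carries it beyond.\<close>

lemma left_solution_unique:
  assumes lip: "local_lipschitz_dde F D"
    and x: "left_solution F D \<phi> T x" and y: "left_solution F D \<phi> T y" and t: "t \<le> T"
  shows "x t = y t"
proof -
  define A where "A = {s\<in>{0..T}. \<forall>t\<le>s. x t = y t}"
  have T: "0 \<le> T" using left_solutionD(1)[OF x] .
  have A0: "0 \<in> A" unfolding A_def using T left_solutionD(2)[OF x] left_solutionD(2)[OF y] by auto
  have bdd: "bdd_above A" unfolding A_def by auto
  define s where "s = Sup A"
  have s: "0 \<le> s" "s \<le> T"
    unfolding s_def using cSup_upper[OF A0 bdd] A0 by (auto intro!: cSup_least simp: A_def)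
  have below: "x t = y t" if "t < s" for t
  proof -
    obtain a where "a \<in> A" "t < a" using less_cSupD[of A t] A0 \<open>t < s\<close> unfolding s_def by blast
    then show ?thesis unfolding A_def by auto
  qed
  have "x s = y s"
  proof (rule tendsto_unique)
    have cx: "continuous_on {..s} x" "continuous_on {..s} y"
      using continuous_on_of_segment[OF left_solutionD(3)[OF x s(2)]]
        continuous_on_of_segment[OF left_solutionD(3)[OF y s(2)]] .
    have le: "at_left s \<le> at s within {..s}" by (rule at_le) auto
    show "(x \<longlongrightarrow> x s) (at_left s)" using cx(1) le unfolding continuous_on_def by (auto intro: tendsto_mono)
    have "(y \<longlongrightarrow> y s) (at_left s)" using cx(2) le unfolding continuous_on_def by (auto intro: tendsto_mono)
    then show "(x \<longlongrightarrow> y s) (at_left s)"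
      by (rule filterlim_mono_eventually[OF _ order.refl order.refl]) (auto simp: eventually_at_filter below)
  qed simp
  with below have upto: "x t = y t" if "t \<le> s" for t using that by (cases "t = s") auto
  have "\<not> s < T"
  proof
    assume "s < T"
    from left_solution_unique_step[OF lip x y s(1) this upto]
    obtain r where r: "s < r" "r \<le> T" "\<And>t. t \<le> r \<Longrightarrow> x t = y t" by blast
    then have "r \<in> A" unfolding A_def using s by auto
    then show False using cSup_upper[OF _ bdd, of r] r(1) unfolding s_def by simp
  qed
  then show ?thesis using upto t s by simp
qed

text \<open>Competing solutions live on intervals of any kind with infimum 0. Up to each time of its
  interval a competitor is a left solution, to which uniqueness and the bound T apply.\<close>

lemma maximal_solutionI:
  assumes lip: "local_lipschitz_dde F D"
    and A: "\<And>t. 0 \<le> t \<Longrightarrow> ereal t < T \<Longrightarrow> left_solution F D \<phi> t x"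
    and max: "\<And>t y. left_solution F D \<phi> t y \<Longrightarrow> ereal t < T" and T: "0 < T"
  shows "maximal_solution F D \<phi> T x"
  unfolding maximal_solution_def
proof (intro conjI allI impI T)
  have x0: "left_solution F D \<phi> 0 x" using A[of 0] T by (simp add: zero_ereal_def)
  show "ivp_solution F D \<phi> {t. 0 \<le> t \<and> ereal t < T} x"
  proof (rule ivp_solution_of_left)
    fix t assume t: "t \<in> {t. 0 \<le> t \<and> ereal t < T}"
    then obtain r where r: "t < r" "ereal r < T" using ereal_dense2[of "ereal t" T] by auto
    have "left_solution F D \<phi> r x" using A[of r] r t by auto
    moreover have "\<forall>\<^sub>F s in at t within {t. 0 \<le> t \<and> ereal t < T}. s \<le> r"
      using order_tendstoD(2)[OF tendsto_ident_at r(1)] by eventually_elim simp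
    ultimately show "\<exists>r\<ge>t. left_solution F D \<phi> r x \<and> (\<forall>\<^sub>F s in at t within {t. 0 \<le> t \<and> ereal t < T}. s \<le> r)"
      using r(1) by (intro exI[of _ r]) auto
  qed (use T in \<open>auto intro!: exI[of _ 0] simp: zero_ereal_def\<close>)
  fix I y assume "interval_from_0 I \<and> ivp_solution F D \<phi> I y"
  then have I: "is_interval I" "I \<noteq> {}" "bdd_below I" "Inf I = 0" and y: "ivp_solution F D \<phi> I y"
    unfolding interval_from_0_def by auto
  \<comment> \<open>The interval of a competitor may omit 0, so compatibility at 0 is taken from
    x.\<close>
  have compat: "(0, \<phi>) \<in> D" "half_deriv (c1_fun \<phi>) 0 = F 0 \<phi>"
    using left_solutionD(4,5)[OF x0, of 0] left_solutionD(6)[OF x0]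
      c1_fun_segment[OF left_solutionD(3)[OF x0, of 0]] by auto
  have sol: "left_solution F D \<phi> t y" if t: "t \<in> I" for t
  proof (rule left_solution_of_ivp[OF y I(1) t _ _ compat])
    show "0 \<le> t" using cInf_lower[OF t I(3)] I(4) by simp
    fix s assume s: "0 < s" "s \<le> t"
    then obtain r where "r \<in> I" "r < s" using cInf_less_iff[OF I(2,3), of s] I(4) by auto
    then show "s \<in> I" using I(1) t s unfolding is_interval_1 by (meson less_imp_le)
  qed
  show "\<forall>t\<in>I. ereal t < T" using max[OF sol] by blast
  show "\<forall>t\<in>{..0} \<union> I. y t = x t"
  proof
    fix t assume "t \<in> {..0} \<union> I"
    then consider "t \<le> 0" | "t \<in> I" by auto
    then show "y t = x t"
    proof cases
      case 1
      then show ?thesis using y left_solutionD(2)[OF x0 1] unfolding ivp_solution_def by simp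
    next
      case 2
      have "left_solution F D \<phi> t x" using A[OF left_solutionD(1)[OF sol[OF 2]] max[OF sol[OF 2]]] .
      from left_solution_unique[OF lip sol[OF 2] this] show ?thesis by simp
    qed
  qed
qed

text \<open>Each of the two solutions is a competitor in the maximality condition of the
  other.\<close>

lemma maximal_solution_unique:
  assumes "maximal_solution F D \<phi> T x" "maximal_solution F D \<phi> T' x'"
  shows "T = T'" and "\<And>t. ereal t < T \<Longrightarrow> x' t = x t"
proof -
  have iv: "interval_from_0 {t. 0 \<le> t \<and> ereal t < T}" if "0 < T" for T
  proof -
    have "Inf {t. 0 \<le> t \<and> ereal t < T} = 0"
      using that by (intro cInf_eq_minimum) (auto simp: zero_ereal_def)
    moreover have "0 \<in> {t. 0 \<le> t \<and> ereal t < T}" using that by (simp add: zero_ereal_def)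
    moreover have "bdd_below {t. 0 \<le> t \<and> ereal t < T}" by (rule bdd_belowI[of _ 0]) auto
    moreover have "is_interval {t. 0 \<le> t \<and> ereal t < T}"
      unfolding is_interval_1 by (auto, meson ereal_less_eq(3) order.strict_trans1)
    ultimately show ?thesis unfolding interval_from_0_def by blast
  qed
  have le: "T1 \<le> T2" if "maximal_solution F D \<phi> T1 x1" "maximal_solution F D \<phi> T2 x2" for T1 T2 x1 x2
  proof (rule ccontr)
    assume "\<not> T1 \<le> T2"
    then have "T2 < T1" by simp
    then obtain r where r: "T2 < ereal r" "ereal r < T1" using ereal_dense2 by blast
    have "0 < T2" using that(2) unfolding maximal_solution_def by blast
    then have "0 < ereal r" using r(1) by (rule order.strict_trans)
    then have "0 \<le> r" by simp
    then have "r \<in> {t. 0 \<le> t \<and> ereal t < T1}" using r(2) by simp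
    then have "ereal r < T2" using that iv[of T1] unfolding maximal_solution_def by blast
    then show False using r(1) by simp
  qed
  show T: "T = T'" using le[OF assms] le[OF assms(2,1)] by (rule antisym)
  fix t assume "ereal t < T"
  then have "t \<in> {..0} \<union> {t. 0 \<le> t \<and> ereal t < T'}" using T by auto
  then show "x' t = x t" using assms iv[of T'] unfolding maximal_solution_def T by blast
qed

section \<open>Prescribed slopes at zero\<close>

text \<open>The linear side of the equation defining the solution manifold; its kernel will be the
  model space of the charts.\<close>

definition initial_slope :: "'n::finite c1_space \<Rightarrow> real ^ 'n"
  where "initial_slope \<phi> = half_deriv (c1_fun \<phi>) 0"

lemma linear_initial_slope: "linear initial_slope"
  unfolding initial_slope_def
  by (rule linearI) (simp_all add: plus_c1_space.rep_eq half_deriv_add[OF c1_fun c1_fun]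
      scaleR_c1_space.rep_eq half_deriv_scale[OF c1_fun])

lemma norm_initial_slope: "norm (initial_slope \<phi>) \<le> c1_seminorm 0 \<phi>"
  using norm_le_max_norm[OF continuous_half_deriv, of 0 0 \<phi>] max_norm_nonneg[OF continuous_c1_fun, of 0 \<phi>]
  unfolding initial_slope_def c1_seminorm_def by simp

lemma continuous_initial_slope: "continuous_on UNIV initial_slope"
proof (rule linear_continuousI[OF linear_initial_slope])
  have "((\<lambda>x. c1_seminorm 0 (x - 0)) \<longlongrightarrow> 0) (nhds 0)"
    using c1_space.tendsto_seminorm[THEN iffD1, OF filterlim_ident] by blast
  then show "(initial_slope \<longlongrightarrow> 0) (nhds 0)"
    by (intro Lim_null_comparison[where f = initial_slope and g = "c1_seminorm 0"])
      (simp_all add: norm_initial_slope)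
qed

text \<open>Maps with prescribed slope at $0$ which are small in the topology of \<open>c_space\<close>.\<close>

definition sine_ramp :: "real \<Rightarrow> real ^ 'n::finite \<Rightarrow> 'n c1_space"
  where "sine_ramp \<epsilon> c = c1_segment (\<lambda>t. (\<epsilon> * sin (t / \<epsilon>)) *\<^sub>R c) 0"

lemma sine_ramp_rep:
  assumes "\<epsilon> > 0" "s \<le> 0"
  shows "c1_fun (sine_ramp \<epsilon> c) s = (\<epsilon> * sin (s / \<epsilon>)) *\<^sub>R c"
    and "half_deriv (c1_fun (sine_ramp \<epsilon> c)) s = cos (s / \<epsilon>) *\<^sub>R c"
proof -
  have der: "((\<lambda>t. (\<epsilon> * sin (t / \<epsilon>)) *\<^sub>R c) has_vector_derivative cos (t / \<epsilon>) *\<^sub>R c) (at t)" for t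
  proof -
    have "((\<lambda>t. \<epsilon> * sin (t / \<epsilon>)) has_real_derivative cos (t / \<epsilon>)) (at t)"
      using assms(1) by (auto intro!: derivative_eq_intros)
    from has_vector_derivative_scaleR[OF this has_vector_derivative_const]
    show ?thesis by simp
  qed
  have cont: "continuous_on UNIV (\<lambda>t. cos (t / \<epsilon>) *\<^sub>R c)"
    using assms(1) by (intro continuous_intros) auto
  note seg = segment_c1_UNIV[OF der cont, where t = 0]
  show "c1_fun (sine_ramp \<epsilon> c) s = (\<epsilon> * sin (s / \<epsilon>)) *\<^sub>R c"
    unfolding sine_ramp_def c1_fun_segment[OF seg(1)] using assms(2) by (simp add: segment_def)
  show "half_deriv (c1_fun (sine_ramp \<epsilon> c)) s = cos (s / \<epsilon>) *\<^sub>R c"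
    unfolding sine_ramp_def c1_fun_segment[OF seg(1)] using seg(2)[OF assms(2)] by simp
qed

lemma initial_slope_sine_ramp: "\<epsilon> > 0 \<Longrightarrow> initial_slope (sine_ramp \<epsilon> c) = c"
  unfolding initial_slope_def by (simp add: sine_ramp_rep)

lemma linear_sine_ramp: "\<epsilon> > 0 \<Longrightarrow> linear (sine_ramp \<epsilon>)"
  by (rule linearI; rule c1_space_eqI)
    (simp_all add: sine_ramp_rep plus_c1_space.rep_eq scaleR_c1_space.rep_eq algebra_simps)

lemma c_seminorm_sine_ramp:
  assumes "\<epsilon> > 0" shows "c_seminorm j (c1_to_c (sine_ramp \<epsilon> c)) \<le> \<epsilon> * norm c"
  unfolding c_seminorm_def c1_to_c.rep_eq
proof (rule max_norm_le)
  fix s assume "s \<in> {- real j..0}"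
  then show "norm (c1_fun (sine_ramp \<epsilon> c) s) \<le> \<epsilon> * norm c"
    using assms mult_right_mono[of "\<epsilon> * \<bar>sin (s / \<epsilon>)\<bar>" \<epsilon> "norm c"]
    by (simp add: sine_ramp_rep abs_mult)
qed

lemma c1_seminorm_sine_ramp:
  assumes "\<epsilon> > 0" shows "c1_seminorm j (sine_ramp \<epsilon> c) \<le> (\<epsilon> + 1) * norm c"
proof -
  have "max_norm j (half_deriv (c1_fun (sine_ramp \<epsilon> c))) \<le> norm c"
    by (rule max_norm_le) (auto simp: sine_ramp_rep(2)[OF assms] intro!: mult_left_le_one_le)
  then have "c1_seminorm j (sine_ramp \<epsilon> c) \<le> \<epsilon> * norm c + norm c"
    using c_seminorm_sine_ramp[OF assms, of j c]
    unfolding c1_seminorm_def c_seminorm_def c1_to_c.rep_eq by (intro add_mono)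
  then show ?thesis by (simp add: algebra_simps)
qed

lemma continuous_sine_ramp:
  assumes "\<epsilon> > 0" shows "continuous_on UNIV (sine_ramp \<epsilon> :: real ^ 'n::finite \<Rightarrow> 'n c1_space)"
proof (rule linear_continuousI[OF linear_sine_ramp[OF assms]])
  have cont: "continuous_on UNIV (\<lambda>c :: real ^ 'n. (\<epsilon> + 1) * norm c)" by (intro continuous_intros)
  show "((sine_ramp \<epsilon> :: real ^ 'n \<Rightarrow> 'n c1_space) \<longlongrightarrow> 0) (nhds 0)"
    unfolding c1_space.tendsto_seminorm
  proof
    fix j
    have "((\<lambda>c :: real ^ 'n. (\<epsilon> + 1) * norm c) \<longlongrightarrow> 0) (nhds 0)"
      using continuous_on_open_nhds[OF cont, of 0] by simp
    then show "((\<lambda>c. c1_seminorm j (sine_ramp \<epsilon> c - 0 :: 'n c1_space)) \<longlongrightarrow> 0) (nhds 0)"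
      by (rule Lim_null_comparison[rotated])
        (simp add: c1_space.p_nonneg c1_seminorm_sine_ramp[OF assms])
  qed
qed

lemma closed_complemented_slope:
  "closed_complemented {\<phi> :: 'n::finite c1_space. initial_slope \<phi> = 0}"
  unfolding closed_complemented_def
proof (intro conjI exI)
  let ?G = "{\<phi> :: 'n c1_space. initial_slope \<phi> = 0}" and ?H = "range (sine_ramp 1) :: 'n c1_space set"
  show "subspace ?G"
    by (rule subspaceI) (simp_all add: linear_0[OF linear_initial_slope] linear_add[OF linear_initial_slope]
        linear_cmul[OF linear_initial_slope])
  show "closed ?G" by (intro closed_Collect_eq continuous_initial_slope continuous_on_const)
  show "subspace ?H" by (rule linear_subspace_image[OF linear_sine_ramp subspace_UNIV]) simp
  \<comment> \<open>The complement is the fixed point set of the continuous projection \<psi> to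
    \<open>sine_ramp 1 (initial_slope \<psi>)\<close>, hence closed.\<close>
  have H: "?H = {\<psi>. \<psi> = sine_ramp 1 (initial_slope \<psi>)}" by (auto simp: initial_slope_sine_ramp)
  have "continuous_on UNIV (\<lambda>\<psi> :: 'n c1_space. sine_ramp 1 (initial_slope \<psi>))"
    by (rule continuous_on_compose2[OF continuous_sine_ramp continuous_initial_slope]) auto
  then show "closed ?H" unfolding H by (intro closed_Collect_eq continuous_on_id)
  have 0: "sine_ramp 1 0 = (0 :: 'n c1_space)" by (rule linear_0[OF linear_sine_ramp]) simp
  then have "0 \<in> ?H" by (metis rangeI)
  then show "?G \<inter> ?H = {0}"
    using linear_0[OF linear_initial_slope] 0 by (auto simp: initial_slope_sine_ramp)
  have "\<exists>g h. \<phi> = g + h \<and> g \<in> ?G \<and> h \<in> ?H" for \<phi>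
    by (rule exI[of _ "\<phi> - sine_ramp 1 (initial_slope \<phi>)"], rule exI[of _ "sine_ramp 1 (initial_slope \<phi>)"])
      (simp add: linear_diff[OF linear_initial_slope] initial_slope_sine_ramp)
  then show "{g + h |g h. g \<in> ?G \<and> h \<in> ?H} = UNIV" by blast
qed

section \<open>The flow of the extended equation\<close>

locale smooth_delay_equation =
  fixes f :: "'n::finite c1_space \<Rightarrow> real ^ 'n" and U :: "'n c1_space set"
  assumes open_U: "open U" and smooth: "C1F_on UNIV U f" and prop_e: "property_e f U"
begin

abbreviation Df :: "'n c1_space \<Rightarrow> 'n c1_space \<Rightarrow> real ^ 'n"
  where "Df \<equiv> dir_deriv f"

definition defect :: "'n c1_space \<Rightarrow> real ^ 'n"
  where "defect \<phi> = half_deriv (c1_fun \<phi>) 0 - f \<phi>"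

text \<open>The derivative of \<open>defect\<close> at \<phi> in direction \<eta>.\<close>

definition linear_defect :: "'n c1_space \<Rightarrow> 'n c1_space \<Rightarrow> real ^ 'n"
  where "linear_defect \<phi> \<eta> = half_deriv (c1_fun \<eta>) 0 - Df \<phi> \<eta>"

lemma f_C1: "hadamard_C1 U f Df"
  using hadamard_C1_of_property_e[OF open_U smooth prop_e] .

text \<open>At t = 0 the fixed point equation gives \<zeta> \<phi> 0 = f \<phi>, so the prolongation
  solves the extended equation. The last clause is the linearized fixed point equation, from which
  the variational equation is read off.\<close>

lemma local_prolongation:
  assumes \<phi>0: "\<phi>0 \<in> U"
  obtains h N \<zeta> D\<zeta> where "h > 0" "\<phi>0 \<in> N" "hadamard_C1 N \<zeta> D\<zeta>" "N \<subseteq> U"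
    "\<And>\<phi> t. \<phi> \<in> N \<Longrightarrow> t \<in> {0..h} \<Longrightarrow> prolong_segment t (\<phi>, \<zeta> \<phi>) \<in> U"
    "\<And>\<phi> t. \<phi> \<in> N \<Longrightarrow> t \<in> {0..h} \<Longrightarrow> apply_bcontfun (\<zeta> \<phi>) t = f (prolong_segment t (\<phi>, \<zeta> \<phi>))"
    "\<And>\<phi> t \<eta>. \<phi> \<in> N \<Longrightarrow> t \<in> {0..h} \<Longrightarrow> apply_bcontfun (D\<zeta> \<phi> \<eta>) t =
      Df (prolong_segment t (\<phi>, \<zeta> \<phi>)) (prolong_segment t (\<eta>, D\<zeta> \<phi> \<eta>))"
proof -
  obtain j \<epsilon> \<Lambda> where pos: "\<epsilon> > 0" "\<Lambda> > 0" and BU: "{\<psi>. c1_seminorm j (\<psi> - \<phi>0) < \<epsilon>} \<subseteq> U"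
    and lip: "\<And>\<psi> \<psi>'. c1_seminorm j (\<psi> - \<phi>0) < \<epsilon> \<Longrightarrow> c1_seminorm j (\<psi>' - \<phi>0) < \<epsilon> \<Longrightarrow>
      norm (f \<psi> - f \<psi>') \<le> \<Lambda> * c_seminorm j (c1_to_c (\<psi> - \<psi>'))"
    using property_e_lipschitz[OF open_U smooth prop_e \<phi>0] by metis
  define B where "B = {\<psi>. c1_seminorm j (\<psi> - \<phi>0) < \<epsilon>}"
  have B: "open B" "\<phi>0 \<in> B" unfolding B_def using pos by (auto intro: c1_space.open_ball simp: c1_space.p_zero)
  \<comment> \<open>The initial guess for t to f(x_t) is its value at time 0 for the datum
    \<phi>0.\<close>
  define z0 :: "real \<Rightarrow>\<^sub>C (real ^ 'n)" where "z0 = const_bcontfun (f \<phi>0)"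
  \<comment> \<open>The segment at time 0 is \<phi>0 itself, so short times and data near (\<phi>0,
    z0) keep segments in a given neighbourhood.\<close>
  have near: "\<exists>d>0. \<exists>P r. open P \<and> \<phi>0 \<in> P \<and> r > 0 \<and>
      (\<forall>t\<in>{0..d}. \<forall>\<phi>\<in>P. \<forall>z\<in>cball z0 r. prolong_segment t (\<phi>, z) \<in> B')"
    if B': "open B'" "\<phi>0 \<in> B'" for B'
  proof -
    have "prolong_segment 0 (\<phi>0, z0) \<in> B'" using B'(2) by (simp add: prolong_segment_0)
    then obtain A where A: "open A" "(0, (\<phi>0, z0)) \<in> A"
      and AB: "\<And>y. y \<in> {0..1} \<times> UNIV \<Longrightarrow> y \<in> A \<Longrightarrow> prolong_segment (fst y) (snd y) \<in> B'"
      using continuous_prolong_segment[of 1, unfolded continuous_on_topological, rule_format,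
          of "(0, (\<phi>0, z0))" B'] B'(1) by auto
    obtain A0 Q where AQ: "open A0" "open Q" "(0, (\<phi>0, z0)) \<in> A0 \<times> Q" "A0 \<times> Q \<subseteq> A"
      using open_prod_elim[OF A] by metis
    then have "(\<phi>0, z0) \<in> Q" by blast
    then obtain P R where PR: "open P" "open R" "(\<phi>0, z0) \<in> P \<times> R" "P \<times> R \<subseteq> Q"
      using open_prod_elim[OF AQ(2)] by metis
    obtain e where e: "e > 0" "cball 0 e \<subseteq> A0" using AQ(1,3) open_contains_cball by blast
    obtain r where r: "r > 0" "cball z0 r \<subseteq> R" using PR(2,3) open_contains_cball by blast
    have step: "prolong_segment t (\<phi>, z) \<in> B'" if "t \<in> {0..min e 1}" "\<phi> \<in> P" "z \<in> cball z0 r" for t \<phi> z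
    proof -
      have "t \<in> A0" using e(2) that(1) by (force simp: dist_real_def)
      moreover have "(\<phi>, z) \<in> Q" using PR(4) that(2,3) r(2) by blast
      ultimately have "(t, (\<phi>, z)) \<in> A" using AQ(4) by blast
      then show ?thesis using AB[of "(t, (\<phi>, z))"] that(1) by simp
    qed
    show ?thesis
    proof (intro exI conjI ballI)
      show "min e 1 > 0" "open P" "\<phi>0 \<in> P" "r > 0" using e(1) r(1) PR(1,3) by auto
    qed (rule step)
  qed
  obtain d1 P1 r where d1: "d1 > 0" "open P1" "\<phi>0 \<in> P1" "r > 0"
    and in_B: "\<forall>t\<in>{0..d1}. \<forall>\<phi>\<in>P1. \<forall>z\<in>cball z0 r. prolong_segment t (\<phi>, z) \<in> B"
    using near[OF B] by blast
  \<comment> \<open>With r / 4 at each time, the sup norm of the first iteration step remains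
    strictly below (1 - 1/2) * r.\<close>
  have B2: "open (U \<inter> f -` ball (f \<phi>0) (r / 4))"
    using continuous_open_preimage[OF hadamard_C1D(2)[OF f_C1] open_U open_ball] .
  have \<phi>0_B2: "\<phi>0 \<in> U \<inter> f -` ball (f \<phi>0) (r / 4)" using \<phi>0 d1(4) by simp
  obtain d2 P2 r2 where d2: "d2 > 0" "open P2" "\<phi>0 \<in> P2" "r2 > 0"
    and in_B2: "\<forall>t\<in>{0..d2}. \<forall>\<phi>\<in>P2. \<forall>z\<in>cball z0 r2.
      prolong_segment t (\<phi>, z) \<in> U \<inter> f -` ball (f \<phi>0) (r / 4)"
    using near[OF B2 \<phi>0_B2] by blast
  \<comment> \<open>With the factor 2 * h from \<open>c_seminorm_prolong_segment\<close>, the bound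
    1 / (4 * \<Lambda>) produces the contraction constant 1/2.\<close>
  define h where "h = min (min d1 d2) (1 / (4 * \<Lambda>))"
  have h: "h > 0" "h \<le> d1" "h \<le> d2" "h \<le> 1 / (4 * \<Lambda>)" using d1 d2 pos by (auto simp: h_def)
  then have h\<Lambda>: "\<Lambda> * (2 * h) \<le> 1 / 2" using pos(2) by (simp add: field_simps)
  define N where "N = P1 \<inter> P2"
  let ?c = "\<lambda>t. max 0 (min h t)"
  have im: "?c t \<in> {0..h}" for t using h by auto
  define Q where "Q = {u. \<forall>t\<in>{0..h}. prolong_segment t u \<in> U}"
  define \<Gamma> where "\<Gamma> = (\<lambda>u. Bcontfun (\<lambda>t. f (prolong_segment (?c t) u)))"
  define D\<Gamma> where "D\<Gamma> = (\<lambda>u v. Bcontfun (\<lambda>t. Df (prolong_segment (?c t) u) (prolong_segment (?c t) v)))"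
  have C1: "hadamard_C1 Q \<Gamma> D\<Gamma>"
    unfolding Q_def \<Gamma>_def D\<Gamma>_def
    using h(1) by (intro hadamard_C1_superposition[OF f_C1] linear_prolong_segment continuous_prolong_segment) auto
  have cont_seg: "continuous_on {0..h} (\<lambda>t. prolong_segment t u)" for u :: "'n c1_space \<times> (real \<Rightarrow>\<^sub>C (real ^ 'n))"
  proof -
    have "continuous_on {0..h} (\<lambda>t. (t, u))" by (intro continuous_intros)
    from continuous_on_compose2[OF continuous_prolong_segment[of h] this] show ?thesis by auto
  qed
  have \<Gamma>_apply: "apply_bcontfun (\<Gamma> u) t = f (prolong_segment (?c t) u)" if "u \<in> Q" for u t
  proof -
    have "continuous_on {0..h} (\<lambda>t. f (prolong_segment t u))"
      by (rule continuous_on_compose2[OF hadamard_C1D(2)[OF f_C1] cont_seg]) (use that Q_def in blast)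
    from apply_Bcontfun_clamp[OF this] h(1) show ?thesis unfolding \<Gamma>_def by simp
  qed
  have D\<Gamma>_apply: "apply_bcontfun (D\<Gamma> u v) t = Df (prolong_segment (?c t) u) (prolong_segment (?c t) v)"
    if "u \<in> Q" for u v t
  proof -
    have "continuous_on {0..h} (\<lambda>t. (prolong_segment t u, prolong_segment t v))"
      by (intro continuous_on_Pair cont_seg)
    moreover have "(\<lambda>t. (prolong_segment t u, prolong_segment t v)) ` {0..h} \<subseteq> U \<times> UNIV"
      using that unfolding Q_def by blast
    ultimately have "continuous_on {0..h} (\<lambda>t. Df (prolong_segment t u) (prolong_segment t v))"
      using continuous_on_compose2[OF hadamard_C1D(5)[OF f_C1], of "{0..h}" "\<lambda>t. (prolong_segment t u, prolong_segment t v)"]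
      by simp
    from apply_Bcontfun_clamp[OF this] h(1) show ?thesis unfolding D\<Gamma>_def by simp
  qed
  have in_BN: "prolong_segment t (\<phi>, z) \<in> B" if "t \<in> {0..h}" "\<phi> \<in> N" "z \<in> cball z0 r" for t \<phi> z
    using that h(2) by (intro in_B[rule_format]) (auto simp: N_def)
  have dom: "(\<phi>, z) \<in> Q" if "\<phi> \<in> N" "z \<in> cball z0 r" for \<phi> z
    using in_BN that BU unfolding Q_def B_def by blast
  obtain \<zeta> D\<zeta> where \<zeta>: "hadamard_C1 N \<zeta> D\<zeta>" "\<And>u. u \<in> N \<Longrightarrow> \<zeta> u \<in> ball z0 r"
    "\<And>u. u \<in> N \<Longrightarrow> \<Gamma> (u, \<zeta> u) = \<zeta> u" "\<And>u v. u \<in> N \<Longrightarrow> D\<zeta> u v = D\<Gamma> (u, \<zeta> u) (v, D\<zeta> u v)"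
  proof (rule parametrized_contraction[OF C1, of N "1 / 2" z0 r])
    show "open N" unfolding N_def using d1(2) d2(2) by blast
    show "(u, z) \<in> Q" if "u \<in> N" "z \<in> cball z0 r" for u z using dom that .
    show "norm (\<Gamma> (u, z) - \<Gamma> (u, z')) \<le> 1 / 2 * norm (z - z')"
      if u: "u \<in> N" and z: "z \<in> cball z0 r" "z' \<in> cball z0 r" for u z z'
    proof (rule norm_bound)
      fix t
      have "norm (f (prolong_segment (?c t) (u, z)) - f (prolong_segment (?c t) (u, z'))) \<le>
          \<Lambda> * c_seminorm j (c1_to_c (prolong_segment (?c t) (u, z) - prolong_segment (?c t) (u, z')))"
        using in_BN[OF im u z(1)] in_BN[OF im u z(2)] unfolding B_def by (intro lip) auto
      also have "prolong_segment (?c t) (u, z) - prolong_segment (?c t) (u, z') = prolong_segment (?c t) (0, z - z')"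
        using linear_diff[OF linear_prolong_segment, of "?c t" "(u, z)" "(u, z')"] by simp
      also have "\<Lambda> * c_seminorm j (c1_to_c (prolong_segment (?c t) (0, z - z'))) \<le> \<Lambda> * (2 * h * norm (z - z'))"
        using im[of t] pos(2) by (intro mult_left_mono c_seminorm_prolong_segment) auto
      also have "\<dots> = (\<Lambda> * (2 * h)) * norm (z - z')" by simp
      also have "\<dots> \<le> 1 / 2 * norm (z - z')" by (intro mult_right_mono h\<Lambda>) simp
      finally show "norm (apply_bcontfun (\<Gamma> (u, z) - \<Gamma> (u, z')) t) \<le> 1 / 2 * norm (z - z')"
        using dom[OF u z(1)] dom[OF u z(2)] by (simp only: minus_bcontfun.rep_eq \<Gamma>_apply)
    qed
    show "norm (\<Gamma> (u, z0) - z0) < (1 - 1 / 2) * r" if u: "u \<in> N" for u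
    proof -
      have "norm (\<Gamma> (u, z0) - z0) \<le> r / 4"
      proof (rule norm_bound)
        fix t
        have "prolong_segment (?c t) (u, z0) \<in> U \<inter> f -` ball (f \<phi>0) (r / 4)"
          using im[of t] h(3) u d2(4) by (intro in_B2[rule_format]) (auto simp: N_def)
        then have "norm (f (prolong_segment (?c t) (u, z0)) - f \<phi>0) \<le> r / 4"
          by (simp add: dist_norm norm_minus_commute)
        then show "norm (apply_bcontfun (\<Gamma> (u, z0) - z0) t) \<le> r / 4"
          using \<Gamma>_apply[OF dom[OF u, of z0]] d1(4) by (simp add: z0_def const_bcontfun.rep_eq)
      qed
      then show ?thesis using d1(4) by simp
    qed
  qed auto
  have Q\<zeta>: "(u, \<zeta> u) \<in> Q" if "u \<in> N" for u using dom[OF that] \<zeta>(2)[OF that] by simp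
  have c_id: "?c t = t" if "t \<in> {0..h}" for t using that by auto
  show thesis
  proof (rule that[OF h(1) _ \<zeta>(1)])
    show "\<phi>0 \<in> N" using d1(3) d2(3) by (simp add: N_def)
    show "prolong_segment t (\<phi>, \<zeta> \<phi>) \<in> U" if "\<phi> \<in> N" "t \<in> {0..h}" for \<phi> t
      using Q\<zeta>[OF that(1)] that(2) unfolding Q_def by blast
    from this[of _ 0] h(1) show "N \<subseteq> U" by (auto simp: prolong_segment_0)
    show "apply_bcontfun (\<zeta> \<phi>) t = f (prolong_segment t (\<phi>, \<zeta> \<phi>))" if "\<phi> \<in> N" "t \<in> {0..h}" for \<phi> t
      using \<Gamma>_apply[OF Q\<zeta>[OF that(1)], of t] \<zeta>(3)[OF that(1)] c_id[OF that(2)] by simp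
    show "apply_bcontfun (D\<zeta> \<phi> \<eta>) t = Df (prolong_segment t (\<phi>, \<zeta> \<phi>)) (prolong_segment t (\<eta>, D\<zeta> \<phi> \<eta>))"
      if "\<phi> \<in> N" "t \<in> {0..h}" for \<phi> t \<eta>
      using D\<Gamma>_apply[OF Q\<zeta>[OF that(1)], of "(\<eta>, D\<zeta> \<phi> \<eta>)" t] \<zeta>(4)[OF that(1), of \<eta>] c_id[OF that(2)] by simp
  qed
qed

lemma local_lipschitz_extended: "local_lipschitz_dde (\<lambda>t \<psi>. f \<psi> + c) (UNIV \<times> U)"
  unfolding local_lipschitz_dde_def
proof (intro allI impI)
  fix t0 :: real and \<psi>0 assume "(t0, \<psi>0) \<in> UNIV \<times> U"
  then have "\<psi>0 \<in> U" by simp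
  from property_e_lipschitz[OF open_U smooth prop_e this] obtain j \<epsilon> \<Lambda> where "\<epsilon> > 0" "\<Lambda> > 0"
    "\<And>\<psi> \<psi>'. c1_seminorm j (\<psi> - \<psi>0) < \<epsilon> \<Longrightarrow> c1_seminorm j (\<psi>' - \<psi>0) < \<epsilon> \<Longrightarrow>
      norm (f \<psi> - f \<psi>') \<le> \<Lambda> * c_seminorm j (c1_to_c (\<psi> - \<psi>'))" by metis
  then show "\<exists>\<delta>>0. \<exists>\<epsilon>>0. \<exists>j. \<exists>\<Lambda>>0. \<forall>t \<psi> \<psi>'. t0 \<le> t \<longrightarrow> t < t0 + \<delta> \<longrightarrow>
      (t, \<psi>) \<in> UNIV \<times> U \<longrightarrow> (t, \<psi>') \<in> UNIV \<times> U \<longrightarrow>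
      c1_seminorm j (\<psi> - \<psi>0) < \<epsilon> \<longrightarrow> c1_seminorm j (\<psi>' - \<psi>0) < \<epsilon> \<longrightarrow>
      norm ((f \<psi> + c) - (f \<psi>' + c)) \<le> \<Lambda> * c_seminorm j (c1_to_c (\<psi> - \<psi>'))"
    by (intro exI[of _ 1] exI[of _ \<epsilon>] exI[of _ j] exI[of _ \<Lambda>] conjI) auto
qed

text \<open>Property (e) bounds Df by a seminorm of C uniformly for base points near \<xi> t0, and
  \<xi> stays near \<xi> t0 for a short time.\<close>

lemma local_lipschitz_linear:
  assumes \<xi>: "\<xi> ` I \<subseteq> U" "continuous_on I \<xi>"
  shows "local_lipschitz_dde (\<lambda>t \<psi>. Df (\<xi> t) \<psi> + c) (I \<times> UNIV)"
  unfolding local_lipschitz_dde_def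
proof (intro allI impI)
  fix t0 :: real and \<psi>0 :: "'n c1_space" assume "(t0, \<psi>0) \<in> I \<times> UNIV"
  then have t0: "t0 \<in> I" "\<xi> t0 \<in> U" using \<xi>(1) by auto
  from property_e_lipschitz[OF open_U smooth prop_e this(2)] obtain j \<epsilon> \<Lambda> where pos: "\<epsilon> > 0" "\<Lambda> > 0"
    and sub: "{\<psi>. c1_seminorm j (\<psi> - \<xi> t0) < \<epsilon>} \<subseteq> U"
    and le: "\<And>\<psi> \<eta>. c1_seminorm j (\<psi> - \<xi> t0) < \<epsilon> \<Longrightarrow> norm (Df \<psi> \<eta>) \<le> \<Lambda> * c_seminorm j (c1_to_c \<eta>)" by metis
  have "(\<xi> \<longlongrightarrow> \<xi> t0) (at t0 within I)" using \<xi>(2) t0(1) unfolding continuous_on_def by blast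
  then have "((\<lambda>t. c1_seminorm j (\<xi> t - \<xi> t0)) \<longlongrightarrow> 0) (at t0 within I)"
    unfolding c1_space.tendsto_seminorm by blast
  from order_tendstoD(2)[OF this pos(1)]
  obtain \<delta> where \<delta>: "\<delta> > 0" "\<And>t. t \<in> I \<Longrightarrow> t \<noteq> t0 \<Longrightarrow> dist t t0 < \<delta> \<Longrightarrow> c1_seminorm j (\<xi> t - \<xi> t0) < \<epsilon>"
    unfolding eventually_at by blast
  have "norm ((Df (\<xi> t) \<psi> + c) - (Df (\<xi> t) \<psi>' + c)) \<le> \<Lambda> * c_seminorm j (c1_to_c (\<psi> - \<psi>'))"
    if "t0 \<le> t" "t < t0 + \<delta>" "t \<in> I" for t \<psi> \<psi>'
  proof -
    have "c1_seminorm j (\<xi> t - \<xi> t0) < \<epsilon>"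
      using \<delta>(2)[OF that(3)] that pos(1) by (cases "t = t0") (auto simp: c1_space.p_zero dist_real_def)
    then show ?thesis
      using le[of "\<xi> t" "\<psi> - \<psi>'"] linear_diff[OF hadamard_C1D(3)[OF f_C1], of "\<xi> t"] sub by auto
  qed
  then show "\<exists>\<delta>>0. \<exists>\<epsilon>>0. \<exists>j. \<exists>\<Lambda>>0. \<forall>t \<psi> \<psi>'. t0 \<le> t \<longrightarrow> t < t0 + \<delta> \<longrightarrow>
      (t, \<psi>) \<in> I \<times> UNIV \<longrightarrow> (t, \<psi>') \<in> I \<times> UNIV \<longrightarrow>
      c1_seminorm j (\<psi> - \<psi>0) < \<epsilon> \<longrightarrow> c1_seminorm j (\<psi>' - \<psi>0) < \<epsilon> \<longrightarrow>
      norm ((Df (\<xi> t) \<psi> + c) - (Df (\<xi> t) \<psi>' + c)) \<le> \<Lambda> * c_seminorm j (c1_to_c (\<psi> - \<psi>'))"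
    using \<delta>(1) pos by (intro exI[of _ \<delta>] exI[of _ \<epsilon>] exI[of _ j] exI[of _ \<Lambda>] conjI) auto
qed

section \<open>Trajectories of the extended equation and their semigroup property\<close>

definition extended_solution :: "real \<Rightarrow> 'n c1_space \<Rightarrow> (real \<Rightarrow> real ^ 'n) \<Rightarrow> bool"
  where "extended_solution T \<phi> x \<longleftrightarrow> left_solution (\<lambda>t \<psi>. f \<psi> + defect \<phi>) (UNIV \<times> U) \<phi> T x"

definition lifetimes :: "'n c1_space \<Rightarrow> real set"
  where "lifetimes \<phi> = {T. \<exists>x. extended_solution T \<phi> x}"

text \<open>A solution is chosen separately for each end time t and evaluated only there; uniqueness
  makes all these choices agree, so that no solution on the full interval has to be
  assembled.\<close>

definition trajectory :: "'n c1_space \<Rightarrow> real \<Rightarrow> real ^ 'n"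
  where "trajectory \<phi> t = (if t \<le> 0 then c1_fun \<phi> t else (SOME x. extended_solution t \<phi> x) t)"

definition ext_flow :: "real \<Rightarrow> 'n c1_space \<Rightarrow> 'n c1_space"
  where "ext_flow t \<phi> = c1_segment (trajectory \<phi>) t"

lemma trajectory_eq:
  assumes "extended_solution T \<phi> x" "t \<le> T"
  shows "trajectory \<phi> t = x t"
proof (cases "t \<le> 0")
  case True
  then show ?thesis using left_solutionD(2)[OF assms(1)[unfolded extended_solution_def]]
    by (simp add: trajectory_def)
next
  case False
  have x: "extended_solution t \<phi> x"
    using left_solution_mono[OF assms(1)[unfolded extended_solution_def], of t] False assms(2)
    unfolding extended_solution_def by simp
  then have "extended_solution t \<phi> (SOME x. extended_solution t \<phi> x)"
    by (rule someI[of "extended_solution t \<phi>"])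
  with x have "(SOME x. extended_solution t \<phi> x) t = x t"
    unfolding extended_solution_def using left_solution_unique[OF local_lipschitz_extended] by blast
  then show ?thesis using False by (simp add: trajectory_def)
qed

lemma trajectory_solution:
  assumes "T \<in> lifetimes \<phi>" shows "extended_solution T \<phi> (trajectory \<phi>)"
proof -
  obtain x where x: "extended_solution T \<phi> x" using assms unfolding lifetimes_def by blast
  show ?thesis
    using left_solution_cong[OF x[unfolded extended_solution_def]] trajectory_eq[OF x]
    unfolding extended_solution_def by simp
qed

lemma ext_flow_eq:
  assumes "extended_solution T \<phi> x" "t \<le> T" shows "ext_flow t \<phi> = c1_segment x t"
  unfolding ext_flow_def c1_segment_def
  using segment_cong[of t "trajectory \<phi>" x] trajectory_eq[OF assms(1)] assms(2) by simp

lemma lifetimes_mono: "T \<in> lifetimes \<phi> \<Longrightarrow> 0 \<le> t \<Longrightarrow> t \<le> T \<Longrightarrow> t \<in> lifetimes \<phi>"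
  unfolding lifetimes_def extended_solution_def using left_solution_mono by blast

lemma lifetimes_nonneg: "T \<in> lifetimes \<phi> \<Longrightarrow> 0 \<le> T"
  unfolding lifetimes_def extended_solution_def using left_solutionD(1) by blast

lemma ext_flow_in_U: "t \<in> lifetimes \<phi> \<Longrightarrow> ext_flow t \<phi> \<in> U"
  using left_solutionD(1,4)[OF trajectory_solution[unfolded extended_solution_def]]
  unfolding ext_flow_def by blast

text \<open>Conservation of the defect is the extended equation itself, read at the right end of the
  segment.\<close>

lemma defect_ext_flow:
  assumes "t \<in> lifetimes \<phi>" shows "defect (ext_flow t \<phi>) = defect \<phi>"
proof -
  note sol = trajectory_solution[OF assms, unfolded extended_solution_def]
  show ?thesis
    using left_solutionD(5)[OF sol left_solutionD(1)[OF sol] order.refl]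
      c1_fun_segment[OF left_solutionD(3)[OF sol order.refl]]
    unfolding ext_flow_def defect_def[of "c1_segment (trajectory \<phi>) t"] by simp
qed

lemma ext_flow_0:
  assumes "\<phi> \<in> U" shows "0 \<in> lifetimes \<phi>" "ext_flow 0 \<phi> = \<phi>"
proof -
  have seg: "segment (c1_fun \<phi>) 0 = c1_fun \<phi>" using segment_0[of \<phi> "c1_fun \<phi>"] by simp
  have sol: "extended_solution 0 \<phi> (c1_fun \<phi>)"
    unfolding extended_solution_def left_solution_def
    using assms c1_fun[of \<phi>] c1_segment_eqI[OF seg] by (simp add: seg defect_def)
  then show "0 \<in> lifetimes \<phi>" unfolding lifetimes_def by blast
  show "ext_flow 0 \<phi> = \<phi>" using ext_flow_eq[OF sol] c1_segment_eqI[OF seg] by simp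
qed

text \<open>The right hand side depends on the initial value through its defect. As the defect is
  conserved, restarting at time s continues the same equation.\<close>

lemma ext_flow_add:
  assumes s: "s \<in> lifetimes \<phi>" and r: "r \<in> lifetimes (ext_flow s \<phi>)"
  shows "s + r \<in> lifetimes \<phi>" "ext_flow (s + r) \<phi> = ext_flow r (ext_flow s \<phi>)"
proof -
  let ?y = "trajectory (ext_flow s \<phi>)"
  have y: "left_solution (\<lambda>t \<psi>. f \<psi> + defect \<phi>) (UNIV \<times> U) (c1_segment (trajectory \<phi>) s) r ?y"
    using trajectory_solution[OF r] defect_ext_flow[OF s]
    unfolding extended_solution_def ext_flow_def[of s \<phi>] by simp
  have F: "(s + t, \<psi>) \<in> UNIV \<times> U \<and> f \<psi> + defect \<phi> = f \<psi> + defect \<phi>"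
    if "(t, \<psi>) \<in> UNIV \<times> U" for t and \<psi> :: "'n c1_space" using that by simp
  note glue = left_solution_glue[OF trajectory_solution[OF s, unfolded extended_solution_def] y F]
  have sol: "extended_solution (s + r) \<phi> (\<lambda>t. ?y (t - s))"
    unfolding extended_solution_def by (rule glue(1))
  then show "s + r \<in> lifetimes \<phi>" unfolding lifetimes_def by blast
  show "ext_flow (s + r) \<phi> = ext_flow r (ext_flow s \<phi>)"
    using ext_flow_eq[OF sol order.refl] glue(3)[of r] unfolding ext_flow_def[of r] by simp
qed

section \<open>Flow boxes and their concatenation\<close>

text \<open>Collects what is carried from short to long times by concatenation. The constant
  \<open>linear_defect \<phi> \<eta>\<close> is the derivative of the term
  \<open>defect \<phi>\<close> of the extended equation, so V \<phi> \<eta> solves the variational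
  equation of the extended problem.\<close>

definition flow_box ::
    "real \<Rightarrow> 'n c1_space set \<Rightarrow> ('n c1_space \<Rightarrow> 'n c1_space \<Rightarrow> real \<Rightarrow> real ^ 'n) \<Rightarrow> bool"
  where "flow_box T N V \<longleftrightarrow> open N \<and> N \<subseteq> U \<and> (\<forall>\<phi>\<in>N. T \<in> lifetimes \<phi>) \<and>
    continuous_on ({0..T} \<times> N) (\<lambda>p. ext_flow (fst p) (snd p)) \<and>
    (\<forall>s\<in>{0..T}. hadamard_C1 N (ext_flow s) (\<lambda>\<phi> \<eta>. c1_segment (V \<phi> \<eta>) s)) \<and>
    (\<forall>\<phi>\<in>N. \<forall>\<eta>. left_solution (\<lambda>t \<psi>. Df (ext_flow t \<phi>) \<psi> + linear_defect \<phi> \<eta>) UNIV \<eta> T (V \<phi> \<eta>))"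

lemma flow_boxD:
  assumes "flow_box T N V"
  shows "open N" "N \<subseteq> U" "\<phi> \<in> N \<Longrightarrow> T \<in> lifetimes \<phi>"
    "continuous_on ({0..T} \<times> N) (\<lambda>p. ext_flow (fst p) (snd p))"
    "0 \<le> s \<Longrightarrow> s \<le> T \<Longrightarrow> hadamard_C1 N (ext_flow s) (\<lambda>\<phi> \<eta>. c1_segment (V \<phi> \<eta>) s)"
    "\<phi> \<in> N \<Longrightarrow> left_solution (\<lambda>t \<psi>. Df (ext_flow t \<phi>) \<psi> + linear_defect \<phi> \<eta>) UNIV \<eta> T (V \<phi> \<eta>)"
  using assms unfolding flow_box_def by auto

lemma flow_box_mono:
  assumes "flow_box T N V" "0 \<le> t" "t \<le> T"
  shows "flow_box t N V"
  unfolding flow_box_def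
proof (intro conjI ballI allI)
  show "continuous_on ({0..t} \<times> N) (\<lambda>p. ext_flow (fst p) (snd p))"
    using assms(3) by (intro continuous_on_subset[OF flow_boxD(4)[OF assms(1)]]) auto
  show "t \<in> lifetimes \<phi>" if "\<phi> \<in> N" for \<phi>
    using lifetimes_mono[OF flow_boxD(3)[OF assms(1) that] assms(2,3)] .
  show "left_solution (\<lambda>t \<psi>. Df (ext_flow t \<phi>) \<psi> + linear_defect \<phi> \<eta>) UNIV \<eta> t (V \<phi> \<eta>)"
    if "\<phi> \<in> N" for \<phi> \<eta>
    using left_solution_mono[OF flow_boxD(6)[OF assms(1) that] assms(2,3)] .
qed (use flow_boxD(1,2,5)[OF assms(1)] assms(3) in auto)

text \<open>On a short interval the flow is the linear map \<open>prolong_segment\<close> applied to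
  (\<phi>, \<zeta> \<phi>), so its regularity is that of \<zeta>.\<close>

lemma local_flow_box:
  assumes "\<phi>0 \<in> U"
  obtains h N V where "h > 0" "\<phi>0 \<in> N" "flow_box h N V"
proof -
  obtain h N \<zeta> D\<zeta> where h: "h > 0" and N: "\<phi>0 \<in> N" "N \<subseteq> U" and \<zeta>: "hadamard_C1 N \<zeta> D\<zeta>"
    and inU: "\<And>\<phi> t. \<phi> \<in> N \<Longrightarrow> t \<in> {0..h} \<Longrightarrow> prolong_segment t (\<phi>, \<zeta> \<phi>) \<in> U"
    and eq: "\<And>\<phi> t. \<phi> \<in> N \<Longrightarrow> t \<in> {0..h} \<Longrightarrow> apply_bcontfun (\<zeta> \<phi>) t = f (prolong_segment t (\<phi>, \<zeta> \<phi>))"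
    and lin: "\<And>\<phi> t \<eta>. \<phi> \<in> N \<Longrightarrow> t \<in> {0..h} \<Longrightarrow> apply_bcontfun (D\<zeta> \<phi> \<eta>) t =
      Df (prolong_segment t (\<phi>, \<zeta> \<phi>)) (prolong_segment t (\<eta>, D\<zeta> \<phi> \<eta>))"
    using local_prolongation[OF assms] by metis
  have h0: "0 \<in> {0..h}" using h by simp
  have seg: "c1_segment (prolong \<phi> z) t = prolong_segment t (\<phi>, z)" for \<phi> :: "'n c1_space" and z t
    by (simp add: prolong_segment_def)
  have half: "half_deriv (segment (prolong \<phi> z) t) 0 = half_deriv (c1_fun \<phi>) 0 + (z t - z 0)"
    if "0 \<le> t" for \<phi> :: "'n c1_space" and z t
    using that segment_prolong(2)[of 0 \<phi> z t] by (simp add: prolong_deriv_def)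
  have sol: "extended_solution h \<phi> (prolong \<phi> (\<zeta> \<phi>))" if "\<phi> \<in> N" for \<phi>
    unfolding extended_solution_def left_solution_def
    using h inU[OF that] eq[OF that h0] eq[OF that]
    by (auto simp: prolong_def[of _ _ s for s] segment_prolong(1) seg half defect_def prolong_segment_0)
  have flow: "ext_flow t \<phi> = prolong_segment t (\<phi>, \<zeta> \<phi>)" if "\<phi> \<in> N" "t \<in> {0..h}" for \<phi> t
    using ext_flow_eq[OF sol[OF that(1)], of t] that(2) by (simp add: seg)
  have "flow_box h N (\<lambda>\<phi> \<eta>. prolong \<eta> (D\<zeta> \<phi> \<eta>))"
    unfolding flow_box_def
  proof (intro conjI ballI allI)
    show "h \<in> lifetimes \<phi>" if "\<phi> \<in> N" for \<phi> using sol[OF that] unfolding lifetimes_def by blast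
    have "continuous_on ({0..h} \<times> N) (\<lambda>p. \<zeta> (snd p))"
      by (rule continuous_on_compose2[OF hadamard_C1D(2)[OF \<zeta>] continuous_on_snd[OF continuous_on_id]]) auto
    then have "continuous_on ({0..h} \<times> N) (\<lambda>p. (fst p, (snd p, \<zeta> (snd p))))"
      by (intro continuous_on_Pair continuous_intros)
    from continuous_on_compose2[OF continuous_prolong_segment[of h] this]
    have "continuous_on ({0..h} \<times> N) (\<lambda>p. prolong_segment (fst p) (snd p, \<zeta> (snd p)))"
      by (simp add: image_subset_iff mem_Times_iff)
    then show "continuous_on ({0..h} \<times> N) (\<lambda>p. ext_flow (fst p) (snd p))"
      by (rule continuous_on_eq) (auto simp: flow)
    show "hadamard_C1 N (ext_flow s) (\<lambda>\<phi> \<eta>. c1_segment (prolong \<eta> (D\<zeta> \<phi> \<eta>)) s)" if s: "s \<in> {0..h}" for s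
    proof -
      have "continuous_on UNIV (prolong_segment s)"
      proof -
        have "continuous_on UNIV (\<lambda>u. (s, u))" by (intro continuous_intros)
        from continuous_on_compose2[OF continuous_prolong_segment[of s] this] s show ?thesis
          by (simp add: image_subset_iff)
      qed
      from hadamard_C1_linear[OF linear_prolong_segment this]
      have S: "hadamard_C1 UNIV (prolong_segment s) (\<lambda>_. prolong_segment s)" .
      have "hadamard_C1 N (\<lambda>\<phi>. (\<phi>, \<zeta> \<phi>)) (\<lambda>\<phi> \<eta>. (\<eta>, D\<zeta> \<phi> \<eta>))"
        using hadamard_C1_linear[OF linear_id continuous_on_id']
        by (intro hadamard_C1_Pair[OF _ \<zeta>] hadamard_C1_subset[OF _ hadamard_C1D(1)[OF \<zeta>] subset_UNIV])
          (simp add: id_def)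
      from hadamard_C1_compose[OF this S]
      show ?thesis by (rule hadamard_C1_cong) (use s in \<open>auto simp: flow seg\<close>)
    qed
    show "left_solution (\<lambda>t \<psi>. Df (ext_flow t \<phi>) \<psi> + linear_defect \<phi> \<eta>) UNIV \<eta> h (prolong \<eta> (D\<zeta> \<phi> \<eta>))"
      if "\<phi> \<in> N" for \<phi> \<eta>
      unfolding left_solution_def
      using h lin[OF that h0] lin[OF that] flow[OF that]
      by (auto simp: prolong_def[of _ _ s for s] segment_prolong(1) seg half linear_defect_def prolong_segment_0)
  qed (use N hadamard_C1D(1)[OF \<zeta>] in auto)
  then show thesis using that h N(1) by blast
qed

text \<open>Beyond time s the flow is \<open>ext_flow t\<close> after \<open>ext_flow s\<close>. The
  chain rule gives smoothness, and its derivative is the segment of the concatenated variational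
  solution.\<close>

lemma flow_box_concat:
  assumes box: "flow_box s N V" "\<phi>0 \<in> N" "0 \<le> s" and box': "flow_box h N' V'" "ext_flow s \<phi>0 \<in> N'" "0 \<le> h"
  obtains M W where "\<phi>0 \<in> M" "flow_box (s + h) M W"
proof -
  define M where "M = N \<inter> ext_flow s -` N'"
  define W where "W \<phi> \<eta> = (\<lambda>t. V' (ext_flow s \<phi>) (c1_segment (V \<phi> \<eta>) s) (t - s))" for \<phi> \<eta>
  have Cs: "hadamard_C1 N (ext_flow s) (\<lambda>\<phi> \<eta>. c1_segment (V \<phi> \<eta>) s)" using flow_boxD(5)[OF box(1,3)] by simp
  have M: "open M" "M \<subseteq> N" "\<phi>0 \<in> M"
    unfolding M_def using continuous_open_preimage[OF hadamard_C1D(2)[OF Cs] flow_boxD(1)[OF box(1)] flow_boxD(1)[OF box'(1)]]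
      box(2) box'(2) by auto
  have MN': "ext_flow s \<phi> \<in> N'" if "\<phi> \<in> M" for \<phi> using that unfolding M_def by blast
  have add: "s + t \<in> lifetimes \<phi>" "ext_flow (s + t) \<phi> = ext_flow t (ext_flow s \<phi>)"
    if "\<phi> \<in> M" "0 \<le> t" "t \<le> h" for \<phi> t
    using ext_flow_add[OF flow_boxD(3)[OF box(1)] lifetimes_mono[OF flow_boxD(3)[OF box'(1) MN'[OF that(1)]] that(2,3)]]
      M(2) that(1) by auto
  have glue: "left_solution (\<lambda>t \<psi>. Df (ext_flow t \<phi>) \<psi> + linear_defect \<phi> \<eta>) UNIV \<eta> (s + h) (W \<phi> \<eta>)"
    "t \<le> s \<Longrightarrow> W \<phi> \<eta> t = V \<phi> \<eta> t"
    "c1_segment (W \<phi> \<eta>) (s + t) = c1_segment (V' (ext_flow s \<phi>) (c1_segment (V \<phi> \<eta>) s)) t"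
    if \<phi>: "\<phi> \<in> M" for \<phi> \<eta> t
  proof -
    note v = flow_boxD(6)[OF box(1) subsetD[OF M(2) \<phi>], of \<eta>]
    note v' = flow_boxD(6)[OF box'(1) MN'[OF \<phi>], of "c1_segment (V \<phi> \<eta>) s"]
    \<comment> \<open>The inhomogeneity is conserved along the variational equation, so both pieces
      solve the same equation.\<close>
    have "linear_defect (ext_flow s \<phi>) (c1_segment (V \<phi> \<eta>) s) = linear_defect \<phi> \<eta>"
      unfolding linear_defect_def[of "ext_flow s \<phi>"] c1_fun_segment[OF left_solutionD(3)[OF v order.refl]]
      using left_solutionD(5)[OF v box(3) order.refl] by simp
    then have F: "(s + t, \<psi>) \<in> UNIV \<and> Df (ext_flow t (ext_flow s \<phi>)) \<psi> + linear_defect (ext_flow s \<phi>) (c1_segment (V \<phi> \<eta>) s) =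
        Df (ext_flow (s + t) \<phi>) \<psi> + linear_defect \<phi> \<eta>" if "0 \<le> t" "t \<le> h" for t \<psi>
      using add(2)[OF \<phi> that] by simp
    note g = left_solution_glue[OF v v' F]
    show "left_solution (\<lambda>t \<psi>. Df (ext_flow t \<phi>) \<psi> + linear_defect \<phi> \<eta>) UNIV \<eta> (s + h) (W \<phi> \<eta>)"
      "t \<le> s \<Longrightarrow> W \<phi> \<eta> t = V \<phi> \<eta> t"
      "c1_segment (W \<phi> \<eta>) (s + t) = c1_segment (V' (ext_flow s \<phi>) (c1_segment (V \<phi> \<eta>) s)) t"
      unfolding W_def by (rule g; simp)+
  qed
  have "flow_box (s + h) M W"
    unfolding flow_box_def
  proof (intro conjI ballI allI)
    show "s + h \<in> lifetimes \<phi>" if "\<phi> \<in> M" for \<phi> using add(1)[OF that box'(3)] by simp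
    have "continuous_on ({0..s} \<times> M \<union> {s..s + h} \<times> M) (\<lambda>p. ext_flow (fst p) (snd p))"
    proof (rule continuous_on_Un_local)
      show "continuous_on ({0..s} \<times> M) (\<lambda>p. ext_flow (fst p) (snd p))"
        using M(2) by (intro continuous_on_subset[OF flow_boxD(4)[OF box(1)]]) auto
      have "continuous_on ({s..s + h} \<times> M) (\<lambda>p. ext_flow s (snd p))"
        by (rule continuous_on_compose2[OF hadamard_C1D(2)[OF Cs] continuous_on_snd[OF continuous_on_id]])
          (use M(2) in auto)
      then have "continuous_on ({s..s + h} \<times> M) (\<lambda>p. (fst p - s, ext_flow s (snd p)))"
        by (intro continuous_on_Pair continuous_intros)
      from continuous_on_compose2[OF flow_boxD(4)[OF box'(1)] this]
      have "continuous_on ({s..s + h} \<times> M) (\<lambda>p. ext_flow (fst p - s) (ext_flow s (snd p)))"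
        using MN' by (simp add: image_subset_iff mem_Times_iff)
      then show "continuous_on ({s..s + h} \<times> M) (\<lambda>p. ext_flow (fst p) (snd p))"
      proof (rule continuous_on_eq)
        fix p assume "p \<in> {s..s + h} \<times> M"
        then have "snd p \<in> M" "0 \<le> fst p - s" "fst p - s \<le> h" by auto
        from add(2)[OF this] show "ext_flow (fst p - s) (ext_flow s (snd p)) = ext_flow (fst p) (snd p)" by simp
      qed
      have "{0..s} \<times> M = ({0..s} \<times> M \<union> {s..s + h} \<times> M) \<inter> ({..s} \<times> UNIV)" using box(3) by auto
      then show "closedin (top_of_set ({0..s} \<times> M \<union> {s..s + h} \<times> M)) ({0..s} \<times> M)"
        unfolding closedin_closed using closed_Times[OF closed_atMost closed_UNIV] by blast
      have "{s..s + h} \<times> M = ({0..s} \<times> M \<union> {s..s + h} \<times> M) \<inter> ({s..} \<times> UNIV)" using box(3) box'(3) by auto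
      then show "closedin (top_of_set ({0..s} \<times> M \<union> {s..s + h} \<times> M)) ({s..s + h} \<times> M)"
        unfolding closedin_closed using closed_Times[OF closed_atLeast closed_UNIV] by blast
    qed
    moreover have "{0..s} \<times> M \<union> {s..s + h} \<times> M = {0..s + h} \<times> M" using box(3) box'(3) by auto
    ultimately show "continuous_on ({0..s + h} \<times> M) (\<lambda>p. ext_flow (fst p) (snd p))" by simp
    show "hadamard_C1 M (ext_flow r) (\<lambda>\<phi> \<eta>. c1_segment (W \<phi> \<eta>) r)" if r: "r \<in> {0..s + h}" for r
    proof (cases "r \<le> s")
      case True
      have "hadamard_C1 M (ext_flow r) (\<lambda>\<phi> \<eta>. c1_segment (V \<phi> \<eta>) r)"
        using flow_boxD(5)[OF box(1)] True r by (intro hadamard_C1_subset[OF _ M(1,2)]) auto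
      moreover have "c1_segment (V \<phi> \<eta>) r = c1_segment (W \<phi> \<eta>) r" if "\<phi> \<in> M" for \<phi> \<eta>
        using segment_cong[of r "V \<phi> \<eta>" "W \<phi> \<eta>"] glue(2)[OF that] True by (simp add: c1_segment_def)
      ultimately show ?thesis by (rule hadamard_C1_cong[OF _ refl])
    next
      case False
      then have t: "0 \<le> r - s" "r - s \<le> h" using r by auto
      from hadamard_C1_compose[OF hadamard_C1_subset[OF Cs M(1,2)] flow_boxD(5)[OF box'(1) t]]
      have "hadamard_C1 M (ext_flow (r - s) \<circ> ext_flow s)
          (\<lambda>\<phi> \<eta>. c1_segment (V' (ext_flow s \<phi>) (c1_segment (V \<phi> \<eta>) s)) (r - s))"
        using MN' by blast
      then show ?thesis
      proof (rule hadamard_C1_cong)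
        show "(ext_flow (r - s) \<circ> ext_flow s) \<phi> = ext_flow r \<phi>" if "\<phi> \<in> M" for \<phi>
          using add(2)[OF that t] by simp
        show "c1_segment (V' (ext_flow s \<phi>) (c1_segment (V \<phi> \<eta>) s)) (r - s) = c1_segment (W \<phi> \<eta>) r"
          if "\<phi> \<in> M" for \<phi> \<eta>
          using glue(3)[OF that, of \<eta> "r - s"] by simp
      qed
    qed
  qed (use M flow_boxD(2)[OF box(1)] glue(1) in auto)
  then show thesis using that M(3) by blast
qed

text \<open>Let s be the supremum of the times up to T reached by boxes around \<phi>0. A local box
  around the state at time s, attached to a box that ends shortly before s, leads beyond s. Reaching
  strictly beyond T also shows that lifetimes can be prolonged.\<close>

lemma flow_box_exists:
  assumes \<phi>0: "\<phi>0 \<in> U" and T: "T \<in> lifetimes \<phi>0"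
  obtains T' N V where "T < T'" "\<phi>0 \<in> N" "flow_box T' N V"
proof -
  define A where "A = {s\<in>{0..T}. \<exists>N V. \<phi>0 \<in> N \<and> flow_box s N V}"
  have T0: "0 \<le> T" using lifetimes_nonneg[OF T] .
  obtain h0 N0 V0 where h0: "h0 > 0" "\<phi>0 \<in> N0" "flow_box h0 N0 V0" using local_flow_box[OF \<phi>0] .
  have A0: "0 \<in> A" unfolding A_def using T0 h0 flow_box_mono[OF h0(3), of 0] by auto
  have bdd: "bdd_above A" unfolding A_def by auto
  define s where "s = Sup A"
  have s: "0 \<le> s" "s \<le> T"
    unfolding s_def using cSup_upper[OF A0 bdd] A0 by (auto intro!: cSup_least simp: A_def)
  have "ext_flow s \<phi>0 \<in> U" by (intro ext_flow_in_U lifetimes_mono[OF T s])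
  then obtain h N1 V1 where h: "h > 0" "ext_flow s \<phi>0 \<in> N1" "flow_box h N1 V1" using local_flow_box by blast
  have "((\<lambda>r. ext_flow r \<phi>0) \<longlongrightarrow> ext_flow s \<phi>0) (at s within {..s})"
    unfolding ext_flow_def
    using left_solutionD(3)[OF trajectory_solution[OF T, unfolded extended_solution_def] s(2)]
    by (intro c1_segment_tendsto[of _ s]) (auto simp: eventually_at_filter)
  from topological_tendstoD[OF this flow_boxD(1)[OF h(3)] h(2)]
  obtain d where d: "d > 0" "\<And>r. r \<le> s \<Longrightarrow> r \<noteq> s \<Longrightarrow> dist r s < d \<Longrightarrow> ext_flow r \<phi>0 \<in> N1"
    unfolding eventually_at by auto
  \<comment> \<open>Distance less than d places the state at time a in the local box, and distance
    less than h makes a + h exceed s.\<close>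
  have "s - min d h < Sup A" using d(1) h(1) unfolding s_def by simp
  then obtain a where a: "a \<in> A" "s - min d h < a" using less_cSupD[of A] A0 by blast
  have as: "a \<le> s" unfolding s_def by (rule cSup_upper[OF a(1) bdd])
  have aN1: "ext_flow a \<phi>0 \<in> N1" using d(2)[OF as] h(2) a(2) as by (cases "a = s") (auto simp: dist_real_def)
  obtain N V where NV: "\<phi>0 \<in> N" "flow_box a N V" "0 \<le> a" using a(1) unfolding A_def by auto
  obtain M W where MW: "\<phi>0 \<in> M" "flow_box (a + h) M W"
    using flow_box_concat[OF NV(2,1,3) h(3) aN1 less_imp_le[OF h(1)]] .
  have gt: "s < a + h" using a(2) by simp
  have "\<not> s < T"
  proof
    assume "s < T"
    have "flow_box (min (a + h) T) M W" using gt s T0 by (intro flow_box_mono[OF MW(2)]) auto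
    then have "min (a + h) T \<in> A" unfolding A_def using MW(1) gt s T0 by auto
    then have "min (a + h) T \<le> s" unfolding s_def using bdd by (rule cSup_upper)
    then show False using gt \<open>s < T\<close> by simp
  qed
  then have "T < a + h" using gt s by simp
  then show thesis using that MW by blast
qed

lemma lifetimes_open:
  assumes "\<phi> \<in> U" "T \<in> lifetimes \<phi>" shows "\<exists>T'>T. T' \<in> lifetimes \<phi>"
  using flow_box_exists[OF assms] flow_boxD(3) by metis

section \<open>Smoothness and continuity on the whole domain, and the variational solution\<close>

definition time_domain :: "real \<Rightarrow> 'n c1_space set"
  where "time_domain t = {\<phi>\<in>U. t \<in> lifetimes \<phi>}"

lemma flow_box_time_domain:
  assumes "flow_box T N V" "0 \<le> t" "t \<le> T" shows "N \<subseteq> time_domain t"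
  unfolding time_domain_def using flow_boxD(2,3)[OF assms(1)] lifetimes_mono assms(2,3) by blast

text \<open>Stated with \<open>dir_deriv\<close> because the V of a box depends on the box, whereas
  a global derivative has to be the same on overlapping boxes.\<close>

lemma ext_flow_C1:
  assumes t: "0 \<le> t"
  shows "hadamard_C1 (time_domain t) (ext_flow t) (dir_deriv (ext_flow t))"
proof (rule hadamard_C1_local)
  fix \<phi> assume "\<phi> \<in> time_domain t"
  then have "\<phi> \<in> U" "t \<in> lifetimes \<phi>" unfolding time_domain_def by auto
  then obtain T N V where T: "t < T" "\<phi> \<in> N" "flow_box T N V" using flow_box_exists by blast
  have "hadamard_C1 N (ext_flow t) (dir_deriv (ext_flow t))"
    using hadamard_C1_dir_deriv[OF flow_boxD(5)[OF T(3) t]] T(1) by simp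
  moreover have "N \<subseteq> time_domain t" using flow_box_time_domain[OF T(3) t] T(1) by simp
  ultimately show "\<exists>N. \<phi> \<in> N \<and> N \<subseteq> time_domain t \<and> hadamard_C1 N (ext_flow t) (dir_deriv (ext_flow t))"
    using T(2) by blast
qed

lemma continuous_ext_flow:
  "continuous_on {p. snd p \<in> U \<and> fst p \<in> lifetimes (snd p)} (\<lambda>p. ext_flow (fst p) (snd p))"
  (is "continuous_on ?\<Omega> ?\<Phi>")
  unfolding continuous_on_def
proof
  fix p assume p: "p \<in> ?\<Omega>"
  then obtain T N V where T: "fst p < T" "snd p \<in> N" "flow_box T N V" using flow_box_exists by blast
  have p0: "0 \<le> fst p" using p lifetimes_nonneg by blast
  have "p \<in> {0..T} \<times> N" using T p0 by (simp add: mem_Times_iff)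
  then have "(?\<Phi> \<longlongrightarrow> ?\<Phi> p) (at p within {0..T} \<times> N)"
    using flow_boxD(4)[OF T(3)] unfolding continuous_on_def by (rule bspec[rotated])
  \<comment> \<open>The interval [0, T] is no neighbourhood of 0 in the real line, so the times
    below T are used to localize; within the domain all times are nonnegative anyway.\<close>
  moreover have "at p within ?\<Omega> = at p within ?\<Omega> \<inter> ({..<T} \<times> N)"
    by (rule at_within_nhd[of p "{..<T} \<times> N"]) (use T flow_boxD(1)[OF T(3)] in \<open>auto simp: mem_Times_iff open_Times\<close>)
  moreover have "at p within ?\<Omega> \<inter> ({..<T} \<times> N) \<le> at p within {0..T} \<times> N"
    by (rule at_le) (use lifetimes_nonneg in \<open>auto simp: less_imp_le\<close>)
  ultimately show "(?\<Phi> \<longlongrightarrow> ?\<Phi> p) (at p within ?\<Omega>)" by (simp add: tendsto_mono)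
qed

text \<open>For t > 0 the value is the right end of the derivative of the time-t map, which makes it
  independent of any box. On each box it coincides with V because directional derivatives are
  unique.\<close>

definition variation :: "'n c1_space \<Rightarrow> 'n c1_space \<Rightarrow> real \<Rightarrow> real ^ 'n"
  where "variation \<phi> \<eta> t = (if t \<le> 0 then c1_fun \<eta> t else c1_fun (dir_deriv (ext_flow t) \<phi> \<eta>) 0)"

lemma variation_solution:
  assumes \<phi>: "\<phi> \<in> U" and T: "T \<in> lifetimes \<phi>"
  shows "left_solution (\<lambda>t \<psi>. Df (ext_flow t \<phi>) \<psi> + linear_defect \<phi> \<eta>) UNIV \<eta> T (variation \<phi> \<eta>)"
    and "c1_segment (variation \<phi> \<eta>) T = dir_deriv (ext_flow T) \<phi> \<eta>"
proof -
  obtain T' N V where T': "T < T'" "\<phi> \<in> N" "flow_box T' N V" using flow_box_exists[OF assms] .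
  have T0: "0 \<le> T" using lifetimes_nonneg[OF T] .
  note sol = flow_boxD(6)[OF T'(3,2), of \<eta>]
  have deriv: "dir_deriv (ext_flow t) \<phi> \<eta> = c1_segment (V \<phi> \<eta>) t" if "0 \<le> t" "t \<le> T'" for t
    using has_dir_deriv_eq[OF hadamard_deriv_imp_dir[OF hadamard_C1D(4)[OF flow_boxD(5)[OF T'(3) that] T'(2)]]] .
  have eq: "V \<phi> \<eta> t = variation \<phi> \<eta> t" if "t \<le> T'" for t
  proof (cases "t \<le> 0")
    case True
    then show ?thesis using left_solutionD(2)[OF sol] by (simp add: variation_def)
  next
    case False
    then show ?thesis using deriv[of t] that
      by (simp add: variation_def c1_fun_segment[OF left_solutionD(3)[OF sol that]] segment_def)
  qed
  from left_solution_mono[OF left_solution_cong[OF sol eq] T0] T'(1)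
  show "left_solution (\<lambda>t \<psi>. Df (ext_flow t \<phi>) \<psi> + linear_defect \<phi> \<eta>) UNIV \<eta> T (variation \<phi> \<eta>)" by simp
  show "c1_segment (variation \<phi> \<eta>) T = dir_deriv (ext_flow T) \<phi> \<eta>"
    using segment_cong[of T "V \<phi> \<eta>" "variation \<phi> \<eta>"] eq T'(1) deriv[OF T0] by (simp add: c1_segment_def)
qed

section \<open>Charts of the solution manifold\<close>

lemma solution_manifold_iff: "\<phi> \<in> solution_manifold f U \<longleftrightarrow> \<phi> \<in> U \<and> defect \<phi> = 0"
  unfolding solution_manifold_def defect_def by auto

text \<open>
  With $L$ a sufficiently small ramp, $K(\phi)=\phi-L\,f(\phi)$ straightens the solution manifold,
  as $K(\phi)'(0)=\phi'(0)-f(\phi)$. Inverting $K$ at $\psi$ means solving $c=f(\psi+Lc)$ for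
  $c\in\mathbb{R}^n$, and property (e) makes the right hand side a contraction.
\<close>

lemma solution_manifold_chart:
  assumes Q: "open Q" and m: "m \<in> solution_manifold f U \<inter> Q"
  obtains V W K where "m \<in> V"
    "submanifold_chart {\<phi>. initial_slope \<phi> = 0} (solution_manifold f U \<inter> Q) V W K"
proof -
  have mU: "m \<in> U" using m unfolding solution_manifold_def by blast
  obtain j \<epsilon> \<Lambda> where pos: "\<epsilon> > 0" "\<Lambda> > 0" and BU: "{\<psi>. c1_seminorm j (\<psi> - m) < \<epsilon>} \<subseteq> U"
    and lip: "\<And>\<psi> \<psi>'. c1_seminorm j (\<psi> - m) < \<epsilon> \<Longrightarrow> c1_seminorm j (\<psi>' - m) < \<epsilon> \<Longrightarrow>
      norm (f \<psi> - f \<psi>') \<le> \<Lambda> * c_seminorm j (c1_to_c (\<psi> - \<psi>'))"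
    using property_e_lipschitz[OF open_U smooth prop_e mU] by metis
  define B where "B = {\<psi>. c1_seminorm j (\<psi> - m) < \<epsilon>}"
  have B: "open B" "m \<in> B" unfolding B_def using pos by (auto intro: c1_space.open_ball simp: c1_space.p_zero)
  \<comment> \<open>In C the ramp has size at most 1 / (2 * \<Lambda>) times its slope, so c to f
    (\<psi> + L c) contracts with constant 1/2.\<close>
  define L :: "real ^ 'n \<Rightarrow> 'n c1_space" where "L = sine_ramp (1 / (2 * \<Lambda>))"
  have \<Lambda>': "1 / (2 * \<Lambda>) > 0" using pos by simp
  have L: "linear L" "continuous_on UNIV L" "\<And>c. initial_slope (L c) = c"
    "\<And>c. c_seminorm j (c1_to_c (L c)) \<le> 1 / (2 * \<Lambda>) * norm c"
    unfolding L_def using linear_sine_ramp[OF \<Lambda>'] continuous_sine_ramp[OF \<Lambda>']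
      initial_slope_sine_ramp[OF \<Lambda>'] c_seminorm_sine_ramp[OF \<Lambda>'] by auto
  define S where "S p = fst p + L (snd p)" for p
  have S_lin: "linear S"
    unfolding S_def by (rule linearI) (simp_all add: linear_add[OF L(1)] linear_cmul[OF L(1)] algebra_simps)
  have S_cont: "continuous_on UNIV S"
    unfolding S_def
    by (intro continuous_on_nhdsI tendsto_add tendsto_fst filterlim_ident
        filterlim_compose[OF continuous_on_open_nhds[OF L(2)]] tendsto_snd) auto
  \<comment> \<open>c0 and \<psi>0 are chosen such that \<psi>0 = K m and c0 is the fixed point
    belonging to \<psi>0.\<close>
  define c0 where "c0 = f m"
  define \<psi>0 where "\<psi>0 = m - L c0"
  have "open (S -` B)" using S_cont B(1) by (simp add: continuous_on_open_vimage)
  moreover have "(\<psi>0, c0) \<in> S -` B" using B(2) by (simp add: S_def \<psi>0_def)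
  ultimately obtain P R where PR: "open P" "open R" "(\<psi>0, c0) \<in> P \<times> R" "P \<times> R \<subseteq> S -` B"
    using open_prod_elim by metis
  obtain r where r: "r > 0" "cball c0 r \<subseteq> R" using PR(2,3) open_contains_cball by blast
  have fB: "open (U \<inter> f -` ball c0 (r / 2))"
    using continuous_open_preimage[OF hadamard_C1D(2)[OF f_C1] open_U open_ball] .
  have cont_sh: "continuous_on UNIV (\<lambda>\<psi>. \<psi> + L c0)"
    by (intro continuous_on_nhdsI tendsto_add tendsto_const filterlim_ident)
  \<comment> \<open>The radius r / 2 equals (1 - 1/2) * r, the bound required of the first iteration
    step.\<close>
  define N where "N = P \<inter> (\<lambda>\<psi>. \<psi> + L c0) -` (U \<inter> f -` ball c0 (r / 2))"
  have N: "open N" "\<psi>0 \<in> N"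
    unfolding N_def using PR(1,3) open_vimage[OF fB cont_sh] mU r(1)
    by (auto simp: \<psi>0_def c0_def)
  have SB: "S (\<psi>, c) \<in> B" if "\<psi> \<in> N" "c \<in> cball c0 r" for \<psi> c
    using that PR(4) r(2) unfolding N_def by blast
  have C1: "hadamard_C1 (S -` B) (f \<circ> S) (\<lambda>u v. Df (S u) (S v))"
    using hadamard_C1_compose[OF hadamard_C1_subset[OF hadamard_C1_linear[OF S_lin S_cont] \<open>open (S -` B)\<close> subset_UNIV] f_C1]
      BU unfolding B_def by blast
  obtain \<zeta> D\<zeta> where \<zeta>: "hadamard_C1 N \<zeta> D\<zeta>" "\<And>\<psi>. \<psi> \<in> N \<Longrightarrow> \<zeta> \<psi> \<in> ball c0 r"
    "\<And>\<psi>. \<psi> \<in> N \<Longrightarrow> (f \<circ> S) (\<psi>, \<zeta> \<psi>) = \<zeta> \<psi>"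
    "\<And>\<psi> c. \<psi> \<in> N \<Longrightarrow> c \<in> cball c0 r \<Longrightarrow> (f \<circ> S) (\<psi>, c) = c \<Longrightarrow> c = \<zeta> \<psi>"
  proof (rule parametrized_contraction[OF C1 N(1), of "1 / 2" c0 r])
    show "(\<psi>, c) \<in> S -` B" if "\<psi> \<in> N" "c \<in> cball c0 r" for \<psi> c using SB[OF that] by simp
    show "norm ((f \<circ> S) (\<psi>, c) - (f \<circ> S) (\<psi>, c')) \<le> 1 / 2 * norm (c - c')"
      if "\<psi> \<in> N" "c \<in> cball c0 r" "c' \<in> cball c0 r" for \<psi> c c'
    proof -
      have "norm (f (S (\<psi>, c)) - f (S (\<psi>, c'))) \<le> \<Lambda> * c_seminorm j (c1_to_c (S (\<psi>, c) - S (\<psi>, c')))"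
        using SB[OF that(1,2)] SB[OF that(1,3)] unfolding B_def by (intro lip) auto
      also have "S (\<psi>, c) - S (\<psi>, c') = L (c - c')" by (simp add: S_def linear_diff[OF L(1)])
      also have "\<Lambda> * c_seminorm j (c1_to_c (L (c - c'))) \<le> \<Lambda> * (1 / (2 * \<Lambda>) * norm (c - c'))"
        using pos(2) by (intro mult_left_mono L(4)) auto
      also have "\<dots> = 1 / 2 * norm (c - c')" using pos(2) by simp
      finally show ?thesis by simp
    qed
    show "norm ((f \<circ> S) (\<psi>, c0) - c0) < (1 - 1 / 2) * r" if "\<psi> \<in> N" for \<psi>
      using that unfolding N_def by (simp add: S_def dist_norm norm_minus_commute)
  qed auto
  define k where "k \<psi> = \<psi> + L (\<zeta> \<psi>)" for \<psi>
  have kS: "k \<psi> = S (\<psi>, \<zeta> \<psi>)" for \<psi> by (simp add: k_def S_def)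
  have k_C1: "hadamard_C1 N k (\<lambda>\<psi> \<eta>. \<eta> + L (D\<zeta> \<psi> \<eta>))"
    unfolding k_def
    by (rule hadamard_C1_add[OF hadamard_C1_id[OF N(1)] hadamard_C1_linear_compose[OF \<zeta>(1) L(1,2)]])
  define K where "K \<phi> = \<phi> + L (- f \<phi>)" for \<phi>
  have "hadamard_C1 U (\<lambda>\<phi>. - f \<phi>) (\<lambda>\<phi> \<eta>. - Df \<phi> \<eta>)"
    by (rule hadamard_C1_linear_compose[OF f_C1]) (auto intro: linearI continuous_intros)
  from hadamard_C1_add[OF hadamard_C1_id[OF open_U] hadamard_C1_linear_compose[OF this L(1,2)]]
  have K_C1: "hadamard_C1 U K (\<lambda>\<phi> \<eta>. \<eta> + L (- Df \<phi> \<eta>))"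
    unfolding K_def .
  have kU: "k \<psi> \<in> U" if "\<psi> \<in> N" for \<psi>
    using SB[OF that, of "\<zeta> \<psi>"] \<zeta>(2)[OF that] BU unfolding kS B_def by auto
  have fk: "f (k \<psi>) = \<zeta> \<psi>" if "\<psi> \<in> N" for \<psi> using \<zeta>(3)[OF that] by (simp add: kS)
  have Kk: "K (k \<psi>) = \<psi>" if "\<psi> \<in> N" for \<psi>
    unfolding K_def fk[OF that] by (simp add: k_def linear_neg[OF L(1)])
  have kK: "k (K \<phi>) = \<phi>" if "K \<phi> \<in> N" "f \<phi> \<in> ball c0 r" for \<phi>
  proof -
    have "S (K \<phi>, f \<phi>) = \<phi>" by (simp add: S_def K_def linear_neg[OF L(1)])
    then have "f \<phi> = \<zeta> (K \<phi>)" using that by (intro \<zeta>(4)) auto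
    then show ?thesis unfolding k_def by (simp add: K_def linear_neg[OF L(1)])
  qed
  \<comment> \<open>The restriction on f \<phi> makes f \<phi> the unique fixed point belonging to K
    \<phi>, so that k inverts K.\<close>
  define V where "V = (U \<inter> K -` N) \<inter> (U \<inter> f -` ball c0 r) \<inter> Q"
  define W where "W = N \<inter> k -` Q"
  have V: "open V" "V \<subseteq> U"
    unfolding V_def using Q continuous_open_preimage[OF hadamard_C1D(2)[OF K_C1] open_U N(1)]
      continuous_open_preimage[OF hadamard_C1D(2)[OF f_C1] open_U open_ball[of c0 r]] by auto
  have W: "open W" "W \<subseteq> N"
    unfolding W_def using continuous_open_preimage[OF hadamard_C1D(2)[OF k_C1] N(1) Q] by auto
  have KV: "K \<phi> \<in> W" "k (K \<phi>) = \<phi>" if "\<phi> \<in> V" for \<phi>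
    using that kK[of \<phi>] unfolding V_def W_def by auto
  have kW: "k \<psi> \<in> V" "K (k \<psi>) = \<psi>" if "\<psi> \<in> W" for \<psi>
    using that kU[of \<psi>] Kk[of \<psi>] fk[of \<psi>] \<zeta>(2)[of \<psi>] unfolding V_def W_def by auto
  have bij: "bij_betw K V W" by (rule bij_betw_byWitness[of V k]) (use KV kW in auto)
  have inv: "inv_into V K \<psi> = k \<psi>" if "\<psi> \<in> W" for \<psi>
    using inv_into_f_eq[OF bij_betw_imp_inj_on[OF bij] kW[OF that]] .
  have "hadamard_C1 W (inv_into V K) (\<lambda>\<psi> \<eta>. \<eta> + L (D\<zeta> \<psi> \<eta>))"
    by (rule hadamard_C1_cong[OF hadamard_C1_subset[OF k_C1 W]]) (simp_all add: inv)
  then have "C1F_diffeo V W K"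
    unfolding C1F_diffeo_def using bij C1F_on_UNIVI[OF hadamard_C1_subset[OF K_C1 V]] C1F_on_UNIVI by blast
  moreover have slope: "initial_slope (K \<phi>) = defect \<phi>" for \<phi>
    unfolding K_def linear_add[OF linear_initial_slope] L(3) by (simp add: defect_def initial_slope_def)
  have "K ` (solution_manifold f U \<inter> Q \<inter> V) = W \<inter> {\<phi>. initial_slope \<phi> = 0}"
  proof (intro equalityI subsetI)
    fix \<psi> assume "\<psi> \<in> K ` (solution_manifold f U \<inter> Q \<inter> V)"
    then show "\<psi> \<in> W \<inter> {\<phi>. initial_slope \<phi> = 0}" using KV(1) by (auto simp: slope solution_manifold_iff)
  next
    fix \<psi> assume \<psi>: "\<psi> \<in> W \<inter> {\<phi>. initial_slope \<phi> = 0}"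
    then have k: "k \<psi> \<in> V" "K (k \<psi>) = \<psi>" using kW by auto
    then have "k \<psi> \<in> solution_manifold f U \<inter> Q \<inter> V"
      using \<psi> slope[of "k \<psi>"] V(2) by (auto simp: solution_manifold_iff V_def)
    then show "\<psi> \<in> K ` (solution_manifold f U \<inter> Q \<inter> V)" using k(2) by (intro image_eqI[of _ _ "k \<psi>"]) auto
  qed
  ultimately have "submanifold_chart {\<phi>. initial_slope \<phi> = 0} (solution_manifold f U \<inter> Q) V W K"
    unfolding submanifold_chart_def by blast
  moreover have "m \<in> V"
  proof -
    have "K m = \<psi>0" by (simp add: K_def \<psi>0_def c0_def linear_neg[OF L(1)])
    then show ?thesis using mU N(2) r(1) m unfolding V_def by (auto simp: c0_def)
  qed
  ultimately show thesis using that by blast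
qed

text \<open>The set Q is included because a time map lives on a relatively open part of the solution
  manifold, and smoothness there refers to charts of that part.\<close>

lemma C1F_submanifold_solution_manifold:
  "open Q \<Longrightarrow> C1F_submanifold {\<phi>. initial_slope \<phi> = 0} (solution_manifold f U \<inter> Q)"
  unfolding C1F_submanifold_def using closed_complemented_slope solution_manifold_chart by metis

section \<open>The semiflow on the solution manifold\<close>

text \<open>Along a curve in the solution manifold \<open>initial_slope\<close> and f coincide; both
  compositions are differentiated at 0.\<close>

lemma slope_tangent:
  assumes \<phi>: "\<phi> \<in> solution_manifold f U" and \<eta>: "\<eta> \<in> tangent_space (solution_manifold f U) \<phi>"
  shows "linear_defect \<phi> \<eta> = 0"
proof -
  obtain c where "C1_curve (solution_manifold f U) \<phi> \<eta> c" using \<eta> unfolding tangent_space_def by blast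
  then obtain J where J: "open J" "0 \<in> J" "c ` J \<subseteq> solution_manifold f U"
    and c: "has_dir_deriv c 0 1 \<eta>" "c 0 = \<phi>"
    unfolding C1_curve_def by auto
  have \<phi>U: "\<phi> \<in> U" using \<phi> unfolding solution_manifold_def by blast
  have 1: "has_dir_deriv (f \<circ> c) 0 1 (Df \<phi> \<eta>)"
    using has_dir_deriv_compose[OF _ c(1)] hadamard_C1D(4)[OF f_C1 \<phi>U] c(2) by blast
  have "has_dir_deriv (initial_slope \<circ> c) 0 1 (initial_slope \<eta>)"
    using has_dir_deriv_compose[OF _ c(1)]
      hadamard_C1D(4)[OF hadamard_C1_linear[OF linear_initial_slope continuous_initial_slope]] by blast
  then have "has_dir_deriv (f \<circ> c) 0 1 (initial_slope \<eta>)"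
  proof (rule has_dir_deriv_cong[where G = UNIV and U = J])
    show "(initial_slope \<circ> c) x = (f \<circ> c) x" if "x \<in> J" for x
      using J(3) that unfolding solution_manifold_def initial_slope_def by auto
  qed (use J in auto)
  with 1 have "Df \<phi> \<eta> = initial_slope \<eta>" using has_dir_deriv_eq by metis
  then show ?thesis by (simp add: linear_defect_def initial_slope_def)
qed

section \<open>Identification of the extended flow with the semiflow on the manifold\<close>

definition life :: "'n c1_space \<Rightarrow> ereal"
  where "life \<phi> = (SUP t\<in>lifetimes \<phi>. ereal t)"

text \<open>Lifetimes can always be prolonged a little, so the supremum is not attained.\<close>

lemma less_life_iff:
  assumes "\<phi> \<in> U" "0 \<le> t" shows "ereal t < life \<phi> \<longleftrightarrow> t \<in> lifetimes \<phi>"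
proof
  assume "ereal t < life \<phi>"
  then obtain s where "s \<in> lifetimes \<phi>" "t < s" unfolding life_def less_SUP_iff by auto
  then show "t \<in> lifetimes \<phi>" using lifetimes_mono assms(2) by simp
next
  assume "t \<in> lifetimes \<phi>"
  then obtain s where s: "t < s" "s \<in> lifetimes \<phi>" using lifetimes_open[OF assms(1)] by blast
  then show "ereal t < life \<phi>" unfolding life_def less_SUP_iff by (intro bexI[of _ s]) auto
qed

lemma extended_solution_on_manifold:
  assumes "\<phi> \<in> solution_manifold f U"
  shows "extended_solution T \<phi> x \<longleftrightarrow> left_solution (\<lambda>t. f) (UNIV \<times> U) \<phi> T x"
proof -
  have "defect \<phi> = 0" using assms by (simp add: solution_manifold_iff)
  then show ?thesis unfolding extended_solution_def by simp
qed

lemma maximal_trajectory: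
  assumes \<phi>: "\<phi> \<in> solution_manifold f U"
  shows "maximal_solution (\<lambda>t. f) (UNIV \<times> U) \<phi> (life \<phi>) (trajectory \<phi>)"
proof -
  have \<phi>U: "\<phi> \<in> U" using \<phi> unfolding solution_manifold_def by blast
  show ?thesis
  proof (rule maximal_solutionI)
    show "local_lipschitz_dde (\<lambda>t. f) (UNIV \<times> U)" using local_lipschitz_extended[of 0] by simp
    show "left_solution (\<lambda>t. f) (UNIV \<times> U) \<phi> t (trajectory \<phi>)" if "0 \<le> t" "ereal t < life \<phi>" for t
      using trajectory_solution that less_life_iff[OF \<phi>U] extended_solution_on_manifold[OF \<phi>] by blast
    show "ereal t < life \<phi>" if y: "left_solution (\<lambda>t. f) (UNIV \<times> U) \<phi> t y" for t y
      using less_life_iff[OF \<phi>U left_solutionD(1)[OF y]] y extended_solution_on_manifold[OF \<phi>]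
      unfolding lifetimes_def by blast
    show "0 < life \<phi>" using less_life_iff[OF \<phi>U order.refl] ext_flow_0(1)[OF \<phi>U] by (simp add: zero_ereal_def)
  qed
qed

lemma exit_time_eq: "\<phi> \<in> solution_manifold f U \<Longrightarrow> exit_time f U \<phi> = life \<phi>"
  unfolding exit_time_def using maximal_trajectory maximal_solution_unique(1) by (intro the_equality) blast+

lemma maximal_max_solution:
  "\<phi> \<in> solution_manifold f U \<Longrightarrow>
    maximal_solution (\<lambda>t. f) (UNIV \<times> U) \<phi> (exit_time f U \<phi>) (max_solution f U \<phi>)"
  unfolding max_solution_def exit_time_eq
  by (rule someI[of "maximal_solution (\<lambda>t. f) (UNIV \<times> U) \<phi> (life \<phi>)"]) (rule maximal_trajectory)

lemma flow_domain_iff: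
  "(t, \<phi>) \<in> flow_domain f U \<longleftrightarrow> \<phi> \<in> solution_manifold f U \<and> t \<in> lifetimes \<phi>"
proof -
  have "0 \<le> t \<and> ereal t < exit_time f U \<phi> \<longleftrightarrow> t \<in> lifetimes \<phi>" if \<phi>: "\<phi> \<in> solution_manifold f U"
    using exit_time_eq[OF \<phi>] less_life_iff[of \<phi> t] lifetimes_nonneg[of t \<phi>] \<phi>
    unfolding solution_manifold_def by auto
  then show ?thesis unfolding flow_domain_def by auto
qed

lemma flow_eq:
  assumes "(t, \<phi>) \<in> flow_domain f U" shows "flow f U (t, \<phi>) = ext_flow t \<phi>"
proof -
  have \<phi>: "\<phi> \<in> solution_manifold f U" and t: "ereal t < exit_time f U \<phi>"
    using assms unfolding flow_domain_def by auto
  have "max_solution f U \<phi> s = trajectory \<phi> s" if "s \<le> t" for s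
  proof (rule maximal_solution_unique(2)[OF maximal_trajectory[OF \<phi>] maximal_max_solution[OF \<phi>]])
    show "ereal s < life \<phi>" using t that exit_time_eq[OF \<phi>] by (metis ereal_less_eq(3) order.strict_trans1)
  qed
  then show ?thesis
    using segment_cong[of t "max_solution f U \<phi>" "trajectory \<phi>"] by (simp add: flow_def ext_flow_def c1_segment_def)
qed

lemma flow_slice_eq: "flow_slice f U t = solution_manifold f U \<inter> time_domain t"
  unfolding flow_slice_def time_domain_def flow_domain_iff solution_manifold_def by blast

lemma flow_semiflow: "continuous_semiflow (solution_manifold f U) (flow_domain f U) (flow f U)"
  unfolding continuous_semiflow_def
proof (intro conjI ballI allI impI)
  show "flow_domain f U \<subseteq> {0..} \<times> solution_manifold f U" unfolding flow_domain_def by auto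
  have mem: "ext_flow t \<phi> \<in> solution_manifold f U" if "(t, \<phi>) \<in> flow_domain f U" for t \<phi>
    using that ext_flow_in_U defect_ext_flow unfolding flow_domain_iff solution_manifold_iff by auto
  then show "flow f U ` flow_domain f U \<subseteq> solution_manifold f U" using flow_eq by auto
  have "continuous_on (flow_domain f U) (\<lambda>p. ext_flow (fst p) (snd p))"
    by (rule continuous_on_subset[OF continuous_ext_flow]) (auto simp: flow_domain_iff solution_manifold_iff)
  then show "continuous_on (flow_domain f U) (flow f U)"
    by (rule continuous_on_eq) (auto simp: flow_eq)
  fix \<phi> assume \<phi>: "\<phi> \<in> solution_manifold f U"
  then have "\<phi> \<in> U" unfolding solution_manifold_def by blast
  then show "(0, \<phi>) \<in> flow_domain f U" using ext_flow_0 \<phi> by (simp add: flow_domain_iff)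
  then show "flow f U (0, \<phi>) = \<phi>" using ext_flow_0(2)[OF \<open>\<phi> \<in> U\<close>] flow_eq by simp
next
  fix t s \<phi> assume *: "(t, \<phi>) \<in> flow_domain f U \<and> (s, flow f U (t, \<phi>)) \<in> flow_domain f U"
  then have s: "s \<in> lifetimes (ext_flow t \<phi>)" and t: "t \<in> lifetimes \<phi>" and \<phi>: "\<phi> \<in> solution_manifold f U"
    using flow_eq[of t \<phi>] by (auto simp: flow_domain_iff)
  note add = ext_flow_add[OF t s]
  show st: "(s + t, \<phi>) \<in> flow_domain f U" using add(1) \<phi> by (simp add: flow_domain_iff add.commute)
  show "flow f U (s + t, \<phi>) = flow f U (s, flow f U (t, \<phi>))"
    using add(2) flow_eq[OF st] * flow_eq[of t \<phi>] flow_eq[of s "flow f U (t, \<phi>)"] by (simp add: add.commute)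
qed

lemma open_time_domain: "0 \<le> t \<Longrightarrow> open (time_domain t)"
  using hadamard_C1D(1)[OF ext_flow_C1] .

text \<open>The charts are arbitrary, over any model space. The inverse chart is smooth and maps
  into the slice, where the time map is the restriction of \<open>ext_flow t\<close>, which is
  smooth on an open set.\<close>

lemma flow_time_map_smooth:
  assumes t: "0 \<le> t"
  shows "C1F_on_submanifold (flow_slice f U t) (\<lambda>\<phi>. flow f U (t, \<phi>))"
  unfolding C1F_on_submanifold_def
proof (intro conjI allI impI)
  show "\<exists>G. C1F_submanifold G (flow_slice f U t)"
    unfolding flow_slice_eq using C1F_submanifold_solution_manifold[OF open_time_domain[OF t]] by blast
  fix G V W K
  assume chart: "C1F_submanifold G (flow_slice f U t) \<and> submanifold_chart G (flow_slice f U t) V W K"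
  then have G: "subspace G" unfolding C1F_submanifold_def closed_complemented_def by blast
  have K: "bij_betw K V W" "C1F_on UNIV W (inv_into V K)" "K ` (flow_slice f U t \<inter> V) = W \<inter> G"
    using chart unfolding submanifold_chart_def C1F_diffeo_def by auto
  have inM: "inv_into V K \<psi> \<in> flow_slice f U t" if "\<psi> \<in> W \<inter> G" for \<psi>
  proof -
    have "\<psi> \<in> K ` (flow_slice f U t \<inter> V)" using that unfolding K(3) .
    then obtain \<phi> where "\<psi> = K \<phi>" "\<phi> \<in> flow_slice f U t \<inter> V" by (rule imageE)
    then show ?thesis using inv_into_f_f[OF bij_betw_imp_inj_on[OF K(1)], of \<phi>] by simp
  qed
  have "C1F_on G (W \<inter> G) (ext_flow t \<circ> inv_into V K)"
    using inM by (intro C1F_on_compose[OF K(2) ext_flow_C1[OF t] G]) (auto simp: flow_slice_eq)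
  then show "C1F_on G (W \<inter> G) ((\<lambda>\<phi>. flow f U (t, \<phi>)) \<circ> inv_into V K)"
  proof (rule C1F_on_cong)
    show "(ext_flow t \<circ> inv_into V K) \<psi> = ((\<lambda>\<phi>. flow f U (t, \<phi>)) \<circ> inv_into V K) \<psi>" if "\<psi> \<in> W \<inter> G" for \<psi>
      using inM[OF that] by (simp add: flow_slice_def flow_eq)
  qed
qed

text \<open>Vanishing of \<open>linear_defect \<phi> \<eta>\<close> removes the inhomogeneity. The
  equation is posed only at times where the flow through \<phi> is defined, so no solution outlives
  \<open>life \<phi>\<close>.\<close>

lemma maximal_variation:
  assumes \<phi>: "\<phi> \<in> solution_manifold f U" and \<eta>: "linear_defect \<phi> \<eta> = 0"
  shows "maximal_solution (\<lambda>t. Df (flow f U (t, \<phi>))) ({t. (t, \<phi>) \<in> flow_domain f U} \<times> UNIV)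
    \<eta> (life \<phi>) (variation \<phi> \<eta>)"
proof -
  have \<phi>U: "\<phi> \<in> U" using \<phi> unfolding solution_manifold_def by blast
  let ?I = "{t. (t, \<phi>) \<in> flow_domain f U}"
  have "continuous_on (flow_domain f U) (flow f U)"
    using flow_semiflow unfolding continuous_semiflow_def by blast
  moreover have "continuous_on ?I (\<lambda>t. (t, \<phi>))" by (intro continuous_intros)
  ultimately have "continuous_on ?I (\<lambda>t. flow f U (t, \<phi>))" by (rule continuous_on_compose2) auto
  moreover have "(\<lambda>t. flow f U (t, \<phi>)) ` ?I \<subseteq> U"
    using ext_flow_in_U by (auto simp: flow_eq flow_domain_iff)
  ultimately have lip: "local_lipschitz_dde (\<lambda>t. Df (flow f U (t, \<phi>))) (?I \<times> UNIV)"
    using local_lipschitz_linear[of "\<lambda>t. flow f U (t, \<phi>)" ?I 0] by simp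
  show ?thesis
  proof (rule maximal_solutionI[OF lip])
    fix t assume t: "0 \<le> t" "ereal t < life \<phi>"
    then have T: "t \<in> lifetimes \<phi>" using less_life_iff[OF \<phi>U] by blast
    have "(s, \<psi>) \<in> ?I \<times> UNIV \<and> Df (flow f U (s, \<phi>)) \<psi> = Df (ext_flow s \<phi>) \<psi> + linear_defect \<phi> \<eta>"
      if "0 \<le> s" "s \<le> t" for s and \<psi> :: "'n c1_space"
    proof -
      have "(s, \<phi>) \<in> flow_domain f U" using lifetimes_mono[OF T that] \<phi> by (simp add: flow_domain_iff)
      then show ?thesis using flow_eq \<eta> by simp
    qed
    then show "left_solution (\<lambda>t. Df (flow f U (t, \<phi>))) (?I \<times> UNIV) \<eta> t (variation \<phi> \<eta>)"
      by (intro left_solution_change[OF variation_solution(1)[OF \<phi>U T]])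
  next
    fix t y assume y: "left_solution (\<lambda>t. Df (flow f U (t, \<phi>))) (?I \<times> UNIV) \<eta> t y"
    have t: "0 \<le> t" using left_solutionD(1)[OF y] .
    have "(t, \<phi>) \<in> flow_domain f U" using left_solutionD(4)[OF y t order.refl] by simp
    then show "ereal t < life \<phi>" using less_life_iff[OF \<phi>U t] by (simp add: flow_domain_iff)
  next
    show "0 < life \<phi>" using less_life_iff[OF \<phi>U order.refl] ext_flow_0(1)[OF \<phi>U] by (simp add: zero_ereal_def)
  qed
qed

text \<open>A curve in the manifold stays in the open domain of the time map for small parameters,
  so \<eta> is tangent to the slice too. Along curves in the slice the flow equals
  \<open>ext_flow t\<close>, which is differentiable in all directions, and the chain rule
  applies.\<close>

lemma flow_tangent_deriv:
  assumes t: "(t, \<phi>) \<in> flow_domain f U" and \<eta>: "\<eta> \<in> tangent_space (solution_manifold f U) \<phi>"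
  shows "has_tangent_deriv (flow_slice f U t) (\<lambda>\<psi>. flow f U (t, \<psi>)) \<phi> \<eta> (c1_segment (variation \<phi> \<eta>) t)"
  unfolding has_tangent_deriv_def
proof (intro conjI allI impI)
  have tl: "t \<in> lifetimes \<phi>" and \<phi>U: "\<phi> \<in> U" using t by (auto simp: flow_domain_iff solution_manifold_def)
  have t0: "0 \<le> t" using lifetimes_nonneg[OF tl] .
  have \<phi>t: "\<phi> \<in> time_domain t" using tl \<phi>U by (simp add: time_domain_def)
  obtain c where c: "C1_curve (solution_manifold f U) \<phi> \<eta> c" using \<eta> unfolding tangent_space_def by blast
  then obtain J c' where J: "is_interval J" "open J" "0 \<in> J" "c ` J \<subseteq> solution_manifold f U"
    "\<forall>t\<in>J. has_dir_deriv c t 1 (c' t)" "continuous_on J c'" "c 0 = \<phi>" "c' 0 = \<eta>"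
    unfolding C1_curve_def by blast
  from topological_tendstoD[OF C1_curve_tendsto[OF c] open_time_domain[OF t0] \<phi>t]
  obtain e where e: "e > 0" "\<And>s. s \<noteq> 0 \<Longrightarrow> dist s 0 < e \<Longrightarrow> c s \<in> time_domain t"
    unfolding eventually_at by blast
  have in_dom: "c s \<in> time_domain t" if "s \<in> {- e<..<e}" for s
    using e(2)[of s] that J(7) \<phi>t by (cases "s = 0") (auto simp: dist_real_def)
  have "C1_curve (flow_slice f U t) \<phi> \<eta> c"
    unfolding C1_curve_def
  proof (intro exI[of _ "J \<inter> {- e<..<e}"] exI[of _ c'] conjI)
    show "is_interval (J \<inter> {- e<..<e})" by (rule is_interval_Int[OF J(1) is_interval_oo])
    show "c ` (J \<inter> {- e<..<e}) \<subseteq> flow_slice f U t" using J(4) in_dom unfolding flow_slice_eq by auto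
    show "open (J \<inter> {- e<..<e})" using J(2) by (intro open_Int open_greaterThanLessThan)
    show "0 \<in> J \<inter> {- e<..<e}" using J(3) e(1) by simp
    show "\<forall>t\<in>J \<inter> {- e<..<e}. has_dir_deriv c t 1 (c' t)" using J(5) by blast
    show "continuous_on (J \<inter> {- e<..<e}) c'" by (rule continuous_on_subset[OF J(6)]) blast
  qed (rule J(7,8))+
  then show "\<eta> \<in> tangent_space (flow_slice f U t) \<phi>" unfolding tangent_space_def by blast
  fix c assume "C1_curve (flow_slice f U t) \<phi> \<eta> c"
  then obtain J where J: "open J" "0 \<in> J" "c ` J \<subseteq> flow_slice f U t" and c: "has_dir_deriv c 0 1 \<eta>" "c 0 = \<phi>"
    unfolding C1_curve_def by auto
  have "has_dir_deriv (ext_flow t \<circ> c) 0 1 (dir_deriv (ext_flow t) \<phi> \<eta>)"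
    using has_dir_deriv_compose[OF _ c(1)] hadamard_C1D(4)[OF ext_flow_C1[OF t0] \<phi>t] c(2) by blast
  then have "has_dir_deriv ((\<lambda>\<psi>. flow f U (t, \<psi>)) \<circ> c) 0 1 (dir_deriv (ext_flow t) \<phi> \<eta>)"
  proof (rule has_dir_deriv_cong[where G = UNIV and U = J])
    show "(ext_flow t \<circ> c) s = ((\<lambda>\<psi>. flow f U (t, \<psi>)) \<circ> c) s" if "s \<in> J" for s
    proof -
      have "(t, c s) \<in> flow_domain f U" using J(3) that unfolding flow_slice_def by blast
      from flow_eq[OF this] show ?thesis by simp
    qed
  qed (use J in auto)
  then show "has_dir_deriv ((\<lambda>\<psi>. flow f U (t, \<psi>)) \<circ> c) 0 1 (c1_segment (variation \<phi> \<eta>) t)"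
    using variation_solution(2)[OF \<phi>U tl] by simp
qed

end

theorem mainTheorem1:
  fixes f :: "'n::finite c1_space \<Rightarrow> real ^ 'n" and U :: "'n c1_space set"
  assumes "open U"
    and "C1F_on UNIV U f"
    and "property_e f U"
    and "solution_manifold f U \<noteq> {}"
  shows "(\<forall>\<phi> \<in> solution_manifold f U.
           maximal_solution (\<lambda>t. f) (UNIV \<times> U) \<phi> (exit_time f U \<phi>) (max_solution f U \<phi>))
         \<and> continuous_semiflow (solution_manifold f U) (flow_domain f U) (flow f U)
         \<and> (\<forall>t\<ge>0. openin (top_of_set (solution_manifold f U)) (flow_slice f U t) \<and>
           (flow_slice f U t \<noteq> {} \<longrightarrow>
             C1F_on_submanifold (flow_slice f U t) (\<lambda>\<phi>. flow f U (t, \<phi>))))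
         \<and> (\<forall>\<phi> \<in> solution_manifold f U. \<forall>\<eta> \<in> tangent_space (solution_manifold f U) \<phi>.
           \<exists>T v. maximal_solution (\<lambda>t. dir_deriv f (flow f U (t, \<phi>)))
                   ({t. (t, \<phi>) \<in> flow_domain f U} \<times> UNIV) \<eta> T v \<and>
             (\<forall>t. (t, \<phi>) \<in> flow_domain f U \<longrightarrow> ereal t < T \<and>
               has_tangent_deriv (flow_slice f U t) (\<lambda>\<psi>. flow f U (t, \<psi>)) \<phi> \<eta> (c1_segment v t)))"
proof -
  interpret smooth_delay_equation f U using assms by unfold_locales
  show ?thesis
  proof (intro conjI ballI allI impI)
    show "maximal_solution (\<lambda>t. f) (UNIV \<times> U) \<phi> (exit_time f U \<phi>) (max_solution f U \<phi>)"
      if "\<phi> \<in> solution_manifold f U" for \<phi>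
      using maximal_max_solution[OF that] .
    show "continuous_semiflow (solution_manifold f U) (flow_domain f U) (flow f U)"
      by (rule flow_semiflow)
    show "openin (top_of_set (solution_manifold f U)) (flow_slice f U t)" if "0 \<le> t" for t
      unfolding flow_slice_eq using open_time_domain[OF that] by (rule openin_open_Int)
    show "C1F_on_submanifold (flow_slice f U t) (\<lambda>\<phi>. flow f U (t, \<phi>))" if "0 \<le> t" for t
      using flow_time_map_smooth[OF that] .
    fix \<phi> \<eta> assume \<phi>: "\<phi> \<in> solution_manifold f U" and \<eta>: "\<eta> \<in> tangent_space (solution_manifold f U) \<phi>"
    have "ereal t < life \<phi>" if "(t, \<phi>) \<in> flow_domain f U" for t
      using that exit_time_eq[OF \<phi>] unfolding flow_domain_def by auto
    then show "\<exists>T v. maximal_solution (\<lambda>t. dir_deriv f (flow f U (t, \<phi>)))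
                   ({t. (t, \<phi>) \<in> flow_domain f U} \<times> UNIV) \<eta> T v \<and>
             (\<forall>t. (t, \<phi>) \<in> flow_domain f U \<longrightarrow> ereal t < T \<and>
               has_tangent_deriv (flow_slice f U t) (\<lambda>\<psi>. flow f U (t, \<psi>)) \<phi> \<eta> (c1_segment v t))"
      using maximal_variation[OF \<phi> slope_tangent[OF \<phi> \<eta>]] flow_tangent_deriv[OF _ \<eta>]
      by (intro exI[of _ "life \<phi>"] exI[of _ "variation \<phi> \<eta>"]) auto
  qed
qed

end
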